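(* Let $R\stackrel{\pi}{\to}\Gamma\rightrightarrows M$ be an $S^1$-central extension of groupoids, where the orbit space $M/\Gamma$ is path-connected, and let $L\to M$ be a principal $S^1$-bundle over $R\rightrightarrows M$ with Chern class $[\theta+\omega]\in H^2_{dR}(R_\bullet,\mathbb{Z})$, where $\theta+\omega\in\Omega^1(R)\oplus\Omega^2(M)$. Then the index of $L$ is given by $$\mathrm{Ind}(L)=\int_{\pi^{-1}(\epsilon(m))}\theta,$$ where $\epsilon:M\to\Gamma$ is the unit map (and $m\in M$ is any point).
   Context: Groupoids and cochains. A Lie groupoid $R\rightrightarrows M$ has source $s$ and target $t$; $\gamma\gamma'$ is defined iff $t(\gamma)=s(\gamma')$. $R_0=M$ and $R_p$ is the manifold of composable $p$-tuples. $\partial:\Omega^k(R_p)\to\Omega^k(R_{p+1})$ is the alternating sum of pull-backs along the face maps, with signs such that $\partial=s^*-t^*$ on $\Omega^k(M)$ and $\partial=\mathrm{pr}_1^*-m^*+\mathrm{pr}_2^*$ on $\Omega^k(R)$. $C^n_{dR}(R_\bullet)=\bigoplus_{p+k=n}\Omega^k(R_p)$ has differential $\delta=(-1)^pd+\partial$. A de Rham cocycle is integral if its integral over every integral singular cycle of the double complex $C_k(R_p,\mathbb{Z})$ is an integer; $H^2_{dR}(R_\bullet,\mathbb{Z})$ denotes classes of integral $2$-cocycles. $S^1$-central extension. A Lie groupoid $R\rightrightarrows M$ with a groupoid morphism $\pi:R\to\Gamma$ over $\mathrm{id}_M$ and a left $S^1$-action on $R$ making $\pi$ a principal $S^1$-bundle,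 with $(s\cdot x)(t\cdot y)=st\cdot(xy)$ for $s,t\in S^1$ and composable $x,y\in R$. $S^1$-bundle over a groupoid $R\rightrightarrows M$. A (right) principal $S^1$-bundle $p:L\to M$ with a left action of $R$ on $L$ ($\gamma\cdot l$ defined iff $t(\gamma)=p(l)$, $p(\gamma\cdot l)=s(\gamma)$) commuting with the $S^1$-action. The transformation groupoid $R\times_ML\rightrightarrows L$ has source $(\gamma,l)\mapsto\gamma\cdot l$ and target $(\gamma,l)\mapsto l$, and maps to $R\rightrightarrows M$. A pseudo-connection is a connection $1$-form $\theta_L\in\Omega^1(L)$ for $L\to M$ (real valued, integral $1$ over each $S^1$-orbit); $\delta\theta_L$ is the pull-back of a unique integral $2$-cocycle in $\Omega^1(R)\oplus\Omega^2(M)$, the pseudo-curvature, whose class is the Chern class of $L$. Index. For $m\in M$ let $f_m:S^1\to R$, $f_m(\lambda)=\lambda\cdot1_m$, where $1_m\in R$ is the unit over $m$; this is a groupoid homomorphism from $S^1\rightrightarrows\cdot$ to $R\rightrightarrows M$. $H^1(R_\bullet,S^1)$ is the group of isomorphism classes of $S^1$-bundles over $R\rightrightarrows M$. One has $H^1(S^1_\bullet,S^1)\cong\mathbb{Z}$, with $k\in\mathbb{Z}$ corresponding to the bundle $B_k=S^1\to\cdot$ on which $S^1\rightrightarrows\cdot$ acts by $\lambda\cdot z=\lambda^kz$. $\mathrm{Ind}_m(L)=f_m^*[L]\in H^1(S^1_\bullet,S^1)\cong\mathbb{Z}$; since $M/\Gamma$ is path-connected it is independent of $m$ and is denoted $\mathrm{Ind}(L)$.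 The circle $\pi^{-1}(\epsilon(m))$ is oriented via $f_m:S^1\to\pi^{-1}(\epsilon(m))$. *)

theory Defs
  imports "HOL-Analysis.Analysis" "HOL-Homology.Homology"
begin

section \<open>Smooth spaces and manifolds\<close>

text \<open>
  The smooth structure of a space is given by its algebra of smooth real functions (differential
  spaces in the sense of Sikorski). This gives products and subspaces, hence fibre products, their
  standard smooth structures; a manifold is such a space that is locally diffeomorphic to
  \<open>\<real>\<^sup>n\<close>, Hausdorff and second countable. Points lie in a carrier set; the functions are
  total on the type, but membership in \<open>fns\<close> only depends on the values on the carrier.
\<close>

record 'a dspace =
  pts :: "'a set"
  fns :: "('a \<Rightarrow> real) set"

text \<open>\<open>F\<close> is of class \<open>C\<^sup>k\<close> on \<open>\<real>\<^sup>n = Euclidean_space n\<close>: all iterated partial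
  derivatives of order at most \<open>k\<close> exist and are continuous.\<close>

primrec Ck_fun :: "nat \<Rightarrow> nat \<Rightarrow> ((nat \<Rightarrow> real) \<Rightarrow> real) \<Rightarrow> bool" where
  "Ck_fun 0 n F \<longleftrightarrow> continuous_map (Euclidean_space n) euclideanreal F"
| "Ck_fun (Suc k) n F \<longleftrightarrow> continuous_map (Euclidean_space n) euclideanreal F \<and>
     (\<forall>i<n. \<exists>D. (\<forall>x\<in>topspace (Euclidean_space n).
         ((\<lambda>h. F (x(i := h))) has_real_derivative D x) (at (x i))) \<and> Ck_fun k n D)"

definition smooth_fun :: "nat \<Rightarrow> ((nat \<Rightarrow> real) \<Rightarrow> real) \<Rightarrow> bool" where
  "smooth_fun n F \<longleftrightarrow> (\<forall>k. Ck_fun k n F)"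

definition init_top :: "'a set \<Rightarrow> ('a \<Rightarrow> real) set \<Rightarrow> 'a topology" where
  "init_top S G = topology_generated_by (insert S {{x \<in> S. g x \<in> V} | g V. g \<in> G \<and> open V})"

text \<open>The smooth structure on \<open>S\<close> generated by \<open>G\<close>: functions that are locally a smooth
  function of finitely many members of \<open>G\<close>.\<close>

definition gen_space :: "'a set \<Rightarrow> ('a \<Rightarrow> real) set \<Rightarrow> 'a dspace" where
  "gen_space S G = \<lparr>pts = S, fns = {f. \<forall>x\<in>S. \<exists>n g F W.
      (\<forall>i<n. g i \<in> G) \<and> smooth_fun n F \<and> openin (init_top S G) W \<and> x \<in> W \<and>
      (\<forall>y\<in>W. f y = F (\<lambda>i. if i < n then g i y else 0))}\<rparr>"

definition dtop :: "'a dspace \<Rightarrow> 'a topology" where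
  "dtop X = init_top (pts X) (fns X)"

definition subspace_of :: "'a dspace \<Rightarrow> 'a set \<Rightarrow> 'a dspace" where
  "subspace_of X S = gen_space (pts X \<inter> S) (fns X)"

definition prod_space :: "'a dspace \<Rightarrow> 'b dspace \<Rightarrow> ('a \<times> 'b) dspace" where
  "prod_space X Y = gen_space (pts X \<times> pts Y)
     ((\<lambda>f. f \<circ> fst) ` fns X \<union> (\<lambda>f. f \<circ> snd) ` fns Y)"

definition Rn :: "nat \<Rightarrow> (nat \<Rightarrow> real) dspace" where
  "Rn n = gen_space (topspace (Euclidean_space n)) {\<lambda>x. x i | i. i < n}"

definition circle :: "complex dspace" where
  "circle = gen_space (sphere 0 1) {Re, Im}"

definition point :: "unit dspace" where
  "point = gen_space UNIV {}"

definition smooth_map :: "'a dspace \<Rightarrow> 'b dspace \<Rightarrow> ('a \<Rightarrow> 'b) \<Rightarrow> bool" where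
  "smooth_map X Y f \<longleftrightarrow> f ` pts X \<subseteq> pts Y \<and> (\<forall>g\<in>fns Y. g \<circ> f \<in> fns X)"

definition diffeo :: "'a dspace \<Rightarrow> 'b dspace \<Rightarrow> ('a \<Rightarrow> 'b) \<Rightarrow> bool" where
  "diffeo X Y f \<longleftrightarrow> smooth_map X Y f \<and> bij_betw f (pts X) (pts Y) \<and>
     smooth_map Y X (inv_into (pts X) f)"

definition manifold :: "'a dspace \<Rightarrow> bool" where
  "manifold X \<longleftrightarrow> X = gen_space (pts X) (fns X) \<and>
     Hausdorff_space (dtop X) \<and> second_countable (dtop X) \<and>
     (\<forall>x\<in>pts X. \<exists>U n V \<phi>. openin (dtop X) U \<and> x \<in> U \<and> openin (Euclidean_space n) V \<and>
        diffeo (subspace_of X U) (subspace_of (Rn n) V) \<phi>)"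

section \<open>Tangent vectors and differential forms\<close>

text \<open>Tangent vectors are derivations of the algebra of smooth functions. The value on functions
  that are not smooth is normalised to 0, so that equality of vectors is equality of functionals.\<close>

type_synonym 'a tvec = "('a \<Rightarrow> real) \<Rightarrow> real"
type_synonym 'a form = "'a \<Rightarrow> 'a tvec list \<Rightarrow> real"

definition tangent :: "'a dspace \<Rightarrow> 'a \<Rightarrow> 'a tvec set" where
  "tangent X x = {v. (\<forall>f. f \<notin> fns X \<longrightarrow> v f = 0) \<and>
     (\<forall>f\<in>fns X. \<forall>g\<in>fns X. \<forall>a b. v (\<lambda>y. a * f y + b * g y) = a * v f + b * v g) \<and>
     (\<forall>f\<in>fns X. \<forall>g\<in>fns X. v (\<lambda>y. f y * g y) = f x * v g + g x * v f)}"

text \<open>Push-forward of a tangent vector along a map with target \<open>Y\<close>.\<close>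

definition dmap :: "'b dspace \<Rightarrow> ('a \<Rightarrow> 'b) \<Rightarrow> 'a tvec \<Rightarrow> 'b tvec" where
  "dmap Y f v = (\<lambda>g. if g \<in> fns Y then v (g \<circ> f) else 0)"

definition velocity :: "'a dspace \<Rightarrow> (real \<Rightarrow> 'a) \<Rightarrow> real \<Rightarrow> 'a tvec" where
  "velocity X c t = (\<lambda>g. if g \<in> fns X then deriv (\<lambda>u. g (c u)) t else 0)"

definition submersion :: "'a dspace \<Rightarrow> 'b dspace \<Rightarrow> ('a \<Rightarrow> 'b) \<Rightarrow> bool" where
  "submersion X Y f \<longleftrightarrow> smooth_map X Y f \<and>
     (\<forall>x\<in>pts X. dmap Y f ` tangent X x = tangent Y (f x))"

definition vector_field :: "'a dspace \<Rightarrow> ('a \<Rightarrow> 'a tvec) \<Rightarrow> bool" where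
  "vector_field X V \<longleftrightarrow> (\<forall>x\<in>pts X. V x \<in> tangent X x) \<and>
     (\<forall>f\<in>fns X. (\<lambda>x. V x f) \<in> fns X)"

definition bracket :: "'a dspace \<Rightarrow> ('a \<Rightarrow> 'a tvec) \<Rightarrow> ('a \<Rightarrow> 'a tvec) \<Rightarrow> 'a \<Rightarrow> 'a tvec" where
  "bracket X V W x = (\<lambda>f. if f \<in> fns X then V x (\<lambda>y. W y f) - W x (\<lambda>y. V y f) else 0)"

text \<open>Smooth differential \<open>k\<close>-forms; values outside the carrier, on lists of other lengths or on
  non-tangent vectors are irrelevant, so that forms are compared with \<open>form_eq\<close>.\<close>

definition diff_form :: "'a dspace \<Rightarrow> nat \<Rightarrow> 'a form \<Rightarrow> bool" where
  "diff_form X k \<omega> \<longleftrightarrow>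
     (\<forall>x\<in>pts X. \<forall>vs. length vs = k \<and> set vs \<subseteq> tangent X x \<longrightarrow>
        (\<forall>i<k. \<forall>u\<in>tangent X x. \<forall>w\<in>tangent X x. \<forall>a b.
           \<omega> x (vs[i := (\<lambda>f. a * u f + b * w f)]) = a * \<omega> x (vs[i := u]) + b * \<omega> x (vs[i := w])) \<and>
        (\<not> distinct vs \<longrightarrow> \<omega> x vs = 0)) \<and>
     (\<forall>Vs. length Vs = k \<and> (\<forall>V\<in>set Vs. vector_field X V) \<longrightarrow>
        (\<lambda>x. \<omega> x (map (\<lambda>V. V x) Vs)) \<in> fns X)"

definition form_eq :: "'a dspace \<Rightarrow> nat \<Rightarrow> 'a form \<Rightarrow> 'a form \<Rightarrow> bool" where
  "form_eq X k \<omega> \<eta> \<longleftrightarrow>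
     (\<forall>x\<in>pts X. \<forall>vs. length vs = k \<and> set vs \<subseteq> tangent X x \<longrightarrow> \<omega> x vs = \<eta> x vs)"

definition zero_form :: "'a form" where "zero_form = (\<lambda>x vs. 0)"
definition add_form :: "'a form \<Rightarrow> 'a form \<Rightarrow> 'a form" where
  "add_form \<omega> \<eta> = (\<lambda>x vs. \<omega> x vs + \<eta> x vs)"
definition sub_form :: "'a form \<Rightarrow> 'a form \<Rightarrow> 'a form" where
  "sub_form \<omega> \<eta> = (\<lambda>x vs. \<omega> x vs - \<eta> x vs)"

definition pullback :: "'b dspace \<Rightarrow> ('a \<Rightarrow> 'b) \<Rightarrow> 'b form \<Rightarrow> 'a form" where
  "pullback Y f \<omega> = (\<lambda>x vs. \<omega> (f x) (map (dmap Y f) vs))"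

text \<open>Exterior derivative: \<open>df(v) = v f\<close> in degree 0, and Koszul's invariant formula in positive
  degree, evaluated on vector fields through the given tangent vectors (on a manifold such fields
  exist and the value does not depend on their choice).\<close>

definition koszul :: "'a dspace \<Rightarrow> nat \<Rightarrow> 'a form \<Rightarrow> 'a \<Rightarrow> (nat \<Rightarrow> 'a \<Rightarrow> 'a tvec) \<Rightarrow> real" where
  "koszul X k \<omega> x V =
     (\<Sum>i\<le>k. (-1) ^ i * V i x (\<lambda>y. \<omega> y (map (\<lambda>l. V l y) (filter (\<lambda>l. l \<noteq> i) [0..<Suc k])))) +
     (\<Sum>j\<le>k. \<Sum>i<j. (-1) ^ (i + j) *
        \<omega> x (bracket X (V i) (V j) x #
             map (\<lambda>l. V l x) (filter (\<lambda>l. l \<noteq> i \<and> l \<noteq> j) [0..<Suc k])))"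

definition ext_d :: "'a dspace \<Rightarrow> nat \<Rightarrow> 'a form \<Rightarrow> 'a form" where
  "ext_d X k \<omega> = (\<lambda>x vs. if k = 0 then hd vs (\<lambda>y. \<omega> y [])
     else koszul X k \<omega> x (SOME V. \<forall>i\<le>k. vector_field X (V i) \<and> V i x = vs ! i))"

section \<open>Integration\<close>

definition loop_integral :: "'a dspace \<Rightarrow> (complex \<Rightarrow> 'a) \<Rightarrow> 'a form \<Rightarrow> real" where
  "loop_integral X f \<theta> = integral {0..1}
     (\<lambda>t. \<theta> (f (cis (2 * pi * t))) [velocity X (\<lambda>u. f (cis (2 * pi * u))) t])"

text \<open>Integral over an embedded circle \<open>C\<close>, oriented by the parametrisation \<open>f : S\<^sup>1 \<rightarrow> C\<close>.\<close>

definition circle_integral :: "'a dspace \<Rightarrow> 'a set \<Rightarrow> (complex \<Rightarrow> 'a) \<Rightarrow> 'a form \<Rightarrow> real" where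
  "circle_integral X C f \<theta> =
     (if diffeo circle (subspace_of X C) f then loop_integral X f \<theta> else undefined)"

definition smooth_chain :: "nat \<Rightarrow> 'a dspace \<Rightarrow> 'a chain \<Rightarrow> bool" where
  "smooth_chain k X c \<longleftrightarrow> singular_chain k (dtop X) c \<and>
     (\<forall>\<sigma>\<in>Poly_Mapping.keys c. smooth_map (subspace_of (Rn (Suc k)) (standard_simplex k)) X \<sigma>)"

text \<open>The standard simplex is parametrised by its barycentric coordinates \<open>u\<^sub>1, \<dots>, u\<^sub>k\<close>, which
  gives the orientation for which Stokes' theorem holds with the usual boundary operator. The
  boundary, where the partial derivatives of \<open>\<sigma>\<close> are only one-sided, is left out.\<close>

definition bary :: "nat \<Rightarrow> (nat \<Rightarrow> real) \<Rightarrow> nat \<Rightarrow> real" where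
  "bary k u = (\<lambda>i. if i = 0 then 1 - (\<Sum>j=1..k. u j) else if i \<le> k then u i else 0)"

definition simplex_integral :: "'a dspace \<Rightarrow> nat \<Rightarrow> 'a form \<Rightarrow> ((nat \<Rightarrow> real) \<Rightarrow> 'a) \<Rightarrow> real" where
  "simplex_integral X k \<omega> \<sigma> =
     (LINT u : {u. (\<forall>i\<in>{1..k}. 0 < u i) \<and> (\<Sum>i=1..k. u i) < 1} | (\<Pi>\<^sub>M i\<in>{1..k}. lborel).
        \<omega> (\<sigma> (bary k u))
          (map (\<lambda>j. velocity X (\<lambda>h. \<sigma> (bary k (u(j := h)))) (u j)) [1..<Suc k]))"

definition chain_integral :: "'a dspace \<Rightarrow> nat \<Rightarrow> 'a form \<Rightarrow> 'a chain \<Rightarrow> real" where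
  "chain_integral X k \<omega> c =
     (\<Sum>\<sigma>\<in>Poly_Mapping.keys c. of_int (Poly_Mapping.lookup c \<sigma>) * simplex_integral X k \<omega> \<sigma>)"

section \<open>Lie groupoids\<close>

text \<open>The product \<open>mul G g h\<close> is defined iff \<open>tgt G g = src G h\<close>.\<close>

record ('m, 'r) groupoid =
  ob :: "'m dspace"
  ar :: "'r dspace"
  src :: "'r \<Rightarrow> 'm"
  tgt :: "'r \<Rightarrow> 'm"
  idn :: "'m \<Rightarrow> 'r"
  ginv :: "'r \<Rightarrow> 'r"
  mul :: "'r \<Rightarrow> 'r \<Rightarrow> 'r"

definition ar2 :: "('m, 'r) groupoid \<Rightarrow> ('r \<times> 'r) dspace" where
  "ar2 G = subspace_of (prod_space (ar G) (ar G)) {(g, h). tgt G g = src G h}"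

definition ar3 :: "('m, 'r) groupoid \<Rightarrow> ('r \<times> 'r \<times> 'r) dspace" where
  "ar3 G = subspace_of (prod_space (ar G) (prod_space (ar G) (ar G)))
     {(g, h, k). tgt G g = src G h \<and> tgt G h = src G k}"

definition lie_groupoid :: "('m, 'r) groupoid \<Rightarrow> bool" where
  "lie_groupoid G \<longleftrightarrow>
     manifold (ob G) \<and> manifold (ar G) \<and>
     submersion (ar G) (ob G) (src G) \<and> submersion (ar G) (ob G) (tgt G) \<and>
     smooth_map (ob G) (ar G) (idn G) \<and> smooth_map (ar G) (ar G) (ginv G) \<and>
     smooth_map (ar2 G) (ar G) (\<lambda>(g, h). mul G g h) \<and>
     (\<forall>(g, h)\<in>pts (ar2 G). src G (mul G g h) = src G g \<and> tgt G (mul G g h) = tgt G h) \<and>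
     (\<forall>(g, h, k)\<in>pts (ar3 G). mul G (mul G g h) k = mul G g (mul G h k)) \<and>
     (\<forall>x\<in>pts (ob G). src G (idn G x) = x \<and> tgt G (idn G x) = x) \<and>
     (\<forall>g\<in>pts (ar G). mul G (idn G (src G g)) g = g \<and> mul G g (idn G (tgt G g)) = g \<and>
        src G (ginv G g) = tgt G g \<and> tgt G (ginv G g) = src G g \<and>
        mul G g (ginv G g) = idn G (src G g) \<and> mul G (ginv G g) g = idn G (tgt G g))"

definition groupoid_morphism ::
  "('m, 'r) groupoid \<Rightarrow> ('n, 'q) groupoid \<Rightarrow> ('m \<Rightarrow> 'n) \<Rightarrow> ('r \<Rightarrow> 'q) \<Rightarrow> bool" where
  "groupoid_morphism G H f0 f1 \<longleftrightarrow>
     smooth_map (ob G) (ob H) f0 \<and> smooth_map (ar G) (ar H) f1 \<and>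
     (\<forall>g\<in>pts (ar G). src H (f1 g) = f0 (src G g) \<and> tgt H (f1 g) = f0 (tgt G g)) \<and>
     (\<forall>x\<in>pts (ob G). f1 (idn G x) = idn H (f0 x)) \<and>
     (\<forall>(g, h)\<in>pts (ar2 G). f1 (mul G g h) = mul H (f1 g) (f1 h))"

definition orbit :: "('m, 'r) groupoid \<Rightarrow> 'm \<Rightarrow> 'm set" where
  "orbit G x = {tgt G g | g. g \<in> pts (ar G) \<and> src G g = x}"

text \<open>The orbit set with the quotient topology.\<close>

definition orbit_space :: "('m, 'r) groupoid \<Rightarrow> 'm set topology" where
  "orbit_space G = topology (\<lambda>U. U \<subseteq> orbit G ` pts (ob G) \<and>
     openin (dtop (ob G)) {x \<in> pts (ob G). orbit G x \<in> U})"

lemma topspace_dtop [simp]: "topspace (dtop X) = pts X"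
  by (auto simp: dtop_def init_top_def topology_generated_by_topspace)

lemma openin_orbit_space:
  "openin (orbit_space G) U \<longleftrightarrow> U \<subseteq> orbit G ` pts (ob G) \<and>
     openin (dtop (ob G)) {x \<in> pts (ob G). orbit G x \<in> U}"
proof -
  have "istopology (\<lambda>U. U \<subseteq> orbit G ` pts (ob G) \<and>
     openin (dtop (ob G)) {x \<in> pts (ob G). orbit G x \<in> U})" (is "istopology ?P")
    unfolding istopology_def
  proof (intro conjI allI impI)
    fix S T assume *: "?P S" "?P T"
    show "S \<inter> T \<subseteq> orbit G ` pts (ob G)" using * by blast
    have "{x \<in> pts (ob G). orbit G x \<in> S \<inter> T} =
        {x \<in> pts (ob G). orbit G x \<in> S} \<inter> {x \<in> pts (ob G). orbit G x \<in> T}" by blast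
    then show "openin (dtop (ob G)) {x \<in> pts (ob G). orbit G x \<in> S \<inter> T}"
      using * by (simp only: openin_Int)
  next
    fix K assume *: "\<forall>S\<in>K. ?P S"
    show "\<Union>K \<subseteq> orbit G ` pts (ob G)" using * by blast
    have "{x \<in> pts (ob G). orbit G x \<in> \<Union>K} =
        (\<Union>S\<in>K. {x \<in> pts (ob G). orbit G x \<in> S})" by blast
    moreover have "openin (dtop (ob G)) (\<Union>S\<in>K. {x \<in> pts (ob G). orbit G x \<in> S})"
      by (rule openin_Union) (use * in blast)
    ultimately show "openin (dtop (ob G)) {x \<in> pts (ob G). orbit G x \<in> \<Union>K}"
      by (simp only:)
  qed
  then show ?thesis by (simp add: orbit_space_def topology_inverse')
qed

lemma quotient_map_orbit_space: "quotient_map (dtop (ob G)) (orbit_space G) (orbit G)"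
proof -
  have "topspace (orbit_space G) = orbit G ` pts (ob G)"
  proof
    show "topspace (orbit_space G) \<subseteq> orbit G ` pts (ob G)"
      using openin_orbit_space[THEN iffD1, OF openin_topspace] by (rule conjunct1)
    have "{x \<in> pts (ob G). orbit G x \<in> orbit G ` pts (ob G)} = topspace (dtop (ob G))"
      by auto
    then have "openin (orbit_space G) (orbit G ` pts (ob G))"
      by (simp only: openin_orbit_space openin_topspace subset_refl simp_thms)
    then show "orbit G ` pts (ob G) \<subseteq> topspace (orbit_space G)"
      by (rule openin_subset)
  qed
  then show ?thesis
    unfolding quotient_map_def by (simp add: openin_orbit_space)
qed

section \<open>De Rham cohomology of a Lie groupoid in degree 2\<close>

text \<open>
  Cochains of degree 1 are pairs in \<open>\<Omega>\<^sup>1(R\<^sub>0) \<oplus> \<Omega>\<^sup>0(R\<^sub>1)\<close>, those of degree 2 are triples in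
  \<open>\<Omega>\<^sup>2(R\<^sub>0) \<oplus> \<Omega>\<^sup>1(R\<^sub>1) \<oplus> \<Omega>\<^sup>0(R\<^sub>2)\<close>.
\<close>

type_synonym ('m, 'r) cochain1 = "'m form \<times> 'r form"
type_synonym ('m, 'r) cochain2 = "'m form \<times> 'r form \<times> ('r \<times> 'r) form"

definition is_cochain1 :: "('m, 'r) groupoid \<Rightarrow> ('m, 'r) cochain1 \<Rightarrow> bool" where
  "is_cochain1 G = (\<lambda>(\<alpha>, f). diff_form (ob G) 1 \<alpha> \<and> diff_form (ar G) 0 f)"

definition is_cochain2 :: "('m, 'r) groupoid \<Rightarrow> ('m, 'r) cochain2 \<Rightarrow> bool" where
  "is_cochain2 G = (\<lambda>(\<omega>, \<theta>, f).
     diff_form (ob G) 2 \<omega> \<and> diff_form (ar G) 1 \<theta> \<and> diff_form (ar2 G) 0 f)"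

definition cochain2_eq :: "('m, 'r) groupoid \<Rightarrow> ('m, 'r) cochain2 \<Rightarrow> ('m, 'r) cochain2 \<Rightarrow> bool" where
  "cochain2_eq G = (\<lambda>(\<omega>, \<theta>, f) (\<omega>', \<theta>', f').
     form_eq (ob G) 2 \<omega> \<omega>' \<and> form_eq (ar G) 1 \<theta> \<theta>' \<and> form_eq (ar2 G) 0 f f')"

definition cochain2_add :: "('m, 'r) cochain2 \<Rightarrow> ('m, 'r) cochain2 \<Rightarrow> ('m, 'r) cochain2" where
  "cochain2_add = (\<lambda>(\<omega>, \<theta>, f) (\<omega>', \<theta>', f'). (add_form \<omega> \<omega>', add_form \<theta> \<theta>', add_form f f'))"

definition bd0 :: "('m, 'r) groupoid \<Rightarrow> 'm form \<Rightarrow> 'r form" where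
  "bd0 G \<omega> = sub_form (pullback (ob G) (src G) \<omega>) (pullback (ob G) (tgt G) \<omega>)"

definition bd1 :: "('m, 'r) groupoid \<Rightarrow> 'r form \<Rightarrow> ('r \<times> 'r) form" where
  "bd1 G \<theta> = add_form
     (sub_form (pullback (ar G) fst \<theta>) (pullback (ar G) (\<lambda>(g, h). mul G g h) \<theta>))
     (pullback (ar G) snd \<theta>)"

definition bd2 :: "('m, 'r) groupoid \<Rightarrow> ('r \<times> 'r) form \<Rightarrow> ('r \<times> 'r \<times> 'r) form" where
  "bd2 G f = sub_form
     (add_form
       (sub_form (pullback (ar2 G) (\<lambda>(g, h, k). (h, k)) f)
                 (pullback (ar2 G) (\<lambda>(g, h, k). (mul G g h, k)) f))
       (pullback (ar2 G) (\<lambda>(g, h, k). (g, mul G h k)) f))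
     (pullback (ar2 G) (\<lambda>(g, h, k). (g, h)) f)"

definition delta1 :: "('m, 'r) groupoid \<Rightarrow> ('m, 'r) cochain1 \<Rightarrow> ('m, 'r) cochain2" where
  "delta1 G = (\<lambda>(\<alpha>, f). (ext_d (ob G) 1 \<alpha>, sub_form (bd0 G \<alpha>) (ext_d (ar G) 0 f), bd1 G f))"

text \<open>\<open>\<delta> c = 0\<close>, written out in \<open>\<Omega>\<^sup>3(R\<^sub>0) \<oplus> \<Omega>\<^sup>2(R\<^sub>1) \<oplus> \<Omega>\<^sup>1(R\<^sub>2) \<oplus> \<Omega>\<^sup>0(R\<^sub>3)\<close>.\<close>

definition is_cocycle2 :: "('m, 'r) groupoid \<Rightarrow> ('m, 'r) cochain2 \<Rightarrow> bool" where
  "is_cocycle2 G = (\<lambda>(\<omega>, \<theta>, f). is_cochain2 G (\<omega>, \<theta>, f) \<and>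
     form_eq (ob G) 3 (ext_d (ob G) 2 \<omega>) zero_form \<and>
     form_eq (ar G) 2 (sub_form (bd0 G \<omega>) (ext_d (ar G) 1 \<theta>)) zero_form \<and>
     form_eq (ar2 G) 1 (add_form (bd1 G \<theta>) (ext_d (ar2 G) 0 f)) zero_form \<and>
     form_eq (ar3 G) 0 (bd2 G f) zero_form)"

text \<open>A 2-cycle of the double complex \<open>C\<^sub>k(R\<^sub>p, \<int>)\<close>. The boundary operator is the transpose of
  \<open>\<delta>\<close>, so its singular part on \<open>R\<^sub>p\<close> carries the sign \<open>(-1)\<^sup>p\<close>; the two equations hold in
  \<open>C\<^sub>1(R\<^sub>0, \<int>)\<close> and \<open>C\<^sub>0(R\<^sub>1, \<int>)\<close>.\<close>

definition is_cycle2 ::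
  "('m, 'r) groupoid \<Rightarrow> 'm chain \<times> 'r chain \<times> ('r \<times> 'r) chain \<Rightarrow> bool" where
  "is_cycle2 G = (\<lambda>(a, b, c).
     smooth_chain 2 (ob G) a \<and> smooth_chain 1 (ar G) b \<and> smooth_chain 0 (ar2 G) c \<and>
     chain_boundary 2 a + (chain_map 1 (src G) b - chain_map 1 (tgt G) b) = 0 \<and>
     - chain_boundary 1 b +
       (chain_map 0 fst c - chain_map 0 (\<lambda>(g, h). mul G g h) c + chain_map 0 snd c) = 0)"

definition integral_cocycle2 :: "('m, 'r) groupoid \<Rightarrow> ('m, 'r) cochain2 \<Rightarrow> bool" where
  "integral_cocycle2 G = (\<lambda>(\<omega>, \<theta>, f). is_cocycle2 G (\<omega>, \<theta>, f) \<and>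
     (\<forall>a b c. is_cycle2 G (a, b, c) \<longrightarrow>
        chain_integral (ob G) 2 \<omega> a + chain_integral (ar G) 1 \<theta> b + chain_integral (ar2 G) 0 f c
          \<in> \<int>))"

definition dR_class :: "('m, 'r) groupoid \<Rightarrow> ('m, 'r) cochain2 \<Rightarrow> ('m, 'r) cochain2 set" where
  "dR_class G c = {c'. is_cochain2 G c' \<and>
     (\<exists>b. is_cochain1 G b \<and> cochain2_eq G c' (cochain2_add c (delta1 G b)))}"

definition H2_dR_int :: "('m, 'r) groupoid \<Rightarrow> ('m, 'r) cochain2 set set" where
  "H2_dR_int G = {dR_class G c | c. integral_cocycle2 G c}"

definition cochain2_pullback ::
  "('n, 'q) groupoid \<Rightarrow> ('m \<Rightarrow> 'n) \<Rightarrow> ('r \<Rightarrow> 'q) \<Rightarrow> ('n, 'q) cochain2 \<Rightarrow> ('m, 'r) cochain2" where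
  "cochain2_pullback H f0 f1 = (\<lambda>(\<omega>, \<theta>, f).
     (pullback (ob H) f0 \<omega>, pullback (ar H) f1 \<theta>, pullback (ar2 H) (map_prod f1 f1) f))"

section \<open>Circle bundles and central extensions\<close>

text \<open>As \<open>S\<^sup>1\<close> is abelian, left and right actions need not be distinguished here:
  \<open>act z x\<close> stands for either.\<close>

definition principal_circle_bundle ::
  "'a dspace \<Rightarrow> 'b dspace \<Rightarrow> ('a \<Rightarrow> 'b) \<Rightarrow> (complex \<Rightarrow> 'a \<Rightarrow> 'a) \<Rightarrow> bool" where
  "principal_circle_bundle P B p act \<longleftrightarrow>
     manifold P \<and> manifold B \<and> smooth_map P B p \<and>
     smooth_map (prod_space circle P) P (\<lambda>(z, x). act z x) \<and>
     (\<forall>x\<in>pts P. act 1 x = x) \<and>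
     (\<forall>z\<in>pts circle. \<forall>w\<in>pts circle. \<forall>x\<in>pts P. act (z * w) x = act z (act w x)) \<and>
     (\<forall>z\<in>pts circle. \<forall>x\<in>pts P. p (act z x) = p x) \<and>
     (\<forall>b\<in>pts B. \<exists>U \<Phi>. openin (dtop B) U \<and> b \<in> U \<and>
        diffeo (prod_space (subspace_of B U) circle) (subspace_of P {x. p x \<in> U}) \<Phi> \<and>
        (\<forall>u\<in>U. \<forall>z\<in>pts circle. p (\<Phi> (u, z)) = u \<and>
           (\<forall>w\<in>pts circle. \<Phi> (u, w * z) = act w (\<Phi> (u, z)))))"

definition circle_central_extension ::
  "('m, 'g) groupoid \<Rightarrow> ('m, 'r) groupoid \<Rightarrow> ('r \<Rightarrow> 'g) \<Rightarrow> (complex \<Rightarrow> 'r \<Rightarrow> 'r) \<Rightarrow> bool" where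
  "circle_central_extension \<Gamma> R \<pi> act \<longleftrightarrow>
     lie_groupoid \<Gamma> \<and> lie_groupoid R \<and> ob R = ob \<Gamma> \<and>
     groupoid_morphism R \<Gamma> id \<pi> \<and>
     principal_circle_bundle (ar R) (ar \<Gamma>) \<pi> act \<and>
     (\<forall>(x, y)\<in>pts (ar2 R). \<forall>z\<in>pts circle. \<forall>w\<in>pts circle.
        mul R (act z x) (act w y) = act (z * w) (mul R x y))"

record ('m, 'r, 'l) circle_bundle =
  tot :: "'l dspace"
  prj :: "'l \<Rightarrow> 'm"
  rac :: "'l \<Rightarrow> complex \<Rightarrow> 'l"
  lac :: "'r \<Rightarrow> 'l \<Rightarrow> 'l"

definition act_space :: "('m, 'r) groupoid \<Rightarrow> ('m, 'r, 'l) circle_bundle \<Rightarrow> ('r \<times> 'l) dspace" where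
  "act_space R L = subspace_of (prod_space (ar R) (tot L)) {(g, l). tgt R g = prj L l}"

definition groupoid_circle_bundle :: "('m, 'r) groupoid \<Rightarrow> ('m, 'r, 'l) circle_bundle \<Rightarrow> bool" where
  "groupoid_circle_bundle R L \<longleftrightarrow>
     principal_circle_bundle (tot L) (ob R) (prj L) (\<lambda>z l. rac L l z) \<and>
     smooth_map (act_space R L) (tot L) (\<lambda>(g, l). lac L g l) \<and>
     (\<forall>(g, l)\<in>pts (act_space R L). prj L (lac L g l) = src R g) \<and>
     (\<forall>l\<in>pts (tot L). lac L (idn R (prj L l)) l = l) \<and>
     (\<forall>(g, h)\<in>pts (ar2 R). \<forall>l\<in>pts (tot L). tgt R h = prj L l \<longrightarrow>
        lac L (mul R g h) l = lac L g (lac L h l)) \<and>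
     (\<forall>(g, l)\<in>pts (act_space R L). \<forall>z\<in>pts circle. lac L g (rac L l z) = rac L (lac L g l) z)"

definition transformation_groupoid ::
  "('m, 'r) groupoid \<Rightarrow> ('m, 'r, 'l) circle_bundle \<Rightarrow> ('l, 'r \<times> 'l) groupoid" where
  "transformation_groupoid R L = \<lparr>ob = tot L, ar = act_space R L,
     src = (\<lambda>(g, l). lac L g l), tgt = snd,
     idn = (\<lambda>l. (idn R (prj L l), l)),
     ginv = (\<lambda>(g, l). (ginv R g, lac L g l)),
     mul = (\<lambda>(g, l) (h, l'). (mul R g h, l'))\<rparr>"

definition pseudo_connection :: "('m, 'r, 'l) circle_bundle \<Rightarrow> 'l form \<Rightarrow> bool" where
  "pseudo_connection L \<theta>L \<longleftrightarrow> diff_form (tot L) 1 \<theta>L \<and>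
     (\<forall>z\<in>pts circle. form_eq (tot L) 1 (pullback (tot L) (\<lambda>l. rac L l z) \<theta>L) \<theta>L) \<and>
     (\<forall>l\<in>pts (tot L). loop_integral (tot L) (rac L l) \<theta>L = 1)"

definition pseudo_curvature ::
  "('m, 'r) groupoid \<Rightarrow> ('m, 'r, 'l) circle_bundle \<Rightarrow> 'l form \<Rightarrow> 'r form \<Rightarrow> 'm form \<Rightarrow> bool" where
  "pseudo_curvature R L \<theta>L \<theta> \<omega> \<longleftrightarrow> diff_form (ar R) 1 \<theta> \<and> diff_form (ob R) 2 \<omega> \<and>
     cochain2_eq (transformation_groupoid R L)
       (delta1 (transformation_groupoid R L) (\<theta>L, zero_form))
       (cochain2_pullback R (prj L) fst (\<omega>, \<theta>, zero_form))"

definition has_chern_class ::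
  "('m, 'r) groupoid \<Rightarrow> ('m, 'r, 'l) circle_bundle \<Rightarrow> ('m, 'r) cochain2 set \<Rightarrow> bool" where
  "has_chern_class R L C \<longleftrightarrow> (\<exists>\<theta>L \<theta> \<omega>. pseudo_connection L \<theta>L \<and> pseudo_curvature R L \<theta>L \<theta> \<omega> \<and>
     C = dR_class R (\<omega>, \<theta>, zero_form))"

section \<open>The index\<close>

definition bundle_iso ::
  "('m, 'r) groupoid \<Rightarrow> ('m, 'r, 'l) circle_bundle \<Rightarrow> ('m, 'r, 'k) circle_bundle \<Rightarrow> bool" where
  "bundle_iso R L K \<longleftrightarrow> (\<exists>\<Phi>. diffeo (tot L) (tot K) \<Phi> \<and>
     (\<forall>l\<in>pts (tot L). prj K (\<Phi> l) = prj L l) \<and>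
     (\<forall>l\<in>pts (tot L). \<forall>z\<in>pts circle. \<Phi> (rac L l z) = rac K (\<Phi> l) z) \<and>
     (\<forall>(g, l)\<in>pts (act_space R L). \<Phi> (lac L g l) = lac K g (\<Phi> l)))"

definition bundle_pullback :: "('n, 'q) groupoid \<Rightarrow> ('n \<Rightarrow> 'm) \<Rightarrow> ('q \<Rightarrow> 'r) \<Rightarrow>
    ('m, 'r, 'l) circle_bundle \<Rightarrow> ('n, 'q, 'n \<times> 'l) circle_bundle" where
  "bundle_pullback H f0 f1 L = \<lparr>
     tot = subspace_of (prod_space (ob H) (tot L)) {(x, l). f0 x = prj L l},
     prj = fst,
     rac = (\<lambda>(x, l) z. (x, rac L l z)),
     lac = (\<lambda>h (x, l). (src H h, lac L (f1 h) l))\<rparr>"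

definition circle_groupoid :: "(unit, complex) groupoid" where
  "circle_groupoid = \<lparr>ob = point, ar = circle, src = (\<lambda>_. ()), tgt = (\<lambda>_. ()),
     idn = (\<lambda>_. 1), ginv = inverse, mul = (*)\<rparr>"

definition B_bundle :: "int \<Rightarrow> (unit, complex, complex) circle_bundle" where
  "B_bundle k = \<lparr>tot = circle, prj = (\<lambda>_. ()), rac = (*), lac = (\<lambda>w z. w powi k * z)\<rparr>"

definition unit_circle_map ::
  "('m, 'r) groupoid \<Rightarrow> (complex \<Rightarrow> 'r \<Rightarrow> 'r) \<Rightarrow> 'm \<Rightarrow> complex \<Rightarrow> 'r" where
  "unit_circle_map R act m = (\<lambda>z. act z (idn R m))"

definition Ind_at ::
  "('m, 'r) groupoid \<Rightarrow> (complex \<Rightarrow> 'r \<Rightarrow> 'r) \<Rightarrow> ('m, 'r, 'l) circle_bundle \<Rightarrow> 'm \<Rightarrow> int" where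
  "Ind_at R act L m = (THE k. bundle_iso circle_groupoid
     (bundle_pullback circle_groupoid (\<lambda>_. m) (unit_circle_map R act m) L) (B_bundle k))"

definition Ind ::
  "('m, 'r) groupoid \<Rightarrow> (complex \<Rightarrow> 'r \<Rightarrow> 'r) \<Rightarrow> ('m, 'r, 'l) circle_bundle \<Rightarrow> int" where
  "Ind R act L = (THE k. \<forall>m\<in>pts (ob R). Ind_at R act L m = k)"

end

theory Submission
  imports Defs
begin

text \<open>
  Fix \<open>m\<close> and let \<open>f\<close> be the circle \<open>\<lambda> \<mapsto> \<lambda> \<cdot> 1\<^sub>m\<close> in \<open>R\<close>. It acts on the fibre \<open>L\<^sub>m\<close> and commutes there with
  the free and transitive action of \<open>S\<^sup>1\<close>; hence it acts through a smooth homomorphism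
  \<open>S\<^sup>1 \<rightarrow> S\<^sup>1\<close>, that is, through \<open>\<lambda> \<mapsto> \<lambda>\<^sup>k\<close> for an integer \<open>k\<close>, the weight at \<open>m\<close>
  (\<open>has_weight_exists\<close>). A trivialisation of \<open>L\<^sub>m\<close> identifies the bundle pulled back along \<open>f\<close> with
  \<open>B\<^sub>k\<close>, so the index at \<open>m\<close> is the weight (\<open>Ind_at_eq_weight\<close>).

  The weight does not depend on \<open>m\<close>. By centrality it is constant on the orbits of the groupoid. For
  a rotation \<open>z\<close> of infinite order, the power of \<open>z\<close> given by the weight is a continuous function of
  \<open>m\<close>, because it is read off from the action in local trivialisations of \<open>L\<close>. So it
  descends to the orbit space, where it has countably many values; on a connected space such a
  function is constant, and the powers of \<open>z\<close> determine their exponents (\<open>weight_constant\<close>).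

  Let \<open>\<theta>\<^sub>L\<close> be a pseudo-connection with pseudo-curvature \<open>\<theta>' + \<omega>'\<close> and \<open>l\<close> a point of \<open>L\<^sub>m\<close>. On the
  loop \<open>\<lambda> \<mapsto> (f \<lambda>, l)\<close> in the transformation groupoid the target map is constant and the source map is
  \<open>\<lambda> \<mapsto> l \<cdot> \<lambda>\<^sup>k\<close>. The identity between the pull-back of \<open>\<theta>'\<close> and \<open>s\<^sup>*\<theta>\<^sub>L - t\<^sup>*\<theta>\<^sub>L\<close> therefore says that
  \<open>\<theta>'\<close> on the velocity of \<open>f\<close> is \<open>k\<close> times \<open>\<theta>\<^sub>L\<close> on the fundamental vector of \<open>L\<close>, which is \<open>1\<close>
  by invariance and normalisation (\<open>pseudo_curvature_on_unit_circle\<close>). Finally \<open>\<theta>\<close> and \<open>\<theta>'\<close> differ by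
  some \<open>s\<^sup>*\<alpha> - t\<^sup>*\<alpha> - dg\<close>: along \<open>f\<close> source and target are constant, and \<open>dg\<close> integrates to zero over
  a closed curve (\<open>loop_integral_unit_circle\<close>).

  In this last step, equality of the two cohomology classes is an equality of sets of cochains, and
  it yields a coboundary between the representatives because a class contains its representative,
  that is, because the zero cochain has zero coboundary. The exterior derivative evaluates Koszul's
  formula on vector fields chosen through the given tangent vectors, so this rests on the
  existence of such fields (\<open>manifold_extend_tangent\<close>). They are built from partial derivatives in
  a chart and a bump function; that they take the given value is Hadamard's lemma.
\<close>

section \<open>Smooth functions on Euclidean space\<close>

abbreviation euc :: "nat \<Rightarrow> (nat \<Rightarrow> real) set" where
  "euc n \<equiv> {x. \<forall>i\<ge>n. x i = 0}"

lemma continuous_map_Euclidean_space_iff: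
  "continuous_map (Euclidean_space n) euclideanreal F \<longleftrightarrow> continuous_on (euc n) F"
  by (simp add: Euclidean_space_def euclidean_product_topology)

lemma openin_Euclidean_space_iff:
  "openin (Euclidean_space n) V \<longleftrightarrow> openin (top_of_set (euc n)) V"
  by (simp add: Euclidean_space_def euclidean_product_topology)

lemma Ck_fun_continuous: "Ck_fun k n F \<Longrightarrow> continuous_on (euc n) F"
  by (cases k) (auto simp: continuous_map_Euclidean_space_iff)

lemma Ck_fun_SucD:
  assumes "Ck_fun (Suc k) n F"
  obtains D where "\<And>i x. i < n \<Longrightarrow> x \<in> euc n \<Longrightarrow> ((\<lambda>h. F (x(i := h))) has_real_derivative D i x) (at (x i))"
    and "\<And>i. i < n \<Longrightarrow> Ck_fun k n (D i)"
proof -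
  have "\<forall>i. \<exists>D. i < n \<longrightarrow> (\<forall>x\<in>topspace (Euclidean_space n).
         ((\<lambda>h. F (x(i := h))) has_real_derivative D x) (at (x i))) \<and> Ck_fun k n D"
    using assms by auto
  then obtain D where "\<forall>i. i < n \<longrightarrow> (\<forall>x\<in>topspace (Euclidean_space n).
         ((\<lambda>h. F (x(i := h))) has_real_derivative D i x) (at (x i))) \<and> Ck_fun k n (D i)"
    by (rule choice[THEN exE])
  then show thesis by (intro that[of D]) (auto simp: topspace_Euclidean_space)
qed

lemma Ck_fun_SucI:
  assumes "continuous_on (euc n) F"
    and "\<And>i x. i < n \<Longrightarrow> x \<in> euc n \<Longrightarrow> ((\<lambda>h. F (x(i := h))) has_real_derivative D i x) (at (x i))"
    and "\<And>i. i < n \<Longrightarrow> Ck_fun k n (D i)"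
  shows "Ck_fun (Suc k) n F"
  using assms by (auto simp: continuous_map_Euclidean_space_iff topspace_Euclidean_space)

lemma Ck_fun_cong:
  assumes "\<And>x. x \<in> euc n \<Longrightarrow> F x = G x"
  shows "Ck_fun k n F \<longleftrightarrow> Ck_fun k n G"
proof -
  have *: "Ck_fun k n G" if "Ck_fun k n F" and eq: "\<And>x. x \<in> euc n \<Longrightarrow> F x = G x" for F G
  proof (cases k)
    case 0
    then show ?thesis
      using that continuous_on_cong[of "euc n" "euc n" F G]
      by (simp add: continuous_map_Euclidean_space_iff)
  next
    case (Suc l)
    with that(1) have F: "Ck_fun (Suc l) n F" by simp
    obtain D where D: "\<And>i x. i < n \<Longrightarrow> x \<in> euc n \<Longrightarrow> ((\<lambda>h. F (x(i := h))) has_real_derivative D i x) (at (x i))"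
      "\<And>i. i < n \<Longrightarrow> Ck_fun l n (D i)" using Ck_fun_SucD[OF F] by blast
    have "((\<lambda>h. G (x(i := h))) has_real_derivative D i x) (at (x i))" if "i < n" "x \<in> euc n" for i x
    proof -
      have "(\<lambda>h. F (x(i := h))) = (\<lambda>h. G (x(i := h)))"
        using that eq by (intro ext) auto
      then show ?thesis using D(1)[OF that] by simp
    qed
    moreover have "continuous_on (euc n) G"
      using Ck_fun_continuous[OF F] eq continuous_on_cong[of "euc n" "euc n" F G] by simp
    ultimately show ?thesis using Ck_fun_SucI[of n G D l] D(2) Suc by blast
  qed
  show ?thesis using *[of F G] *[of G F] assms by auto
qed

lemma Ck_fun_mono: "Ck_fun (Suc k) n F \<Longrightarrow> Ck_fun k n F"
proof (induction k arbitrary: F)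
  case 0
  then show ?case by simp
next
  case (Suc k)
  obtain D where D: "\<And>i x. i < n \<Longrightarrow> x \<in> euc n \<Longrightarrow> ((\<lambda>h. F (x(i := h))) has_real_derivative D i x) (at (x i))"
      "\<And>i. i < n \<Longrightarrow> Ck_fun (Suc k) n (D i)" by (rule Ck_fun_SucD[OF Suc.prems]) blast
  show ?case using Ck_fun_SucI[OF Ck_fun_continuous[OF Suc.prems] D(1) Suc.IH[OF D(2)]] by blast
qed

lemma Ck_fun_const: "Ck_fun k n (\<lambda>x. c)"
  by (induction k arbitrary: c) (auto simp: intro!: exI[of _ "\<lambda>x. 0"])

lemma Ck_fun_coord: "Ck_fun k n (\<lambda>x. x i)"
proof (cases k)
  case 0
  then show ?thesis
    by (auto simp: continuous_map_Euclidean_space_iff intro: continuous_on_subset[OF continuous_on_product_coordinates])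
next
  case (Suc l)
  have "Ck_fun (Suc l) n (\<lambda>x. x i)"
  proof (rule Ck_fun_SucI)
    show "continuous_on (euc n) (\<lambda>x. x i)"
      by (auto intro: continuous_on_subset[OF continuous_on_product_coordinates])
    show "Ck_fun l n ((\<lambda>j x. if i = j then 1 else 0) j)" for j by (rule Ck_fun_const)
    fix j :: nat and x :: "nat \<Rightarrow> real"
    show "((\<lambda>h. (x(j := h)) i) has_real_derivative (if i = j then 1 else 0)) (at (x j))"
      by (cases "i = j") auto
  qed
  then show ?thesis using Suc by simp
qed

lemma Ck_fun_add: "Ck_fun k n F \<Longrightarrow> Ck_fun k n G \<Longrightarrow> Ck_fun k n (\<lambda>x. F x + G x)"
proof (induction k arbitrary: F G)
  case 0
  then show ?case by (auto simp: continuous_map_Euclidean_space_iff intro: continuous_intros)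
next
  case (Suc k)
  obtain D where D: "\<And>i x. i < n \<Longrightarrow> x \<in> euc n \<Longrightarrow> ((\<lambda>h. F (x(i := h))) has_real_derivative D i x) (at (x i))"
      "\<And>i. i < n \<Longrightarrow> Ck_fun k n (D i)" by (rule Ck_fun_SucD[OF Suc.prems(1)]) blast
  obtain E where E: "\<And>i x. i < n \<Longrightarrow> x \<in> euc n \<Longrightarrow> ((\<lambda>h. G (x(i := h))) has_real_derivative E i x) (at (x i))"
      "\<And>i. i < n \<Longrightarrow> Ck_fun k n (E i)" by (rule Ck_fun_SucD[OF Suc.prems(2)]) blast
  show ?case
  proof (rule Ck_fun_SucI)
    show "continuous_on (euc n) (\<lambda>x. F x + G x)"
      using Suc.prems[THEN Ck_fun_continuous] by (intro continuous_intros)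
    show "Ck_fun k n ((\<lambda>i x. D i x + E i x) i)" if "i < n" for i
      using Suc.IH D(2) E(2) that by blast
    show "((\<lambda>h. F (x(i := h)) + G (x(i := h))) has_real_derivative D i x + E i x) (at (x i))"
      if "i < n" "x \<in> euc n" for i x
      using D(1)[OF that] E(1)[OF that] by (rule DERIV_add)
  qed
qed

lemma Ck_fun_mult: "Ck_fun k n F \<Longrightarrow> Ck_fun k n G \<Longrightarrow> Ck_fun k n (\<lambda>x. F x * G x)"
proof (induction k arbitrary: F G)
  case 0
  then show ?case by (auto simp: continuous_map_Euclidean_space_iff intro: continuous_intros)
next
  case (Suc k)
  obtain D where D: "\<And>i x. i < n \<Longrightarrow> x \<in> euc n \<Longrightarrow> ((\<lambda>h. F (x(i := h))) has_real_derivative D i x) (at (x i))"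
      "\<And>i. i < n \<Longrightarrow> Ck_fun k n (D i)" by (rule Ck_fun_SucD[OF Suc.prems(1)]) blast
  obtain E where E: "\<And>i x. i < n \<Longrightarrow> x \<in> euc n \<Longrightarrow> ((\<lambda>h. G (x(i := h))) has_real_derivative E i x) (at (x i))"
      "\<And>i. i < n \<Longrightarrow> Ck_fun k n (E i)" by (rule Ck_fun_SucD[OF Suc.prems(2)]) blast
  show ?case
  proof (rule Ck_fun_SucI)
    show "continuous_on (euc n) (\<lambda>x. F x * G x)"
      using Suc.prems[THEN Ck_fun_continuous] by (intro continuous_intros)
    show "Ck_fun k n ((\<lambda>i x. D i x * G x + E i x * F x) i)" if "i < n" for i
      by (intro Ck_fun_add Suc.IH D(2) E(2) that Suc.prems[THEN Ck_fun_mono])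
    show "((\<lambda>h. F (x(i := h)) * G (x(i := h))) has_real_derivative D i x * G x + E i x * F x) (at (x i))"
      if "i < n" "x \<in> euc n" for i x
      using DERIV_mult[OF D(1)[OF that] E(1)[OF that]] by simp
  qed
qed

lemma Ck_fun_sum: "(\<And>i. i \<in> I \<Longrightarrow> Ck_fun k n (F i)) \<Longrightarrow> Ck_fun k n (\<lambda>x. \<Sum>i\<in>I. F i x)"
  by (induction I rule: infinite_finite_induct) (auto simp: Ck_fun_const intro: Ck_fun_add)

text \<open>Moving one coordinate at a time turns the increment of \<open>F\<close> along the curve into a sum of
  increments along coordinate lines, to which the mean value theorem applies; continuity of the
  partial derivatives gives the limit.\<close>

lemma has_derivative_along_curve:
  fixes F :: "(nat \<Rightarrow> real) \<Rightarrow> real" and c :: "real \<Rightarrow> nat \<Rightarrow> real"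
  assumes F: "\<And>i x. i < n \<Longrightarrow> x \<in> euc n \<Longrightarrow> ((\<lambda>h. F (x(i := h))) has_real_derivative D i x) (at (x i))"
    and D: "\<And>i. i < n \<Longrightarrow> continuous_on (euc n) (D i)"
    and c: "\<And>i. i < n \<Longrightarrow> ((\<lambda>s. c s i) has_real_derivative c' i) (at t)"
    and c_euc: "\<And>s. c s \<in> euc n"
  shows "((\<lambda>s. F (c s)) has_real_derivative (\<Sum>i<n. D i (c t) * c' i)) (at t)"
proof -
  define q where "q j s = (\<lambda>i. if i < j then c s i else c t i)" for j s
  have q_euc: "q j s \<in> euc n" for j s using c_euc by (auto simp: q_def)
  have q_Suc: "q (Suc j) s = (q j s)(j := c s j)" for j s
    by (auto simp: q_def fun_eq_iff less_Suc_eq)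
  have q_j: "q j s j = c t j" for j s by (simp add: q_def)
  have tele: "F (c s) = F (c t) + (\<Sum>j<n. F (q (Suc j) s) - F (q j s))" for s
  proof -
    have "q n s = c s" using c_euc[of s] c_euc[of t] by (auto simp: q_def fun_eq_iff)
    moreover have "q 0 s = c t" by (auto simp: q_def)
    ultimately show ?thesis using sum_lessThan_telescope[of "\<lambda>j. F (q j s)" n] by simp
  qed
  have step: "((\<lambda>s. F (q (Suc j) s) - F (q j s)) has_real_derivative D j (c t) * c' j) (at t)"
    if j: "j < n" for j
  proof -
    have "\<exists>w. \<bar>w - c t j\<bar> \<le> \<bar>c s j - c t j\<bar> \<and>
        F (q (Suc j) s) - F (q j s) = (c s j - c t j) * D j ((q j s)(j := w))" for s
    proof -
      let ?f = "\<lambda>h. F ((q j s)(j := h))"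
      have der: "(?f has_real_derivative D j ((q j s)(j := w))) (at w)" for w
        using F[OF j, of "(q j s)(j := w)"] q_euc[of j s] j by auto
      have f1: "?f (c s j) = F (q (Suc j) s)" by (simp add: q_Suc)
      have f0: "?f (c t j) = F (q j s)" using q_j[of j s] by (metis fun_upd_triv)
      consider "c t j < c s j" | "c s j < c t j" | "c s j = c t j" by linarith
      then show ?thesis
      proof cases
        case 1
        obtain w where "c t j < w" "w < c s j" "?f (c s j) - ?f (c t j) = (c s j - c t j) * D j ((q j s)(j := w))"
          using MVT2[OF 1, of ?f "\<lambda>w. D j ((q j s)(j := w))"] der by blast
        then show ?thesis unfolding f1 f0 by (intro exI[of _ w]) auto
      next
        case 2
        obtain w where "c s j < w" "w < c t j" "?f (c t j) - ?f (c s j) = (c t j - c s j) * D j ((q j s)(j := w))"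
          using MVT2[OF 2, of ?f "\<lambda>w. D j ((q j s)(j := w))"] der by blast
        then show ?thesis unfolding f1 f0 by (intro exI[of _ w]) (auto simp: algebra_simps)
      next
        case 3
        then show ?thesis using f1 f0 by (intro exI[of _ "c t j"]) auto
      qed
    qed
    then obtain w where w: "\<And>s. \<bar>w s - c t j\<bar> \<le> \<bar>c s j - c t j\<bar>"
      "\<And>s. F (q (Suc j) s) - F (q j s) = (c s j - c t j) * D j ((q j s)(j := w s))"
      by metis
    define \<xi> where "\<xi> s = (q j s)(j := w s)" for s
    have ct: "((\<lambda>s. c s i) \<longlongrightarrow> c t i) (at t)" for i
    proof (cases "i < n")
      case True
      then show ?thesis using DERIV_isCont[OF c] by (simp add: isCont_def)
    next
      case False
      then have "c s i = 0" for s using c_euc[of s] by simp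
      then show ?thesis by simp
    qed
    have "((\<lambda>s. \<bar>c s j - c t j\<bar>) \<longlongrightarrow> \<bar>c t j - c t j\<bar>) (at t)"
      by (intro tendsto_intros ct)
    then have "((\<lambda>s. \<bar>c s j - c t j\<bar>) \<longlongrightarrow> 0) (at t)" by simp
    moreover have "\<forall>\<^sub>F s in at t. norm (w s - c t j) \<le> \<bar>c s j - c t j\<bar>"
      using w(1) by (intro always_eventually) auto
    ultimately have "((\<lambda>s. w s - c t j) \<longlongrightarrow> 0) (at t)"
      by (rule Lim_null_comparison[rotated])
    then have wt: "(w \<longlongrightarrow> c t j) (at t)" using LIM_zero_iff by blast
    have "(\<xi> \<longlongrightarrow> c t) (at t)"
    proof -
      have "((\<lambda>s. \<xi> s i) \<longlongrightarrow> c t i) (at t)" for i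
      proof -
        have "((\<lambda>s. ((q j s)(j := w s)) i) \<longlongrightarrow> c t i) (at t)"
          using wt ct[of i] by (cases "i = j"; cases "i < j") (auto simp: q_def)
        then show ?thesis
          by (rule Lim_transform_eventually) (auto simp: \<xi>_def eventually_at_filter)
      qed
      then have "limitin (powertop_real UNIV) \<xi> (c t) (at t)"
        by (auto simp: limitin_componentwise)
      then show ?thesis by (simp add: euclidean_product_topology)
    qed
    moreover have "\<xi> s \<in> euc n" for s
      using q_euc[of j s] c_euc[of t] j by (auto simp: \<xi>_def)
    ultimately have Dlim: "((\<lambda>s. D j (\<xi> s)) \<longlongrightarrow> D j (c t)) (at t)"
      using c_euc[of t] by (intro continuous_on_tendsto_compose[OF D[OF j]] always_eventually) auto
    have "((\<lambda>s. (c s j - c t j) / (s - t)) \<longlongrightarrow> c' j) (at t)"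
      using c[OF j] by (simp add: has_field_derivative_iff)
    then have "((\<lambda>s. D j (\<xi> s) * ((c s j - c t j) / (s - t))) \<longlongrightarrow> D j (c t) * c' j) (at t)"
      by (intro tendsto_intros Dlim)
    then have "((\<lambda>s. (F (q (Suc j) s) - F (q j s) - (F (q (Suc j) t) - F (q j t))) / (s - t))
        \<longlongrightarrow> D j (c t) * c' j) (at t)"
    proof (rule Lim_transform_eventually)
      have "q (Suc j) t = q j t" by (auto simp: q_def)
      then show "\<forall>\<^sub>F s in at t. D j (\<xi> s) * ((c s j - c t j) / (s - t)) =
          (F (q (Suc j) s) - F (q j s) - (F (q (Suc j) t) - F (q j t))) / (s - t)"
        by (auto simp: eventually_at_filter \<xi>_def w(2))
    qed
    then show ?thesis by (simp add: has_field_derivative_iff)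
  qed
  have "((\<lambda>s. F (c t) + (\<Sum>j<n. F (q (Suc j) s) - F (q j s))) has_real_derivative
      0 + (\<Sum>j<n. D j (c t) * c' j)) (at t)"
    by (intro DERIV_add DERIV_const DERIV_sum step) auto
  then show ?thesis unfolding tele[symmetric] by simp
qed

text \<open>Induction on the order: by the chain rule the partial derivatives of the composite are sums of
  products of \<open>C\<^sup>k\<close> functions, and the induction hypothesis applies to the partial derivatives of the
  outer function.\<close>

lemma Ck_fun_compose:
  "Ck_fun k n F \<Longrightarrow> (\<And>i. i < n \<Longrightarrow> Ck_fun k m (G i)) \<Longrightarrow>
    Ck_fun k m (\<lambda>x. F (\<lambda>i. if i < n then G i x else 0))"
proof (induction k arbitrary: F)
  case 0
  have "continuous_on (euc m) (\<lambda>x i. if i < n then G i x else 0)"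
  proof (rule continuous_on_coordinatewise_then_product)
    fix i
    show "continuous_on (euc m) (\<lambda>x. if i < n then G i x else 0)"
      using 0(2)[THEN Ck_fun_continuous] by (cases "i < n") auto
  qed
  then have "continuous_on (euc m) (\<lambda>x. F (\<lambda>i. if i < n then G i x else 0))"
    by (rule continuous_on_compose2[OF Ck_fun_continuous[OF 0(1)]]) auto
  then show ?case by (simp add: continuous_map_Euclidean_space_iff)
next
  case (Suc k)
  let ?c = "\<lambda>x i. if i < n then G i x else 0"
  obtain D where D: "\<And>i x. i < n \<Longrightarrow> x \<in> euc n \<Longrightarrow> ((\<lambda>h. F (x(i := h))) has_real_derivative D i x) (at (x i))"
      "\<And>i. i < n \<Longrightarrow> Ck_fun k n (D i)" by (rule Ck_fun_SucD[OF Suc.prems(1)]) blast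
  have "\<forall>i. \<exists>E. i < n \<longrightarrow> (\<forall>j<m. (\<forall>x\<in>euc m. ((\<lambda>h. G i (x(j := h))) has_real_derivative E j x) (at (x j))) \<and> Ck_fun k m (E j))"
  proof
    fix i
    show "\<exists>E. i < n \<longrightarrow> (\<forall>j<m. (\<forall>x\<in>euc m. ((\<lambda>h. G i (x(j := h))) has_real_derivative E j x) (at (x j))) \<and> Ck_fun k m (E j))"
    proof (cases "i < n")
      case True
      show ?thesis by (rule Ck_fun_SucD[OF Suc.prems(2)[OF True]]) blast
    qed simp
  qed
  then obtain E where "\<forall>i. i < n \<longrightarrow> (\<forall>j<m. (\<forall>x\<in>euc m.
      ((\<lambda>h. G i (x(j := h))) has_real_derivative E i j x) (at (x j))) \<and> Ck_fun k m (E i j))"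
    by (rule choice[THEN exE])
  then have E: "\<And>i j x. i < n \<Longrightarrow> j < m \<Longrightarrow> x \<in> euc m \<Longrightarrow>
      ((\<lambda>h. G i (x(j := h))) has_real_derivative E i j x) (at (x j))"
    "\<And>i j. i < n \<Longrightarrow> j < m \<Longrightarrow> Ck_fun k m (E i j)" by blast+
  show ?case
  proof (rule Ck_fun_SucI)
    have "continuous_on (euc m) ?c"
    proof (rule continuous_on_coordinatewise_then_product)
      fix i
      show "continuous_on (euc m) (\<lambda>x. if i < n then G i x else 0)"
        using Suc.prems(2)[THEN Ck_fun_continuous] by (cases "i < n") auto
    qed
    then show "continuous_on (euc m) (\<lambda>x. F (?c x))"
      by (rule continuous_on_compose2[OF Ck_fun_continuous[OF Suc.prems(1)]]) auto
    show "Ck_fun k m ((\<lambda>j x. \<Sum>i<n. D i (?c x) * E i j x) j)" if "j < m" for j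
    proof (intro Ck_fun_sum Ck_fun_mult)
      fix i assume "i \<in> {..<n}"
      then show "Ck_fun k m (\<lambda>x. D i (?c x))" "Ck_fun k m (E i j)"
        using Suc.IH[OF D(2)] Suc.prems(2)[THEN Ck_fun_mono] E(2) that by simp_all
    qed
    fix j x assume jx: "j < m" "x \<in> euc m"
    have "((\<lambda>h. F ((\<lambda>h. ?c (x(j := h))) h)) has_real_derivative
        (\<Sum>i<n. D i ((\<lambda>h. ?c (x(j := h))) (x j)) * E i j x)) (at (x j))"
      by (rule has_derivative_along_curve[OF D(1)])
        (use D(2)[THEN Ck_fun_continuous] E(1) jx in auto)
    then show "((\<lambda>h. F (?c (x(j := h)))) has_real_derivative (\<Sum>i<n. D i (?c x) * E i j x)) (at (x j))"
      by (simp only: fun_upd_triv)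
  qed
qed

lemma smooth_fun_continuous: "smooth_fun n F \<Longrightarrow> continuous_on (euc n) F"
  unfolding smooth_fun_def using Ck_fun_continuous by blast

lemma smooth_fun_const: "smooth_fun n (\<lambda>x. c)"
  by (simp add: smooth_fun_def Ck_fun_const)

lemma smooth_fun_coord: "smooth_fun n (\<lambda>x. x i)"
  by (simp add: smooth_fun_def Ck_fun_coord)

lemma smooth_fun_add: "smooth_fun n F \<Longrightarrow> smooth_fun n G \<Longrightarrow> smooth_fun n (\<lambda>x. F x + G x)"
  by (simp add: smooth_fun_def Ck_fun_add)

lemma smooth_fun_mult: "smooth_fun n F \<Longrightarrow> smooth_fun n G \<Longrightarrow> smooth_fun n (\<lambda>x. F x * G x)"
  by (simp add: smooth_fun_def Ck_fun_mult)

lemma smooth_fun_compose: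
  "smooth_fun n F \<Longrightarrow> (\<And>i. i < n \<Longrightarrow> smooth_fun m (G i)) \<Longrightarrow>
    smooth_fun m (\<lambda>x. F (\<lambda>i. if i < n then G i x else 0))"
  by (simp add: smooth_fun_def Ck_fun_compose)

text \<open>For each order the definition provides its own partial derivatives; uniqueness of derivatives shows
  that they agree on the subspace, so a single one is \<open>C\<^sup>k\<close> for all \<open>k\<close>.\<close>

lemma smooth_fun_partial:
  assumes "smooth_fun n F"
  obtains D where "\<And>i x. i < n \<Longrightarrow> x \<in> euc n \<Longrightarrow> ((\<lambda>h. F (x(i := h))) has_real_derivative D i x) (at (x i))"
    and "\<And>i. i < n \<Longrightarrow> smooth_fun n (D i)"
proof -
  have "Ck_fun (Suc 0) n F" using assms unfolding smooth_fun_def by blast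
  then obtain D where D: "\<And>i x. i < n \<Longrightarrow> x \<in> euc n \<Longrightarrow> ((\<lambda>h. F (x(i := h))) has_real_derivative D i x) (at (x i))"
    by (rule Ck_fun_SucD) blast
  have "Ck_fun k n (D i)" if "i < n" for k i
  proof -
    have "Ck_fun (Suc k) n F" using assms unfolding smooth_fun_def by blast
    then obtain E where E: "\<And>i x. i < n \<Longrightarrow> x \<in> euc n \<Longrightarrow> ((\<lambda>h. F (x(i := h))) has_real_derivative E i x) (at (x i))"
      "\<And>i. i < n \<Longrightarrow> Ck_fun k n (E i)" by (rule Ck_fun_SucD) blast
    have "E i x = D i x" if "x \<in> euc n" for x
      using DERIV_unique[OF E(1) D] that \<open>i < n\<close> by blast
    then show ?thesis using E(2)[OF that] Ck_fun_cong[of n "E i" "D i" k] by blast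
  qed
  then show thesis using D that unfolding smooth_fun_def by blast
qed

lemma smooth_fun_along_curve:
  assumes "smooth_fun n F"
    and "\<And>i. i < n \<Longrightarrow> (\<lambda>s. c s i) differentiable (at t)"
  shows "(\<lambda>s. F (\<lambda>i. if i < n then c s i else 0)) differentiable (at (t::real))"
proof -
  obtain D where D: "\<And>i x. i < n \<Longrightarrow> x \<in> euc n \<Longrightarrow> ((\<lambda>h. F (x(i := h))) has_real_derivative D i x) (at (x i))"
    "\<And>i. i < n \<Longrightarrow> smooth_fun n (D i)" by (rule smooth_fun_partial[OF assms(1)]) blast
  obtain c' where c': "\<And>i. i < n \<Longrightarrow> ((\<lambda>s. c s i) has_real_derivative c' i) (at t)"
    using assms(2) unfolding real_differentiable_def by metis
  have "((\<lambda>s. F ((\<lambda>s i. if i < n then c s i else 0) s)) has_real_derivative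
     (\<Sum>i<n. D i ((\<lambda>s i. if i < n then c s i else 0) t) * c' i)) (at t)"
    by (rule has_derivative_along_curve[OF D(1)]) (use D(2)[THEN smooth_fun_continuous] c' in auto)
  then show ?thesis unfolding real_differentiable_def by blast
qed

subsection \<open>A flat function\<close>

text \<open>The derivatives of \<open>exp (- 1 / x)\<close> are combinations of these functions, so it is easiest to
  treat all of them at once.\<close>

definition flat :: "nat \<Rightarrow> real \<Rightarrow> real" where
  "flat m x = (if x \<le> 0 then 0 else exp (- 1 / x) / x ^ m)"

lemma flat_tendsto_0: "((\<lambda>x. flat m x) \<longlongrightarrow> 0) (at 0)"
proof -
  have "((\<lambda>x. flat m x) \<longlongrightarrow> 0) (at_right 0)"
  proof -
    have "((\<lambda>x::real. inverse x ^ m / exp (inverse x)) \<longlongrightarrow> 0) (at_right 0)"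
      by (rule filterlim_compose[OF tendsto_power_div_exp_0 filterlim_inverse_at_top_right])
    then show ?thesis
      by (rule Lim_transform_eventually)
        (auto simp: flat_def eventually_at_filter field_simps exp_minus)
  qed
  moreover have "((\<lambda>x. flat m x) \<longlongrightarrow> 0) (at_left 0)"
    by (rule tendsto_eventually) (auto simp: flat_def eventually_at_filter)
  ultimately show ?thesis by (simp add: filterlim_split_at)
qed

lemma flat_has_derivative:
  "(flat m has_real_derivative flat (m + 2) x - real m * flat (m + 1) x) (at x)"
proof -
  consider "x < 0" | "x > 0" | "x = 0" by linarith
  then show ?thesis
  proof cases
    case 1
    have "((\<lambda>_. 0) has_real_derivative 0) (at x)" by simp
    then have "(flat m has_real_derivative 0) (at x)"
      by (rule has_field_derivative_transform_within_open[of _ _ _ "{..<0}"])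
        (use 1 in \<open>auto simp: flat_def\<close>)
    then show ?thesis using 1 by (simp add: flat_def)
  next
    case 2
    have "((\<lambda>x. exp (- 1 / x) / x ^ m) has_real_derivative
        flat (m + 2) x - real m * flat (m + 1) x) (at x)"
      using 2 by (auto intro!: derivative_eq_intros simp: flat_def)
         (cases m; simp add: field_simps power2_eq_square)
    then show ?thesis
      by (rule has_field_derivative_transform_within_open[of _ _ _ "{0<..}"])
        (use 2 in \<open>auto simp: flat_def\<close>)
  next
    case 3
    have "((\<lambda>h. (flat m h - flat m 0) / (h - 0)) \<longlongrightarrow> 0) (at 0)"
      by (rule Lim_transform_eventually[OF flat_tendsto_0[of "Suc m"]])
        (auto simp: flat_def eventually_at_filter)
    then show ?thesis using 3 by (simp add: flat_def has_field_derivative_iff)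
  qed
qed

lemma smooth_fun_flat: "smooth_fun n (\<lambda>x. flat m (x 0))"
proof -
  have cont: "continuous_on (euc n) (\<lambda>x. flat m (x 0))" for m
    by (rule continuous_on_compose2[of UNIV "flat m" _ "\<lambda>x. x 0"])
      (auto intro!: continuous_at_imp_continuous_on DERIV_isCont[OF flat_has_derivative]
         continuous_on_subset[OF continuous_on_product_coordinates])
  have "Ck_fun k n (\<lambda>x. flat m (x 0))" for k
  proof (induction k arbitrary: m)
    case 0
    then show ?case using cont by (simp add: continuous_map_Euclidean_space_iff)
  next
    case (Suc k)
    show ?case
    proof (rule Ck_fun_SucI)
      show "continuous_on (euc n) (\<lambda>x. flat m (x 0))" by (rule cont)
      let ?D = "\<lambda>i x. (if i = 0 then 1 else 0) * (flat (m + 2) (x 0) + (- real m) * flat (m + 1) (x 0))"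
      show "Ck_fun k n (?D i)" for i
        by (intro Ck_fun_mult Ck_fun_add Ck_fun_const Suc.IH)
      show "((\<lambda>h. flat m ((x(i := h)) 0)) has_real_derivative ?D i x) (at (x i))" for i x
      proof (cases "i = 0")
        case True
        have "((\<lambda>h. flat m h) has_real_derivative ?D i x) (at (x i))"
          using flat_has_derivative[of m "x 0"] True by (simp only: simp_thms if_True diff_conv_add_uminus mult_1 mult_minus_left)
        then show ?thesis using True by (simp only: fun_upd_same)
      next
        case False
        then show ?thesis by (simp only: fun_upd_other if_False mult_zero_left DERIV_const simp_thms not_sym)
      qed
    qed
  qed
  then show ?thesis by (simp add: smooth_fun_def)
qed

subsection \<open>Hadamard's lemma\<close>

text \<open>Averages of a smooth function over the segments from \<open>a\<close>; the weights \<open>t ^ m\<close> appear on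
  differentiating under the integral sign.\<close>

lemma Ck_fun_segment_average:
  assumes a: "a \<in> euc n"
  shows "Ck_fun k n F \<Longrightarrow>
    Ck_fun k n (\<lambda>x. integral {0..1} (\<lambda>t. t ^ m * F (\<lambda>j. a j + t * (x j - a j))))"
proof (induction k arbitrary: F m)
  have seg: "(\<lambda>j. a j + t * (x j - a j)) \<in> euc n" if "x \<in> euc n" for x and t :: real
    using that a by auto
  have cont2: "continuous_on (euc n \<times> cbox 0 1) (\<lambda>(x, t). t ^ m * F (\<lambda>j. a j + t * (x j - a j)))"
    if "continuous_on (euc n) F" for F and m :: nat
  proof -
    have "continuous_on (euc n \<times> cbox 0 1) (\<lambda>p j. a j + snd p * (fst p j - a j))"
      by (intro continuous_on_coordinatewise_then_product continuous_on_add continuous_on_mult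
          continuous_on_diff continuous_on_const continuous_on_snd continuous_on_id
          continuous_on_product_then_coordinatewise[OF continuous_on_fst])
    then have "continuous_on (euc n \<times> cbox 0 1) (\<lambda>p. F (\<lambda>j. a j + snd p * (fst p j - a j)))"
      by (rule continuous_on_compose2[OF that]) (use seg in auto)
    then show ?thesis by (auto simp: split_beta intro!: continuous_intros)
  qed
  have cont: "continuous_on (euc n) (\<lambda>x. integral {0..1} (\<lambda>t. t ^ m * F (\<lambda>j. a j + t * (x j - a j))))"
    if "continuous_on (euc n) F" for F and m :: nat
    using integral_continuous_on_param[OF cont2[OF that]] by (simp add: box_real)
  { case 0
    then show ?case using cont by (simp add: continuous_map_Euclidean_space_iff)
  next
    case (Suc k)
    obtain D where D: "\<And>i x. i < n \<Longrightarrow> x \<in> euc n \<Longrightarrow> ((\<lambda>h. F (x(i := h))) has_real_derivative D i x) (at (x i))"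
      "\<And>i. i < n \<Longrightarrow> Ck_fun k n (D i)" by (rule Ck_fun_SucD[OF Suc.prems(1)]) blast
    show ?case
    proof (rule Ck_fun_SucI)
      show "continuous_on (euc n) (\<lambda>x. integral {0..1} (\<lambda>t. t ^ m * F (\<lambda>j. a j + t * (x j - a j))))"
        by (rule cont[OF Ck_fun_continuous[OF Suc.prems]])
      let ?E = "\<lambda>i x. integral {0..1} (\<lambda>t. t ^ Suc m * D i (\<lambda>j. a j + t * (x j - a j)))"
      show "Ck_fun k n (?E i)" if "i < n" for i
        by (rule Suc.IH[OF D(2)[OF that]])
      fix i x assume i: "i < n" and x: "x \<in> euc n"
      let ?s = "\<lambda>h t j. a j + t * ((x(i := h)) j - a j)"
      have xh: "x(i := h) \<in> euc n" for h using x i by auto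
      have "((\<lambda>h. integral (cbox 0 1) (\<lambda>t. t ^ m * F (?s h t))) has_field_derivative
          integral (cbox 0 1) (\<lambda>t. t ^ Suc m * D i (?s (x i) t))) (at (x i) within UNIV)"
      proof (rule leibniz_rule_field_derivative)
        fix h t :: real
        have "((\<lambda>w. F ((?s h t)(i := w))) has_real_derivative D i (?s h t)) (at (?s h t i))"
          by (rule D(1)[OF i seg[OF xh]])
        then have "((\<lambda>w. F ((?s h t)(i := w))) has_real_derivative D i (?s h t)) (at (a i + t * (h - a i)))"
          by simp
        then have "((\<lambda>h'. F ((?s h t)(i := a i + t * (h' - a i)))) has_real_derivative D i (?s h t) * t) (at h)"
          by (rule DERIV_chain2) (auto intro!: derivative_eq_intros)
        moreover have "(?s h t)(i := a i + t * (h' - a i)) = ?s h' t" for h' by auto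
        ultimately have "((\<lambda>h'. F (?s h' t)) has_real_derivative D i (?s h t) * t) (at h)" by simp
        then show "((\<lambda>h'. t ^ m * F (?s h' t)) has_field_derivative t ^ Suc m * D i (?s h t)) (at h within UNIV)"
          by (auto intro!: derivative_eq_intros)
      next
        fix h :: real
        have "continuous_on (cbox 0 1) (\<lambda>t. (\<lambda>(x, t). t ^ m * F (\<lambda>j. a j + t * (x j - a j))) (x(i := h), t))"
          by (rule continuous_on_compose2[OF cont2[OF Ck_fun_continuous[OF Suc.prems]]])
            (use xh in \<open>auto intro!: continuous_intros\<close>)
        then show "(\<lambda>t. t ^ m * F (?s h t)) integrable_on cbox 0 1"
          unfolding split_conv by (rule integrable_continuous)
      next
        have "continuous_on UNIV (\<lambda>h. x(i := h))"
        proof (rule continuous_on_coordinatewise_then_product)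
          fix j show "continuous_on UNIV (\<lambda>h. (x(i := h)) j)" by (cases "i = j") auto
        qed
        then have "continuous_on (UNIV \<times> cbox 0 1) (\<lambda>p. (x(i := fst p), snd p))"
          by (intro continuous_on_Pair continuous_on_compose2[of UNIV "\<lambda>h. x(i := h)" _ fst]
              continuous_on_fst continuous_on_snd continuous_on_id) auto
        then have "continuous_on (UNIV \<times> cbox 0 1) (\<lambda>p. (\<lambda>(x, t). t ^ Suc m * D i (\<lambda>j. a j + t * (x j - a j))) (x(i := fst p), snd p))"
          by (rule continuous_on_compose2[OF cont2[OF Ck_fun_continuous[OF D(2)[OF i]]]])
            (use xh in auto)
        then show "continuous_on (UNIV \<times> cbox 0 1) (\<lambda>(h, t). t ^ Suc m * D i (?s h t))"
          by (simp add: split_beta)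
      qed auto
      then show "((\<lambda>h. integral {0..1} (\<lambda>t. t ^ m * F (\<lambda>j. a j + t * ((x(i := h)) j - a j)))) has_real_derivative ?E i x) (at (x i))"
        by (simp add: box_real)
    qed
  }
qed

text \<open>With \<open>G i\<close> the average of the \<open>i\<close>-th partial derivative over the segment from \<open>a\<close>, this is
  the fundamental theorem of calculus along that segment.\<close>

lemma Hadamard:
  assumes F: "smooth_fun n F" and a: "a \<in> euc n"
  obtains G where "\<And>i. i < n \<Longrightarrow> smooth_fun n (G i)"
    and "\<And>x. x \<in> euc n \<Longrightarrow> F x = F a + (\<Sum>i<n. (x i - a i) * G i x)"
    and "\<And>i. i < n \<Longrightarrow> ((\<lambda>h. F (a(i := h))) has_real_derivative G i a) (at (a i))"
proof -
  obtain D where D: "\<And>i x. i < n \<Longrightarrow> x \<in> euc n \<Longrightarrow> ((\<lambda>h. F (x(i := h))) has_real_derivative D i x) (at (x i))"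
    "\<And>i. i < n \<Longrightarrow> smooth_fun n (D i)" by (rule smooth_fun_partial[OF F]) blast
  define G where "G i x = integral {0..1} (\<lambda>t. t ^ 0 * D i (\<lambda>j. a j + t * (x j - a j)))" for i x
  show thesis
  proof (rule that)
    show "smooth_fun n (G i)" if "i < n" for i
      using D(2)[OF that] Ck_fun_segment_average[OF a] unfolding smooth_fun_def G_def by blast
    show "((\<lambda>h. F (a(i := h))) has_real_derivative G i a) (at (a i))" if "i < n" for i
      using D(1)[OF that a] by (simp add: G_def)
    fix x assume x: "x \<in> euc n"
    let ?c = "\<lambda>t::real. \<lambda>j. a j + t * (x j - a j)"
    have c: "?c t \<in> euc n" for t using a x by auto
    have cont: "continuous_on {0..1} (\<lambda>t. D i (?c t))" if "i < n" for i
      by (rule continuous_on_compose2[OF smooth_fun_continuous[OF D(2)[OF that]]])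
        (use c in \<open>auto intro!: continuous_on_coordinatewise_then_product continuous_intros\<close>)
    have "((\<lambda>t. F (?c t)) has_real_derivative (\<Sum>i<n. D i (?c t) * (x i - a i))) (at t)" for t
      by (rule has_derivative_along_curve[OF D(1)])
        (use D(2)[THEN smooth_fun_continuous] c in \<open>auto intro!: derivative_eq_intros\<close>)
    then have "((\<lambda>t. \<Sum>i<n. D i (?c t) * (x i - a i)) has_integral F (?c 1) - F (?c 0)) {0..1}"
      by (intro fundamental_theorem_of_calculus)
        (auto simp: has_real_derivative_iff_has_vector_derivative[symmetric] intro: has_field_derivative_at_within)
    moreover have "((\<lambda>t. \<Sum>i<n. D i (?c t) * (x i - a i)) has_integral (\<Sum>i<n. G i x * (x i - a i))) {0..1}"
      using cont by (intro has_integral_sum has_integral_mult_left)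
        (auto simp: G_def intro!: integrable_integral integrable_continuous_real)
    ultimately have "F (?c 1) - F (?c 0) = (\<Sum>i<n. G i x * (x i - a i))"
      by (rule has_integral_unique)
    then show "F x = F a + (\<Sum>i<n. (x i - a i) * G i x)"
      by (simp add: mult.commute)
  qed
qed

section \<open>Differential spaces\<close>

lemma topspace_init_top [simp]: "topspace (init_top S G) = S"
  by (auto simp: init_top_def topology_generated_by_topspace)

lemma openin_init_top_generator:
  "g \<in> G \<Longrightarrow> open V \<Longrightarrow> openin (init_top S G) {x \<in> S. g x \<in> V}"
  unfolding init_top_def by (rule topology_generated_by_Basis) blast

lemma continuous_map_init_top_generator:
  "g \<in> G \<Longrightarrow> continuous_map (init_top S G) euclideanreal g"
  by (auto simp: continuous_map_def openin_init_top_generator)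

lemma continuous_map_into_init_top:
  assumes "f ` topspace T \<subseteq> S" "\<And>g. g \<in> G \<Longrightarrow> continuous_map T euclideanreal (\<lambda>x. g (f x))"
  shows "continuous_map T (init_top S G) f"
  unfolding init_top_def
proof (rule continuous_on_generated_topo)
  fix U assume "U \<in> insert S {{x \<in> S. g x \<in> V} | g V. g \<in> G \<and> open V}"
  then consider "U = S" | g V where "U = {x \<in> S. g x \<in> V}" "g \<in> G" "open V" by blast
  then show "openin T (f -` U \<inter> topspace T)"
  proof cases
    case 1
    then have "f -` U \<inter> topspace T = topspace T" using assms(1) by auto
    then show ?thesis by simp
  next
    case 2
    then have "f -` U \<inter> topspace T = {x \<in> topspace T. g (f x) \<in> V}" using assms(1) by auto
    then show ?thesis using openin_continuous_map_preimage[OF assms(2)[OF 2(2)], of V] 2(3) by simp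
  qed
qed (use assms(1) in auto)

text \<open>The initial topology of an open subset is its subspace topology.\<close>

lemma openin_init_top_open_subset:
  assumes U: "openin (init_top S G) U" and W: "openin (init_top (S \<inter> U) G) W"
  shows "openin (init_top S G) W"
proof -
  have "continuous_map (subtopology (init_top S G) U) (init_top (S \<inter> U) G) (\<lambda>x. x)"
    by (rule continuous_map_into_init_top)
      (auto intro: continuous_map_from_subtopology continuous_map_init_top_generator)
  from openin_continuous_map_preimage[OF this W]
  have "openin (subtopology (init_top S G) U) {x \<in> S \<inter> U. x \<in> W}" by simp
  moreover have "{x \<in> S \<inter> U. x \<in> W} = W" using openin_subset[OF W] by auto
  ultimately show ?thesis using U by (simp add: openin_open_subtopology)
qed

lemma pts_gen_space [simp]: "pts (gen_space S G) = S"
  by (simp add: gen_space_def)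

lemma fns_gen_spaceI:
  assumes "\<And>x. x \<in> S \<Longrightarrow> \<exists>n g F W. (\<forall>i<n. g i \<in> G) \<and> smooth_fun n F \<and> openin (init_top S G) W \<and> x \<in> W \<and>
      (\<forall>y\<in>W. f y = F (\<lambda>i. if i < n then g i y else 0))"
  shows "f \<in> fns (gen_space S G)"
  using assms by (simp add: gen_space_def)

lemma fns_gen_spaceE:
  assumes "f \<in> fns (gen_space S G)" "x \<in> S"
  obtains n g F W where "\<And>i. i < n \<Longrightarrow> g i \<in> G" "smooth_fun n F" "openin (init_top S G) W" "x \<in> W"
      "\<And>y. y \<in> W \<Longrightarrow> f y = F (\<lambda>i. if i < n then g i y else 0)"
proof -
  have "\<exists>n g F W. (\<forall>i<n. g i \<in> G) \<and> smooth_fun n F \<and> openin (init_top S G) W \<and> x \<in> W \<and>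
      (\<forall>y\<in>W. f y = F (\<lambda>i. if i < n then g i y else 0))"
    using assms by (simp add: gen_space_def)
  then show thesis using that by blast
qed

lemma gen_space_generator: "g \<in> G \<Longrightarrow> g \<in> fns (gen_space S G)"
  by (rule fns_gen_spaceI)
    (intro exI[of _ 1] exI[of _ "\<lambda>_. g"] exI[of _ "\<lambda>x. x 0"] exI[of _ S],
     use smooth_fun_coord openin_topspace[of "init_top S G"] in auto)

lemma gen_space_local:
  assumes "\<And>x. x \<in> S \<Longrightarrow> \<exists>h\<in>fns (gen_space S G). \<exists>W. openin (init_top S G) W \<and> x \<in> W \<and> (\<forall>y\<in>W. f y = h y)"
  shows "f \<in> fns (gen_space S G)"
proof (rule fns_gen_spaceI)
  fix x assume x: "x \<in> S"
  from assms[OF x] obtain h W where h: "h \<in> fns (gen_space S G)" and W: "openin (init_top S G) W" "x \<in> W" "\<And>y. y \<in> W \<Longrightarrow> f y = h y"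
    by blast
  from h x obtain n g F W' where *: "\<And>i. i < n \<Longrightarrow> g i \<in> G" "smooth_fun n F" "openin (init_top S G) W'" "x \<in> W'"
      "\<And>y. y \<in> W' \<Longrightarrow> h y = F (\<lambda>i. if i < n then g i y else 0)"
    by (rule fns_gen_spaceE) blast
  show "\<exists>n g F W. (\<forall>i<n. g i \<in> G) \<and> smooth_fun n F \<and> openin (init_top S G) W \<and> x \<in> W \<and>
      (\<forall>y\<in>W. f y = F (\<lambda>i. if i < n then g i y else 0))"
    using * W by (intro exI[of _ n] exI[of _ g] exI[of _ F] exI[of _ "W \<inter> W'"]) auto
qed

lemma continuous_map_smooth_fun:
  assumes "smooth_fun n F" "\<And>i. i < n \<Longrightarrow> continuous_map T euclideanreal (g i)"
  shows "continuous_map T euclideanreal (\<lambda>x. F (\<lambda>i. if i < n then g i x else 0))"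
proof -
  have "continuous_map T (Euclidean_space n) (\<lambda>x i. if i < n then g i x else 0)"
    unfolding Euclidean_space_def
    using assms(2) by (auto simp: continuous_map_in_subtopology continuous_map_componentwise_UNIV)
  moreover have "continuous_map (Euclidean_space n) euclideanreal F"
    using smooth_fun_continuous[OF assms(1)] by (simp add: continuous_map_Euclidean_space_iff)
  ultimately show ?thesis
    using continuous_map_compose[of T "Euclidean_space n" _ euclideanreal F] by (simp add: o_def)
qed

lemma continuous_map_gen_space:
  assumes "f \<in> fns (gen_space S G)"
  shows "continuous_map (init_top S G) euclideanreal f"
  unfolding continuous_map_def
proof (intro conjI allI impI)
  fix V :: "real set" assume V: "openin euclideanreal V"
  show "openin (init_top S G) {x \<in> topspace (init_top S G). f x \<in> V}"
  proof (subst openin_subopen, safe)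
    fix x assume x: "x \<in> topspace (init_top S G)" "f x \<in> V"
    then have "x \<in> S" by simp
    with assms obtain n g F W where *: "\<And>i. i < n \<Longrightarrow> g i \<in> G" "smooth_fun n F" "openin (init_top S G) W" "x \<in> W"
      "\<And>y. y \<in> W \<Longrightarrow> f y = F (\<lambda>i. if i < n then g i y else 0)"
      by (rule fns_gen_spaceE) blast
    have "continuous_map (init_top S G) euclideanreal (\<lambda>x. F (\<lambda>i. if i < n then g i x else 0))"
      using *(1,2) by (intro continuous_map_smooth_fun continuous_map_init_top_generator)
    from openin_continuous_map_preimage[OF this V]
    have "openin (init_top S G) (W \<inter> {x \<in> S. F (\<lambda>i. if i < n then g i x else 0) \<in> V})"
      using *(3) by (intro openin_Int) auto
    moreover have "x \<in> W \<inter> {x \<in> S. F (\<lambda>i. if i < n then g i x else 0) \<in> V}"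
      using * x by auto
    moreover have "W \<inter> {x \<in> S. F (\<lambda>i. if i < n then g i x else 0) \<in> V} \<subseteq> {x \<in> topspace (init_top S G). f x \<in> V}"
      using * by auto
    ultimately show "\<exists>T. openin (init_top S G) T \<and> x \<in> T \<and> T \<subseteq> {x \<in> topspace (init_top S G). f x \<in> V}"
      by blast
  qed
qed auto

text \<open>Generated functions are continuous for the topology of the generators, so they add no open sets.\<close>

lemma init_top_fns_gen_space: "init_top S (fns (gen_space S G)) = init_top S G"
proof -
  have 1: "continuous_map (init_top S G) (init_top S (fns (gen_space S G))) (\<lambda>x. x)"
    by (rule continuous_map_into_init_top) (auto intro: continuous_map_gen_space)
  have 2: "continuous_map (init_top S (fns (gen_space S G))) (init_top S G) (\<lambda>x. x)"
    by (rule continuous_map_into_init_top)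
      (auto intro: continuous_map_init_top_generator gen_space_generator)
  have eq: "{x \<in> S. x \<in> U} = U" if "U \<subseteq> S" for U using that by auto
  show ?thesis
    unfolding topology_eq
  proof (intro allI iffI)
    fix U
    show "openin (init_top S G) U" if U: "openin (init_top S (fns (gen_space S G))) U"
      using openin_continuous_map_preimage[OF 1 U] openin_subset[OF U] eq[of U] by simp
    show "openin (init_top S (fns (gen_space S G))) U" if U: "openin (init_top S G) U"
      using openin_continuous_map_preimage[OF 2 U] openin_subset[OF U] eq[of U] by simp
  qed
qed

lemma dtop_gen_space: "dtop (gen_space S G) = init_top S G"
  by (simp add: dtop_def init_top_fns_gen_space)

text \<open>Enumerating the finitely many generators involved near a point makes all inner functions
  depend on the same coordinates.\<close>

lemma gen_space_compose:
  assumes F: "smooth_fun n F" and h: "\<And>i. i < n \<Longrightarrow> h i \<in> fns (gen_space S G)"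
  shows "(\<lambda>x. F (\<lambda>i. if i < n then h i x else 0)) \<in> fns (gen_space S G)"
proof (rule fns_gen_spaceI)
  fix x assume x: "x \<in> S"
  have "\<forall>i. \<exists>q. i < n \<longrightarrow> (case q of (k, g, H, W) \<Rightarrow> (\<forall>j<k. g j \<in> G) \<and> smooth_fun k H \<and>
      openin (init_top S G) W \<and> x \<in> W \<and> (\<forall>y\<in>W. h i y = H (\<lambda>j. if j < k then g j y else 0)))"
  proof
    fix i
    show "\<exists>q. i < n \<longrightarrow> (case q of (k, g, H, W) \<Rightarrow> (\<forall>j<k. g j \<in> G) \<and> smooth_fun k H \<and>
      openin (init_top S G) W \<and> x \<in> W \<and> (\<forall>y\<in>W. h i y = H (\<lambda>j. if j < k then g j y else 0)))"
    proof (cases "i < n")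
      case True
      show ?thesis
        by (rule fns_gen_spaceE[OF h[OF True] x]) (simp, blast)
    qed simp
  qed
  then obtain q where q: "\<forall>i. i < n \<longrightarrow> (case q i of (k, g, H, W) \<Rightarrow> (\<forall>j<k. g j \<in> G) \<and> smooth_fun k H \<and>
      openin (init_top S G) W \<and> x \<in> W \<and> (\<forall>y\<in>W. h i y = H (\<lambda>j. if j < k then g j y else 0)))"
    by (rule choice[THEN exE])
  define k where "k i = fst (q i)" for i
  define g where "g i = fst (snd (q i))" for i
  define H where "H i = fst (snd (snd (q i)))" for i
  define W where "W i = snd (snd (snd (q i)))" for i
  have q_eq: "q i = (k i, g i, H i, W i)" for i by (simp add: k_def g_def H_def W_def)
  have g: "\<And>i j. i < n \<Longrightarrow> j < k i \<Longrightarrow> g i j \<in> G"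
    and H: "\<And>i. i < n \<Longrightarrow> smooth_fun (k i) (H i)"
    and W: "\<And>i. i < n \<Longrightarrow> openin (init_top S G) (W i)" "\<And>i. i < n \<Longrightarrow> x \<in> W i"
    and hW: "\<And>i y. i < n \<Longrightarrow> y \<in> W i \<Longrightarrow> h i y = H i (\<lambda>j. if j < k i then g i j y else 0)"
    using q unfolding q_eq by auto
  define A where "A = (\<Union>i<n. g i ` {..<k i})"
  have "finite A" by (simp add: A_def)
  then obtain e where e: "bij_betw e {0..<card A} A"
    using ex_bij_betw_nat_finite by blast
  define N where "N = card A"
  define idx where "idx i j = inv_into {0..<N} e (g i j)" for i j
  have idx: "idx i j < N" "e (idx i j) = g i j" if "i < n" "j < k i" for i j
  proof -
    have "g i j \<in> e ` {0..<N}" using e that by (auto simp: A_def N_def bij_betw_def)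
    then show "idx i j < N" "e (idx i j) = g i j"
      using inv_into_into[of "g i j" e "{0..<N}"] f_inv_into_f[of "g i j" e "{0..<N}"]
      by (auto simp: idx_def)
  qed
  have eG: "e l \<in> G" if "l < N" for l
  proof -
    have "e l \<in> A" using e that by (auto simp: N_def bij_betw_def)
    then show ?thesis using g by (auto simp: A_def)
  qed
  define H' where "H' i z = H i (\<lambda>j. if j < k i then z (idx i j) else 0)" for i and z :: "nat \<Rightarrow> real"
  have H': "smooth_fun N (H' i)" if "i < n" for i
    unfolding H'_def by (rule smooth_fun_compose[OF H[OF that] smooth_fun_coord])
  show "\<exists>n' g' F' W'. (\<forall>i<n'. g' i \<in> G) \<and> smooth_fun n' F' \<and> openin (init_top S G) W' \<and> x \<in> W' \<and>
      (\<forall>y\<in>W'. F (\<lambda>i. if i < n then h i y else 0) = F' (\<lambda>i. if i < n' then g' i y else 0))"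
  proof (intro exI conjI)
    show "\<forall>i<N. e i \<in> G" using eG by blast
    show "smooth_fun N (\<lambda>z. F (\<lambda>i. if i < n then H' i z else 0))"
      by (rule smooth_fun_compose[OF F H'])
    show "openin (init_top S G) (S \<inter> (\<Inter>i<n. W i))"
    proof (cases "n = 0")
      case True
      then show ?thesis using openin_topspace[of "init_top S G"] by simp
    next
      case False
      have "openin (init_top S G) (\<Inter>i<n. W i)" using W(1) False by (intro openin_INT2) auto
      moreover have "openin (init_top S G) S" using openin_topspace[of "init_top S G"] by simp
      ultimately show ?thesis by blast
    qed
    show "x \<in> S \<inter> (\<Inter>i<n. W i)" using W(2) x by auto
    show "\<forall>y\<in>S \<inter> (\<Inter>i<n. W i). F (\<lambda>i. if i < n then h i y else 0) =
      F (\<lambda>i. if i < n then H' i (\<lambda>i. if i < N then e i y else 0) else 0)"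
    proof
      fix y assume y: "y \<in> S \<inter> (\<Inter>i<n. W i)"
      have "h i y = H' i (\<lambda>i. if i < N then e i y else 0)" if "i < n" for i
      proof -
        have "(\<lambda>j. if j < k i then g i j y else 0) =
            (\<lambda>j. if j < k i then (if idx i j < N then e (idx i j) y else 0) else 0)"
          using idx[OF that] by auto
        then show ?thesis using hW[OF that, of y] y that by (simp add: H'_def)
      qed
      then have "(\<lambda>i. if i < n then h i y else 0) =
          (\<lambda>i. if i < n then H' i (\<lambda>i. if i < N then e i y else 0) else 0)" by auto
      then show "F (\<lambda>i. if i < n then h i y else 0) =
          F (\<lambda>i. if i < n then H' i (\<lambda>i. if i < N then e i y else 0) else 0)"
        by (rule arg_cong)
    qed
  qed
qed

text \<open>A space is saturated if its functions form a differential structure: they are closed under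
  composition with smooth functions and under gluing.\<close>

definition saturated :: "'a dspace \<Rightarrow> bool" where
  "saturated X \<longleftrightarrow> X = gen_space (pts X) (fns X)"

text \<open>Functions that are locally smooth in generated functions are, after composition, locally smooth in the
  generators themselves.\<close>

lemma saturated_gen_space: "saturated (gen_space S G)"
proof -
  have "f \<in> fns (gen_space S G)" if f: "f \<in> fns (gen_space S (fns (gen_space S G)))" for f
  proof (rule gen_space_local)
    fix x assume "x \<in> S"
    with f obtain n g F W where *: "\<And>i. i < n \<Longrightarrow> g i \<in> fns (gen_space S G)" "smooth_fun n F"
      "openin (init_top S (fns (gen_space S G))) W" "x \<in> W"
      "\<And>y. y \<in> W \<Longrightarrow> f y = F (\<lambda>i. if i < n then g i y else 0)"
      by (rule fns_gen_spaceE) blast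
    show "\<exists>h\<in>fns (gen_space S G). \<exists>W. openin (init_top S G) W \<and> x \<in> W \<and> (\<forall>y\<in>W. f y = h y)"
    proof (intro bexI exI conjI ballI)
      show "(\<lambda>y. F (\<lambda>i. if i < n then g i y else 0)) \<in> fns (gen_space S G)"
        by (rule gen_space_compose[OF *(2,1)])
      show "openin (init_top S G) W" using *(3) unfolding init_top_fns_gen_space .
    qed (use *(4,5) in auto)
  qed
  then have "fns (gen_space S (fns (gen_space S G))) = fns (gen_space S G)"
    using gen_space_generator by blast
  then show ?thesis unfolding saturated_def
    by (metis (mono_tags) dspace.cases dspace.select_convs(1) dspace.select_convs(2) pts_gen_space)
qed

lemma saturated_manifold: "manifold X \<Longrightarrow> saturated X"
  by (simp add: manifold_def saturated_def)

lemma saturated_subspace_of [simp]: "saturated (subspace_of X S)"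
  by (simp add: subspace_of_def saturated_gen_space)

lemma saturated_prod_space [simp]: "saturated (prod_space X Y)"
  by (simp add: prod_space_def saturated_gen_space)

lemma saturated_circle [simp]: "saturated circle"
  by (simp add: circle_def saturated_gen_space)

lemma pts_subspace_of [simp]: "pts (subspace_of X S) = pts X \<inter> S"
  by (simp add: subspace_of_def)

lemma pts_prod_space [simp]: "pts (prod_space X Y) = pts X \<times> pts Y"
  by (simp add: prod_space_def)

lemma pts_circle: "pts circle = sphere 0 1"
  by (simp add: circle_def)

lemma in_circle_iff: "z \<in> pts circle \<longleftrightarrow> cmod z = 1"
  by (simp add: pts_circle)

lemma pts_point [simp]: "pts point = UNIV"
  by (simp add: point_def)

lemma continuous_map_fns: "f \<in> fns X \<Longrightarrow> continuous_map (dtop X) euclideanreal f"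
  unfolding dtop_def by (rule continuous_map_init_top_generator)

lemma fns_local:
  assumes "saturated X"
    and "\<And>x. x \<in> pts X \<Longrightarrow> \<exists>h\<in>fns X. \<exists>W. openin (dtop X) W \<and> x \<in> W \<and> (\<forall>y\<in>W. f y = h y)"
  shows "f \<in> fns X"
  using assms gen_space_local[of "pts X" "fns X" f] unfolding saturated_def dtop_def by auto

lemma fns_cong:
  assumes "saturated X" "h \<in> fns X" "\<And>x. x \<in> pts X \<Longrightarrow> f x = h x"
  shows "f \<in> fns X"
  using openin_topspace[of "dtop X"] assms by (intro fns_local) auto

lemma fns_compose:
  assumes "saturated X" "smooth_fun n F" "\<And>i. i < n \<Longrightarrow> h i \<in> fns X"
  shows "(\<lambda>x. F (\<lambda>i. if i < n then h i x else 0)) \<in> fns X"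
  using assms gen_space_compose[of n F h "pts X" "fns X"] unfolding saturated_def by auto

lemma fns_const: "saturated X \<Longrightarrow> (\<lambda>x. c) \<in> fns X"
  using fns_compose[of X 0 "\<lambda>_. c" undefined] by (simp add: smooth_fun_const)

lemma fns_add:
  assumes "saturated X" "f \<in> fns X" "g \<in> fns X" shows "(\<lambda>x. f x + g x) \<in> fns X"
  using fns_compose[OF assms(1), of 2 "\<lambda>x. x 0 + x 1" "\<lambda>i. if i = 0 then f else g"] assms
  by (simp add: smooth_fun_add smooth_fun_coord)

lemma fns_mult:
  assumes "saturated X" "f \<in> fns X" "g \<in> fns X" shows "(\<lambda>x. f x * g x) \<in> fns X"
  using fns_compose[OF assms(1), of 2 "\<lambda>x. x 0 * x 1" "\<lambda>i. if i = 0 then f else g"] assms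
  by (simp add: smooth_fun_mult smooth_fun_coord)

lemma fns_diff:
  assumes "saturated X" "f \<in> fns X" "g \<in> fns X" shows "(\<lambda>x. f x - g x) \<in> fns X"
  using fns_add[OF assms(1,2) fns_mult[OF assms(1) fns_const[OF assms(1), of "-1"] assms(3)]] by simp

lemma fns_sum:
  assumes "saturated X" "\<And>i. i \<in> I \<Longrightarrow> f i \<in> fns X" shows "(\<lambda>x. \<Sum>i\<in>I. f i x) \<in> fns X"
  using assms(2) by (induction I rule: infinite_finite_induct)
    (auto intro: fns_const fns_add assms(1))

text \<open>A function on an open subspace is given near \<open>x\<close> by a smooth expression in functions of the
  whole space, and that expression makes sense everywhere.\<close>

lemma fns_open_subspace_extend:
  assumes X: "saturated X" and U: "openin (dtop X) U" and f: "f \<in> fns (subspace_of X U)" and x: "x \<in> U"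
  obtains h W where "h \<in> fns X" "openin (dtop X) W" "x \<in> W" "W \<subseteq> U" "\<And>y. y \<in> W \<Longrightarrow> f y = h y"
proof -
  have "x \<in> pts X \<inter> U" using x openin_subset[OF U] by auto
  with f obtain n g F W where *: "\<And>i. i < n \<Longrightarrow> g i \<in> fns X" "smooth_fun n F"
      "openin (init_top (pts X \<inter> U) (fns X)) W" "x \<in> W"
      "\<And>y. y \<in> W \<Longrightarrow> f y = F (\<lambda>i. if i < n then g i y else 0)"
    unfolding subspace_of_def by (rule fns_gen_spaceE) blast
  show thesis
  proof (rule that)
    show "(\<lambda>x. F (\<lambda>i. if i < n then g i x else 0)) \<in> fns X" by (rule fns_compose[OF X *(2,1)])
    show "openin (dtop X) W" using U *(3) unfolding dtop_def by (rule openin_init_top_open_subset)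
    show "W \<subseteq> U" using openin_subset[OF *(3)] by auto
  qed (use * in auto)
qed

subsection \<open>Smooth maps\<close>

lemma smooth_map_pts: "smooth_map X Y f \<Longrightarrow> x \<in> pts X \<Longrightarrow> f x \<in> pts Y"
  by (auto simp: smooth_map_def)

lemma smooth_map_fns: "smooth_map X Y f \<Longrightarrow> g \<in> fns Y \<Longrightarrow> (\<lambda>x. g (f x)) \<in> fns X"
  by (auto simp: smooth_map_def o_def)

lemma smooth_map_continuous: "smooth_map X Y f \<Longrightarrow> continuous_map (dtop X) (dtop Y) f"
  unfolding dtop_def[of Y]
  by (rule continuous_map_into_init_top) (auto intro: continuous_map_fns smooth_map_fns smooth_map_pts)

lemma smooth_map_into_gen_space:
  assumes X: "saturated X" and S: "\<And>x. x \<in> pts X \<Longrightarrow> f x \<in> S" and G: "\<And>g. g \<in> G \<Longrightarrow> (\<lambda>x. g (f x)) \<in> fns X"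
  shows "smooth_map X (gen_space S G) f"
  unfolding smooth_map_def
proof (intro conjI ballI)
  have cont: "continuous_map (dtop X) (init_top S G) f"
    by (rule continuous_map_into_init_top) (auto intro: continuous_map_fns S G)
  fix h assume h: "h \<in> fns (gen_space S G)"
  show "h \<circ> f \<in> fns X"
  proof (rule fns_local[OF X])
    fix x assume x: "x \<in> pts X"
    obtain n g F W where *: "\<And>i. i < n \<Longrightarrow> g i \<in> G" "smooth_fun n F" "openin (init_top S G) W" "f x \<in> W"
      "\<And>y. y \<in> W \<Longrightarrow> h y = F (\<lambda>i. if i < n then g i y else 0)"
      using h S[OF x] by (rule fns_gen_spaceE) blast
    have "(\<lambda>x. F (\<lambda>i. if i < n then g i (f x) else 0)) \<in> fns X"
      using *(1) by (intro fns_compose[OF X *(2)] G)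
    moreover have "openin (dtop X) {x \<in> pts X. f x \<in> W}"
      using openin_continuous_map_preimage[OF cont *(3)] by simp
    ultimately show "\<exists>k\<in>fns X. \<exists>W. openin (dtop X) W \<and> x \<in> W \<and> (\<forall>y\<in>W. (h \<circ> f) y = k y)"
      using * x by (intro bexI[rotated] exI[of _ "{x \<in> pts X. f x \<in> W}"]) auto
  qed
qed (use S in auto)

lemma smooth_map_id: "smooth_map X X (\<lambda>x. x)"
  by (auto simp: smooth_map_def o_def)

lemma smooth_map_compose:
  "smooth_map X Y f \<Longrightarrow> smooth_map Y Z g \<Longrightarrow> smooth_map X Z (\<lambda>x. g (f x))"
  by (auto simp: smooth_map_def o_def)

lemma smooth_map_cong:
  assumes "saturated X" "smooth_map X Y f" "\<And>x. x \<in> pts X \<Longrightarrow> f x = g x"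
  shows "smooth_map X Y g"
  unfolding smooth_map_def
proof (intro conjI ballI)
  show "g ` pts X \<subseteq> pts Y" using assms(2,3) by (auto simp: smooth_map_def)
  fix h assume "h \<in> fns Y"
  then have "(\<lambda>x. h (f x)) \<in> fns X" by (rule smooth_map_fns[OF assms(2)])
  then show "h \<circ> g \<in> fns X" by (rule fns_cong[OF assms(1)]) (use assms(3) in auto)
qed

lemma smooth_map_const: "saturated X \<Longrightarrow> y \<in> pts Y \<Longrightarrow> smooth_map X Y (\<lambda>x. y)"
  by (auto simp: smooth_map_def o_def fns_const)

lemma smooth_map_fst: "smooth_map (prod_space X Y) X fst"
  by (auto simp: smooth_map_def prod_space_def intro: gen_space_generator)

lemma smooth_map_snd: "smooth_map (prod_space X Y) Y snd"
  by (auto simp: smooth_map_def prod_space_def intro: gen_space_generator)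

lemma smooth_map_Pair:
  assumes "saturated Z" "smooth_map Z X a" "smooth_map Z Y b"
  shows "smooth_map Z (prod_space X Y) (\<lambda>z. (a z, b z))"
  unfolding prod_space_def
  by (rule smooth_map_into_gen_space[OF assms(1)])
    (auto intro: smooth_map_fns[OF assms(2)] smooth_map_fns[OF assms(3)] smooth_map_pts[OF assms(2)] smooth_map_pts[OF assms(3)])

lemma smooth_map_inclusion: "smooth_map (subspace_of X S) X (\<lambda>x. x)"
  by (auto simp: smooth_map_def subspace_of_def o_def intro: gen_space_generator)

lemma smooth_map_into_subspace:
  assumes "saturated Z" "smooth_map Z X f" "\<And>z. z \<in> pts Z \<Longrightarrow> f z \<in> S"
  shows "smooth_map Z (subspace_of X S) f"
  unfolding subspace_of_def
  by (rule smooth_map_into_gen_space[OF assms(1)])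
    (use smooth_map_fns[OF assms(2)] smooth_map_pts[OF assms(2)] assms(3) in auto)

lemma smooth_map_from_subspace: "smooth_map X Y f \<Longrightarrow> smooth_map (subspace_of X S) Y f"
  by (rule smooth_map_compose[OF smooth_map_inclusion])

section \<open>Extending tangent vectors to vector fields\<close>

text \<open>The topology of a differential space is generated by its functions, so bump functions exist
  around every point of an open set.  Instead of a closed support, the statement gives an open set
  \<open>A\<close> on which the bump function vanishes and which covers the space together with \<open>W\<close>.\<close>

lemma bump_function:
  assumes X: "saturated X" and W: "openin (dtop X) W" and x: "x \<in> W"
  obtains \<psi> A where "\<psi> \<in> fns X" "\<psi> x \<noteq> 0" "openin (dtop X) A" "pts X \<subseteq> A \<union> W" "\<And>y. y \<in> A \<Longrightarrow> \<psi> y = 0"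
proof -
  let ?B = "insert (pts X) {{x \<in> pts X. g x \<in> V} | g V. g \<in> fns X \<and> open V}"
  have "generate_topology_on ?B W"
    using W unfolding dtop_def init_top_def by (rule openin_topology_generated_by)
  then have "\<forall>x\<in>W. \<exists>\<psi> A. \<psi> \<in> fns X \<and> \<psi> x \<noteq> 0 \<and> openin (dtop X) A \<and> pts X \<subseteq> A \<union> W \<and> (\<forall>y\<in>A. \<psi> y = 0)"
  proof (induction rule: generate_topology_on.induct)
    case Empty
    then show ?case by simp
  next
    case (Int a b)
    show ?case
    proof
      fix x assume x: "x \<in> a \<inter> b"
      then obtain \<psi> A where 1: "\<psi> \<in> fns X" "\<psi> x \<noteq> 0" "openin (dtop X) A" "pts X \<subseteq> A \<union> a" "\<forall>y\<in>A. \<psi> y = 0"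
        using Int.IH(1) by blast
      obtain \<psi>' A' where 2: "\<psi>' \<in> fns X" "\<psi>' x \<noteq> 0" "openin (dtop X) A'" "pts X \<subseteq> A' \<union> b" "\<forall>y\<in>A'. \<psi>' y = 0"
        using Int.IH(2) x by blast
      show "\<exists>\<psi> A. \<psi> \<in> fns X \<and> \<psi> x \<noteq> 0 \<and> openin (dtop X) A \<and> pts X \<subseteq> A \<union> (a \<inter> b) \<and> (\<forall>y\<in>A. \<psi> y = 0)"
        using 1 2 by (intro exI[of _ "\<lambda>y. \<psi> y * \<psi>' y"] exI[of _ "A \<union> A'"]) (auto intro: fns_mult[OF X])
    qed
  next
    case (UN K)
    show ?case
    proof
      fix x assume "x \<in> \<Union>K"
      then obtain k where k: "k \<in> K" "x \<in> k" by blast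
      then obtain \<psi> A where 1: "\<psi> \<in> fns X" "\<psi> x \<noteq> 0" "openin (dtop X) A" "pts X \<subseteq> A \<union> k" "\<forall>y\<in>A. \<psi> y = 0"
        using UN.IH by blast
      then show "\<exists>\<psi> A. \<psi> \<in> fns X \<and> \<psi> x \<noteq> 0 \<and> openin (dtop X) A \<and> pts X \<subseteq> A \<union> \<Union>K \<and> (\<forall>y\<in>A. \<psi> y = 0)"
        using k by (intro exI[of _ \<psi>] exI[of _ A]) auto
    qed
  next
    case (Basis s)
    then consider "s = pts X" | g V where "s = {x \<in> pts X. g x \<in> V}" "g \<in> fns X" "open V" by blast
    then show ?case
    proof cases
      case 1
      then show ?thesis
        using fns_const[OF X, of 1] by (intro ballI exI[of _ "\<lambda>_. 1"] exI[of _ "{}"]) auto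
    next
      case 2
      show ?thesis
      proof
        fix x assume x: "x \<in> s"
        then obtain \<epsilon> where e: "\<epsilon> > 0" "ball (g x) \<epsilon> \<subseteq> V" using 2 open_contains_ball by blast
        \<comment> \<open>The argument of \<open>flat 0\<close> is positive exactly when \<open>g y\<close> is within \<open>\<epsilon> / 2\<close> of \<open>g x\<close>.\<close>
        let ?\<psi> = "\<lambda>y. flat 0 ((\<epsilon> / 2)\<^sup>2 - (g y - g x)\<^sup>2)"
        let ?A = "{y \<in> pts X. g y \<in> - cball (g x) (\<epsilon> / 2)}"
        have "(\<lambda>y. (\<epsilon> / 2)\<^sup>2 - (g y - g x)\<^sup>2) \<in> fns X"
          unfolding power2_eq_square by (intro fns_diff[OF X] fns_mult[OF X] fns_const[OF X] 2)
        then have "?\<psi> \<in> fns X"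
          using fns_compose[OF X smooth_fun_flat[of 1 0], of "\<lambda>_ y. (\<epsilon> / 2)\<^sup>2 - (g y - g x)\<^sup>2"] by simp
        moreover have "?\<psi> x \<noteq> 0" using e(1) by (simp add: flat_def not_le)
        moreover have "openin (dtop X) ?A"
          unfolding dtop_def by (rule openin_init_top_generator[OF 2(2)]) auto
        moreover have "pts X \<subseteq> ?A \<union> s" using e 2(1) by (auto simp: subset_iff)
        moreover have "\<forall>y\<in>?A. ?\<psi> y = 0"
        proof
          fix y assume "y \<in> ?A"
          then have "\<epsilon> / 2 \<le> \<bar>g y - g x\<bar>" by (auto simp: dist_real_def abs_minus_commute)
          then have "(\<epsilon> / 2)\<^sup>2 \<le> (g y - g x)\<^sup>2" using e(1) by (subst abs_le_square_iff[symmetric]) auto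
          then show "?\<psi> y = 0" by (simp add: flat_def)
        qed
        ultimately show "\<exists>\<psi> A. \<psi> \<in> fns X \<and> \<psi> x \<noteq> 0 \<and> openin (dtop X) A \<and> pts X \<subseteq> A \<union> s \<and> (\<forall>y\<in>A. \<psi> y = 0)"
          by blast
      qed
    qed
  qed
  from bspec[OF this x] show thesis using that by blast
qed

subsection \<open>Tangent vectors as derivations\<close>

lemma tangent_add_scale:
  "v \<in> tangent X x \<Longrightarrow> f \<in> fns X \<Longrightarrow> g \<in> fns X \<Longrightarrow> v (\<lambda>y. a * f y + b * g y) = a * v f + b * v g"
  by (simp add: tangent_def)

lemma tangent_mult:
  "v \<in> tangent X x \<Longrightarrow> f \<in> fns X \<Longrightarrow> g \<in> fns X \<Longrightarrow> v (\<lambda>y. f y * g y) = f x * v g + g x * v f"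
  by (simp add: tangent_def)

lemma tangent_const:
  assumes X: "saturated X" and v: "v \<in> tangent X x"
  shows "v (\<lambda>y. c) = 0"
proof -
  have "v (\<lambda>y. 1 * 1) = 1 * v (\<lambda>y. 1) + 1 * v (\<lambda>y. 1)"
    by (rule tangent_mult[OF v]) (rule fns_const[OF X])+
  then have "v (\<lambda>y. 1) = 0" by simp
  moreover have "v (\<lambda>y. c * 1 + 0 * 1) = c * v (\<lambda>y. 1) + 0 * v (\<lambda>y. 1)"
    by (rule tangent_add_scale[OF v]) (rule fns_const[OF X])+
  ultimately show ?thesis by simp
qed

lemma tangent_add:
  assumes "v \<in> tangent X x" "f \<in> fns X" "g \<in> fns X" shows "v (\<lambda>y. f y + g y) = v f + v g"
  using tangent_add_scale[OF assms, of 1 1] by simp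

lemma tangent_diff:
  assumes "v \<in> tangent X x" "f \<in> fns X" "g \<in> fns X" shows "v (\<lambda>y. f y - g y) = v f - v g"
  using tangent_add_scale[OF assms, of 1 "-1"] by simp

lemma tangent_sum:
  assumes X: "saturated X" and v: "v \<in> tangent X x" and "finite I" and "\<And>i. i \<in> I \<Longrightarrow> f i \<in> fns X"
  shows "v (\<lambda>y. \<Sum>i\<in>I. f i y) = (\<Sum>i\<in>I. v (f i))"
  using assms(3,4)
proof (induction I rule: finite_induct)
  case empty
  then show ?case by (simp add: tangent_const[OF X v])
next
  case (insert i I)
  then have "v (\<lambda>y. f i y + (\<Sum>i\<in>I. f i y)) = v (f i) + v (\<lambda>y. \<Sum>i\<in>I. f i y)"
    by (intro tangent_add[OF v] fns_sum[OF X]) auto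
  then show ?case using insert by simp
qed

text \<open>Multiplied by a bump function, the difference vanishes on the carrier. A function that vanishes on
  the carrier is its own product with the indicator function of the complement, which is a smooth
  idempotent that is zero at \<open>x\<close>; so every derivation at \<open>x\<close> kills it.\<close>

lemma tangent_local:
  assumes X: "saturated X" and v: "v \<in> tangent X x" and f: "f \<in> fns X" and g: "g \<in> fns X"
    and W: "openin (dtop X) W" "x \<in> W" and eq: "\<And>y. y \<in> W \<Longrightarrow> f y = g y"
  shows "v f = v g"
proof -
  have x: "x \<in> pts X" using W openin_subset by fastforce
  have zero: "v z = 0" if z: "z \<in> fns X" and z0: "\<And>y. y \<in> pts X \<Longrightarrow> z y = 0" for z
  proof -
    define e where "e y = (if y \<in> pts X then 0 else 1 :: real)" for y
    have e: "e \<in> fns X" by (rule fns_cong[OF X fns_const[OF X, of 0]]) (simp add: e_def)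
    have "(\<lambda>y. e y * e y) = e" "(\<lambda>y. z y * e y) = z" using z0 by (auto simp: e_def)
    then have "v e = e x * v e + e x * v e" "v z = z x * v e + e x * v z"
      using tangent_mult[OF v e e] tangent_mult[OF v z e] by simp_all
    then show ?thesis using x by (simp add: e_def)
  qed
  obtain \<psi> A where \<psi>: "\<psi> \<in> fns X" "\<psi> x \<noteq> 0" "openin (dtop X) A" "pts X \<subseteq> A \<union> W" "\<And>y. y \<in> A \<Longrightarrow> \<psi> y = 0"
    using bump_function[OF X W] by blast
  have d: "(\<lambda>y. f y - g y) \<in> fns X" by (rule fns_diff[OF X f g])
  have "v (\<lambda>y. \<psi> y * (f y - g y)) = 0"
    using \<psi> eq by (intro zero fns_mult[OF X _ d]) auto
  then have "\<psi> x * v (\<lambda>y. f y - g y) = 0"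
    using tangent_mult[OF v \<psi>(1) d] eq[OF W(2)] by simp
  then show ?thesis using \<psi>(2) tangent_diff[OF v f g] by simp
qed

subsection \<open>Charts\<close>

lemma pts_Rn: "pts (Rn n) = euc n"
  by (simp add: Rn_def topspace_Euclidean_space)

text \<open>The topology determined by the smooth functions has to be the usual one, because the
  images of charts are open for the latter.\<close>

lemma dtop_Rn: "dtop (Rn n) = Euclidean_space n"
proof -
  let ?G = "{\<lambda>x. x i | i. i < n} :: ((nat \<Rightarrow> real) \<Rightarrow> real) set"
  have 1: "continuous_map (Euclidean_space n) (init_top (euc n) ?G) (\<lambda>x. x)"
    by (rule continuous_map_into_init_top)
      (auto simp: topspace_Euclidean_space continuous_map_Euclidean_space_iff
        intro: continuous_on_subset[OF continuous_on_product_coordinates])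
  have 2: "continuous_map (init_top (euc n) ?G) (Euclidean_space n) (\<lambda>x. x)"
    unfolding Euclidean_space_def continuous_map_in_subtopology continuous_map_componentwise_UNIV
  proof (intro conjI allI)
    fix i
    show "continuous_map (init_top (euc n) ?G) euclideanreal (\<lambda>x. x i)"
    proof (cases "i < n")
      case True
      then show ?thesis by (intro continuous_map_init_top_generator) auto
    next
      case False
      have "continuous_map (init_top (euc n) ?G) euclideanreal (\<lambda>_. 0)" by simp
      then show ?thesis by (rule continuous_map_eq) (use False in auto)
    qed
  qed auto
  have eq: "{x \<in> euc n. x \<in> U} = U" if "U \<subseteq> euc n" for U using that by auto
  have "init_top (euc n) ?G = Euclidean_space n"
    unfolding topology_eq
  proof (intro allI iffI)
    fix U
    show "openin (Euclidean_space n) U" if U: "openin (init_top (euc n) ?G) U"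
      using openin_continuous_map_preimage[OF 1 U] openin_subset[OF U] eq[of U]
      by (simp add: topspace_Euclidean_space)
    show "openin (init_top (euc n) ?G) U" if U: "openin (Euclidean_space n) U"
      using openin_continuous_map_preimage[OF 2 U] openin_subset[OF U] eq[of U]
      by (simp add: topspace_Euclidean_space)
  qed
  then show ?thesis by (simp add: Rn_def dtop_gen_space topspace_Euclidean_space)
qed

lemma smooth_fun_in_fns_Rn: "smooth_fun n F \<Longrightarrow> F \<in> fns (Rn n)"
  unfolding Rn_def
proof (rule fns_gen_spaceI)
  fix x assume F: "smooth_fun n F" and x: "x \<in> topspace (Euclidean_space n)"
  have "y = (\<lambda>i. if i < n then y i else 0)" if "y \<in> topspace (Euclidean_space n)" for y
    using that by (auto simp: topspace_Euclidean_space)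
  then show "\<exists>n' g F' W. (\<forall>i<n'. g i \<in> {\<lambda>x. x i | i. i < n}) \<and> smooth_fun n' F' \<and>
     openin (init_top (topspace (Euclidean_space n)) {\<lambda>x. x i | i. i < n}) W \<and> x \<in> W \<and>
     (\<forall>y\<in>W. F y = F' (\<lambda>i. if i < n' then g i y else 0))"
    using F x openin_topspace[of "init_top (topspace (Euclidean_space n)) {\<lambda>x. x i | i. i < n}"]
    by (intro exI[of _ n] exI[of _ "\<lambda>i x. x i"] exI[of _ F] exI[of _ "topspace (Euclidean_space n)"]) auto
qed

lemma fns_Rn_local_smooth_fun:
  assumes "f \<in> fns (Rn n)" "x \<in> euc n"
  obtains H W where "smooth_fun n H" "openin (Euclidean_space n) W" "x \<in> W" "\<And>y. y \<in> W \<Longrightarrow> f y = H y"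
proof -
  have "x \<in> topspace (Euclidean_space n)" using assms(2) by (simp add: topspace_Euclidean_space)
  with assms(1) obtain k g F W where *: "\<And>i. i < k \<Longrightarrow> g i \<in> {\<lambda>x. x i | i. i < n}" "smooth_fun k F"
    "openin (init_top (topspace (Euclidean_space n)) {\<lambda>x. x i | i. i < n}) W" "x \<in> W"
    "\<And>y. y \<in> W \<Longrightarrow> f y = F (\<lambda>i. if i < k then g i y else 0)"
    unfolding Rn_def by (rule fns_gen_spaceE) blast
  have "openin (Euclidean_space n) W"
    using *(3) dtop_gen_space[of "topspace (Euclidean_space n)" "{\<lambda>x. x i | i. i < n}"] dtop_Rn[of n]
    by (simp add: Rn_def)
  moreover have "smooth_fun n (\<lambda>y. F (\<lambda>i. if i < k then g i y else 0))"
  proof (rule smooth_fun_compose[OF *(2)])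
    fix i assume "i < k"
    from *(1)[OF this] show "smooth_fun n (g i)" by (auto simp: smooth_fun_coord)
  qed
  ultimately show thesis using * that by blast
qed

text \<open>The consequences of having a chart that are used below; \<open>\<kappa>\<close> is the inverse of \<open>\<phi>\<close>. The
  assumption \<open>line\<close> is openness of the chart, tested on coordinate lines.\<close>

locale smooth_chart =
  fixes X :: "'a dspace" and U :: "'a set" and n :: nat and \<phi> :: "'a \<Rightarrow> nat \<Rightarrow> real" and \<kappa> :: "(nat \<Rightarrow> real) \<Rightarrow> 'a"
  assumes X: "saturated X" and U: "openin (dtop X) U"
    and \<phi>_euc: "\<And>y. y \<in> U \<Longrightarrow> \<phi> y \<in> euc n"
    and \<kappa>_\<phi>: "\<And>y. y \<in> U \<Longrightarrow> \<kappa> (\<phi> y) = y"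
    and \<phi>_smooth: "\<And>D. smooth_fun n D \<Longrightarrow> (\<lambda>y. D (\<phi> y)) \<in> fns (subspace_of X U)"
    and local_rep: "\<And>f p. f \<in> fns X \<Longrightarrow> p \<in> U \<Longrightarrow>
      \<exists>H W. smooth_fun n H \<and> openin (dtop X) W \<and> p \<in> W \<and> W \<subseteq> U \<and> (\<forall>y\<in>W. f y = H (\<phi> y))"
    and line: "\<And>W p i. openin (dtop X) W \<Longrightarrow> W \<subseteq> U \<Longrightarrow> p \<in> W \<Longrightarrow> i < n \<Longrightarrow>
      \<exists>B. open B \<and> \<phi> p i \<in> B \<and>
        (\<forall>h\<in>B. \<kappa> ((\<phi> p)(i := h)) \<in> W \<and> \<phi> (\<kappa> ((\<phi> p)(i := h))) = (\<phi> p)(i := h))"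

lemma manifold_chart:
  assumes M: "manifold X" and x: "x \<in> pts X"
  obtains U n \<phi> \<kappa> where "smooth_chart X U n \<phi> \<kappa>" "x \<in> U"
proof -
  have X: "saturated X" by (rule saturated_manifold[OF M])
  obtain U n V \<phi> where U: "openin (dtop X) U" "x \<in> U" and V: "openin (Euclidean_space n) V"
    and \<phi>: "diffeo (subspace_of X U) (subspace_of (Rn n) V) \<phi>"
    using M x unfolding manifold_def by blast
  have Upts: "U \<subseteq> pts X" using openin_subset[OF U(1)] by simp
  have Veuc: "V \<subseteq> euc n" using openin_subset[OF V] by (simp add: topspace_Euclidean_space)
  have ptsU: "pts (subspace_of X U) = U" and ptsV: "pts (subspace_of (Rn n) V) = V"
    using Upts Veuc by (auto simp: pts_Rn)
  define \<kappa> where "\<kappa> = inv_into U \<phi>"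
  have s\<phi>: "smooth_map (subspace_of X U) (subspace_of (Rn n) V) \<phi>"
    and bij: "bij_betw \<phi> U V"
    and s\<kappa>: "smooth_map (subspace_of (Rn n) V) (subspace_of X U) \<kappa>"
    using \<phi> unfolding diffeo_def ptsU ptsV \<kappa>_def by auto
  have \<kappa>\<phi>: "\<kappa> (\<phi> y) = y" and \<phi>V: "\<phi> y \<in> V" if "y \<in> U" for y
    using that bij by (auto simp: \<kappa>_def bij_betw_def)
  have \<phi>\<kappa>: "\<phi> (\<kappa> q) = q" if "q \<in> V" for q
    using that bij by (auto simp: \<kappa>_def bij_betw_def f_inv_into_f)
  have s\<phi>': "smooth_map (subspace_of X U) (Rn n) \<phi>"
    by (rule smooth_map_compose[OF s\<phi> smooth_map_inclusion])
  have s\<kappa>': "smooth_map (subspace_of (Rn n) V) X \<kappa>"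
    by (rule smooth_map_compose[OF s\<kappa> smooth_map_inclusion])
  have open_pull: "openin (dtop X) {y \<in> U. \<phi> y \<in> W}" if W: "openin (Euclidean_space n) W" for W
  proof -
    have "openin (dtop (subspace_of X U)) {y \<in> U. \<phi> y \<in> W}"
      using openin_continuous_map_preimage[OF smooth_map_continuous[OF s\<phi>'], of W] W
      unfolding topspace_dtop ptsU dtop_Rn by simp
    then show ?thesis
      using openin_init_top_open_subset[of "pts X" "fns X" U] U(1)
      unfolding subspace_of_def dtop_gen_space unfolding dtop_def by blast
  qed
  have open_push: "openin (Euclidean_space n) {q \<in> V. \<kappa> q \<in> W}" if W: "openin (dtop X) W" for W
  proof -
    have "openin (dtop (subspace_of (Rn n) V)) {q \<in> V. \<kappa> q \<in> W}"
      using openin_continuous_map_preimage[OF smooth_map_continuous[OF s\<kappa>'] W]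
      unfolding topspace_dtop ptsV .
    then have "openin (dtop (Rn n)) {q \<in> V. \<kappa> q \<in> W}"
      using openin_init_top_open_subset[of "pts (Rn n)" "fns (Rn n)" V] V
      unfolding subspace_of_def dtop_gen_space dtop_Rn[of n, symmetric] unfolding dtop_def by blast
    then show ?thesis by (simp add: dtop_Rn)
  qed
  have "smooth_chart X U n \<phi> \<kappa>"
  proof
    show "\<phi> y \<in> euc n" if "y \<in> U" for y using \<phi>V[OF that] Veuc by blast
    show "(\<lambda>y. D (\<phi> y)) \<in> fns (subspace_of X U)" if "smooth_fun n D" for D
      by (rule smooth_map_fns[OF s\<phi>' smooth_fun_in_fns_Rn[OF that]])
    show "\<exists>H W. smooth_fun n H \<and> openin (dtop X) W \<and> p \<in> W \<and> W \<subseteq> U \<and> (\<forall>y\<in>W. f y = H (\<phi> y))"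
      if f: "f \<in> fns X" and p: "p \<in> U" for f p
    proof -
      have Rn_sat: "saturated (Rn n)" by (simp add: Rn_def saturated_gen_space)
      have Vd: "openin (dtop (Rn n)) V" using V by (simp add: dtop_Rn)
      have "(\<lambda>q. f (\<kappa> q)) \<in> fns (subspace_of (Rn n) V)" by (rule smooth_map_fns[OF s\<kappa>' f])
      then obtain h W1 where h: "h \<in> fns (Rn n)" and W1: "openin (dtop (Rn n)) W1" "\<phi> p \<in> W1" "W1 \<subseteq> V"
        "\<And>q. q \<in> W1 \<Longrightarrow> f (\<kappa> q) = h q"
        by (rule fns_open_subspace_extend[OF Rn_sat Vd _ \<phi>V[OF p]]) blast
      have "\<phi> p \<in> euc n" using \<phi>V[OF p] Veuc by blast
      with h obtain H W2 where H: "smooth_fun n H" "openin (Euclidean_space n) W2" "\<phi> p \<in> W2"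
        "\<And>q. q \<in> W2 \<Longrightarrow> h q = H q"
        by (rule fns_Rn_local_smooth_fun) blast
      have "openin (Euclidean_space n) (W1 \<inter> W2)"
        using W1(1) H(2) by (auto simp: dtop_Rn)
      from open_pull[OF this] show ?thesis
      proof (intro exI conjI)
        show "\<forall>y\<in>{y \<in> U. \<phi> y \<in> W1 \<inter> W2}. f y = H (\<phi> y)"
          using W1(4) H(4) \<kappa>\<phi> by fastforce
      qed (use H W1 p in auto)
    qed
    show "\<exists>B. open B \<and> \<phi> p i \<in> B \<and>
        (\<forall>h\<in>B. \<kappa> ((\<phi> p)(i := h)) \<in> W \<and> \<phi> (\<kappa> ((\<phi> p)(i := h))) = (\<phi> p)(i := h))"
      if W: "openin (dtop X) W" "W \<subseteq> U" "p \<in> W" and i: "i < n" for W p i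
    proof -
      have "openin (top_of_set (euc n)) {q \<in> V. \<kappa> q \<in> W}"
        using open_push[OF W(1)] by (simp add: openin_Euclidean_space_iff)
      then obtain T where T: "open T" "{q \<in> V. \<kappa> q \<in> W} = euc n \<inter> T"
        by (auto simp: openin_open)
      have pU: "p \<in> U" using W by blast
      have "continuous_on UNIV (\<lambda>h. (\<phi> p)(i := h))"
      proof (rule continuous_on_coordinatewise_then_product)
        fix j show "continuous_on UNIV (\<lambda>h. ((\<phi> p)(i := h)) j)" by (cases "i = j") auto
      qed
      then have "open ((\<lambda>h. (\<phi> p)(i := h)) -` T)" by (rule open_vimage[OF T(1)])
      moreover have "\<phi> p \<in> {q \<in> V. \<kappa> q \<in> W}" using \<phi>V[OF pU] \<kappa>\<phi>[OF pU] W(3) by simp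
      then have "\<phi> p \<in> T" using T(2) by blast
      then have "\<phi> p i \<in> (\<lambda>h. (\<phi> p)(i := h)) -` T" by simp
      moreover have "\<kappa> ((\<phi> p)(i := h)) \<in> W \<and> \<phi> (\<kappa> ((\<phi> p)(i := h))) = (\<phi> p)(i := h)"
        if "h \<in> (\<lambda>h. (\<phi> p)(i := h)) -` T" for h
      proof -
        have "\<phi> p \<in> euc n" using \<phi>V[OF pU] Veuc by blast
        then have "(\<phi> p)(i := h) \<in> euc n" using i by auto
        then have "(\<phi> p)(i := h) \<in> {q \<in> V. \<kappa> q \<in> W}" using that T(2) by blast
        then show ?thesis using \<phi>\<kappa> by blast
      qed
      ultimately show ?thesis by blast
    qed
  qed (use X U \<kappa>\<phi> in auto)
  then show thesis using that U(2) by blast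
qed

context smooth_chart
begin

definition partial :: "nat \<Rightarrow> ('a \<Rightarrow> real) \<Rightarrow> 'a \<Rightarrow> real" where
  "partial i f p = deriv (\<lambda>h. f (\<kappa> ((\<phi> p)(i := h)))) (\<phi> p i)"

lemma partial_eqI:
  assumes W: "openin (dtop X) W" "W \<subseteq> U" "p \<in> W" and f: "\<And>y. y \<in> W \<Longrightarrow> f y = H (\<phi> y)" and i: "i < n"
    and D: "((\<lambda>h. H ((\<phi> p)(i := h))) has_real_derivative d) (at (\<phi> p i))"
  shows "((\<lambda>h. f (\<kappa> ((\<phi> p)(i := h)))) has_real_derivative d) (at (\<phi> p i))" "partial i f p = d"
proof -
  obtain B where B: "open B" "\<phi> p i \<in> B" "\<And>h. h \<in> B \<Longrightarrow> \<kappa> ((\<phi> p)(i := h)) \<in> W"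
    "\<And>h. h \<in> B \<Longrightarrow> \<phi> (\<kappa> ((\<phi> p)(i := h))) = (\<phi> p)(i := h)"
    using line[OF W i] by blast
  show *: "((\<lambda>h. f (\<kappa> ((\<phi> p)(i := h)))) has_real_derivative d) (at (\<phi> p i))"
    by (rule has_field_derivative_transform_within_open[OF D B(1,2)])
      (use B(3,4) f in auto)
  show "partial i f p = d" unfolding partial_def by (rule DERIV_imp_deriv[OF *])
qed

lemma partial_has_derivative:
  assumes f: "f \<in> fns X" and p: "p \<in> U" and i: "i < n"
  shows "((\<lambda>h. f (\<kappa> ((\<phi> p)(i := h)))) has_real_derivative partial i f p) (at (\<phi> p i))"
proof -
  obtain H W where H: "smooth_fun n H" "openin (dtop X) W" "p \<in> W" "W \<subseteq> U" "\<And>y. y \<in> W \<Longrightarrow> f y = H (\<phi> y)"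
    using local_rep[OF f p] by blast
  obtain D where "\<And>i x. i < n \<Longrightarrow> x \<in> euc n \<Longrightarrow> ((\<lambda>h. H (x(i := h))) has_real_derivative D i x) (at (x i))"
    by (rule smooth_fun_partial[OF H(1)]) blast
  then have "((\<lambda>h. H ((\<phi> p)(i := h))) has_real_derivative D i (\<phi> p)) (at (\<phi> p i))"
    using i \<phi>_euc[OF p] by blast
  from partial_eqI[OF H(2,4,3) H(5) i this] show ?thesis by simp
qed

lemma partial_smooth:
  assumes f: "f \<in> fns X" and p: "p \<in> U"
  obtains k W where "\<And>i. i < n \<Longrightarrow> k i \<in> fns (subspace_of X U)" "openin (dtop X) W" "p \<in> W" "W \<subseteq> U"
    "\<And>i y. i < n \<Longrightarrow> y \<in> W \<Longrightarrow> partial i f y = k i y"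
proof -
  obtain H W where H: "smooth_fun n H" "openin (dtop X) W" "p \<in> W" "W \<subseteq> U" "\<And>y. y \<in> W \<Longrightarrow> f y = H (\<phi> y)"
    using local_rep[OF f p] by blast
  obtain D where D: "\<And>i x. i < n \<Longrightarrow> x \<in> euc n \<Longrightarrow> ((\<lambda>h. H (x(i := h))) has_real_derivative D i x) (at (x i))"
    "\<And>i. i < n \<Longrightarrow> smooth_fun n (D i)"
    by (rule smooth_fun_partial[OF H(1)]) blast
  show thesis
  proof (rule that[of "\<lambda>i y. D i (\<phi> y)" W])
    show "(\<lambda>y. D i (\<phi> y)) \<in> fns (subspace_of X U)" if "i < n" for i
      by (rule \<phi>_smooth[OF D(2)[OF that]])
    show "partial i f y = D i (\<phi> y)" if "i < n" "y \<in> W" for i y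
      by (rule partial_eqI(2)[OF H(2,4) that(2) H(5) that(1) D(1)[OF that(1)]])
        (use that(2) H(4) \<phi>_euc in auto)
  qed (use H in auto)
qed

text \<open>By Hadamard's lemma a derivation is determined by its values on the coordinate functions;
  the coordinates enter through globally defined functions \<open>y i\<close> that agree with them near \<open>x\<close>.\<close>

lemma tangent_eq_partials:
  assumes x: "x \<in> U" and v: "v \<in> tangent X x"
  obtains a where "\<And>f. f \<in> fns X \<Longrightarrow> v f = (\<Sum>i<n. a i * partial i f x)"
proof -
  have ext: "\<exists>h. h \<in> fns X \<and> (\<exists>W. openin (dtop X) W \<and> x \<in> W \<and> (\<forall>y\<in>W. f y = h y))"
    if f: "f \<in> fns (subspace_of X U)" for f
    by (rule fns_open_subspace_extend[OF X U f x]) blast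
  have "\<forall>i. \<exists>h. h \<in> fns X \<and> (\<exists>W. openin (dtop X) W \<and> x \<in> W \<and> (\<forall>y\<in>W. \<phi> y i = h y))"
    using ext[OF \<phi>_smooth[OF smooth_fun_coord]] by blast
  then obtain y where y: "\<And>i. y i \<in> fns X"
      "\<And>i. \<exists>W. openin (dtop X) W \<and> x \<in> W \<and> (\<forall>p\<in>W. \<phi> p i = y i p)" by metis
  show thesis
  proof (rule that[of "\<lambda>i. v (y i)"])
    fix f assume f: "f \<in> fns X"
    obtain H W where H: "smooth_fun n H" "openin (dtop X) W" "x \<in> W" "W \<subseteq> U" "\<And>y. y \<in> W \<Longrightarrow> f y = H (\<phi> y)"
      using local_rep[OF f x] by blast
    obtain G where G: "\<And>i. i < n \<Longrightarrow> smooth_fun n (G i)"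
      "\<And>q. q \<in> euc n \<Longrightarrow> H q = H (\<phi> x) + (\<Sum>i<n. (q i - \<phi> x i) * G i q)"
      "\<And>i. i < n \<Longrightarrow> ((\<lambda>h. H ((\<phi> x)(i := h))) has_real_derivative G i (\<phi> x)) (at (\<phi> x i))"
      by (rule Hadamard[OF H(1) \<phi>_euc[OF x]]) blast
    have "\<forall>i. \<exists>h. i < n \<longrightarrow> h \<in> fns X \<and> (\<exists>W. openin (dtop X) W \<and> x \<in> W \<and> (\<forall>p\<in>W. G i (\<phi> p) = h p))"
      using ext[OF \<phi>_smooth[OF G(1)]] by blast
    then obtain k where k: "\<And>i. i < n \<Longrightarrow> k i \<in> fns X"
        "\<And>i. i < n \<Longrightarrow> \<exists>W. openin (dtop X) W \<and> x \<in> W \<and> (\<forall>p\<in>W. G i (\<phi> p) = k i p)" by metis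
    obtain Wy where Wy: "\<And>i. openin (dtop X) (Wy i)" "\<And>i. x \<in> Wy i" "\<And>i p. p \<in> Wy i \<Longrightarrow> \<phi> p i = y i p"
      using y(2) by metis
    obtain Wk where Wk: "\<And>i. i < n \<Longrightarrow> openin (dtop X) (Wk i)" "\<And>i. i < n \<Longrightarrow> x \<in> Wk i"
      "\<And>i p. i < n \<Longrightarrow> p \<in> Wk i \<Longrightarrow> G i (\<phi> p) = k i p"
      using k(2) by metis
    define W' where "W' = W \<inter> (\<Inter>i\<in>{..<n}. Wy i \<inter> Wk i)"
    have W': "openin (dtop X) W'" "x \<in> W'"
    proof -
      have "openin (dtop X) (W \<inter> (\<Inter>i\<in>I. Wy i \<inter> Wk i))" if "finite I" "I \<subseteq> {..<n}" for I
        using that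
      proof (induction I rule: finite_induct)
        case empty
        then show ?case using H(2) by simp
      next
        case (insert i I)
        then have "openin (dtop X) ((W \<inter> (\<Inter>i\<in>I. Wy i \<inter> Wk i)) \<inter> (Wy i \<inter> Wk i))"
          by (intro openin_Int[OF insert.IH] openin_Int[OF Wy(1) Wk(1)]) auto
        then show ?case by (simp add: Int_ac)
      qed
      then show "openin (dtop X) W'" by (simp add: W'_def)
      show "x \<in> W'" using Wy(2) Wk(2) H(3) by (auto simp: W'_def)
    qed
    let ?F = "\<lambda>p. f x + (\<Sum>i<n. (y i p - \<phi> x i) * k i p)"
    have yc: "(\<lambda>p. y i p - \<phi> x i) \<in> fns X" for i by (intro fns_diff[OF X] y(1) fns_const[OF X])
    have prod_fns: "(\<lambda>p. (y i p - \<phi> x i) * k i p) \<in> fns X" if "i < n" for i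
      by (rule fns_mult[OF X yc k(1)[OF that]])
    have "f p = ?F p" if p: "p \<in> W'" for p
    proof -
      have pW: "p \<in> W" "p \<in> U" using p H(4) by (auto simp: W'_def)
      have "f p = H (\<phi> x) + (\<Sum>i<n. (\<phi> p i - \<phi> x i) * G i (\<phi> p))"
        using H(5)[OF pW(1)] G(2)[OF \<phi>_euc[OF pW(2)]] by simp
      also have "(\<Sum>i<n. (\<phi> p i - \<phi> x i) * G i (\<phi> p)) = (\<Sum>i<n. (y i p - \<phi> x i) * k i p)"
        using p Wy(3) Wk(3) by (intro sum.cong) (auto simp: W'_def)
      finally show ?thesis using H(5)[OF H(3)] by simp
    qed
    then have "v f = v ?F"
      by (intro tangent_local[OF X v f _ W'] fns_add[OF X] fns_const[OF X] fns_sum[OF X] prod_fns) auto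
    also have "\<dots> = (\<Sum>i<n. v (\<lambda>p. (y i p - \<phi> x i) * k i p))"
      using tangent_add[OF v fns_const[OF X] fns_sum[OF X, of "{..<n}"]] prod_fns tangent_const[OF X v]
        tangent_sum[OF X v, of "{..<n}"] by simp
    also have "\<dots> = (\<Sum>i<n. v (y i) * partial i f x)"
    proof (rule sum.cong)
      fix i assume "i \<in> {..<n}"
      then have i: "i < n" by simp
      have "v (\<lambda>p. (y i p - \<phi> x i) * k i p) = (y i x - \<phi> x i) * v (k i) + k i x * v (\<lambda>p. y i p - \<phi> x i)"
        by (rule tangent_mult[OF v yc k(1)[OF i]])
      moreover have "y i x = \<phi> x i" using Wy(2,3) by simp
      moreover have "v (\<lambda>p. y i p - \<phi> x i) = v (y i)"
        using tangent_diff[OF v y(1) fns_const[OF X]] tangent_const[OF X v] by simp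
      moreover have "k i x = partial i f x"
        using partial_eqI(2)[OF H(2,4,3) H(5) i G(3)[OF i]] Wk(2,3)[OF i] by simp
      ultimately show "v (\<lambda>p. (y i p - \<phi> x i) * k i p) = v (y i) * partial i f x" by simp
    qed simp
    finally show "v f = (\<Sum>i<n. v (y i) * partial i f x)" .
  qed
qed

text \<open>In the chart the tangent vector is a combination of partial derivatives with constant coefficients;
  multiplied by a bump function, this combination extends by zero to the whole space.\<close>

lemma extend_tangent:
  assumes x: "x \<in> U" and v: "v \<in> tangent X x"
  obtains V where "vector_field X V" "V x = v"
proof -
  obtain a where a: "\<And>f. f \<in> fns X \<Longrightarrow> v f = (\<Sum>i<n. a i * partial i f x)"
    by (rule tangent_eq_partials[OF x v]) blast
  obtain \<psi> A where \<psi>: "\<psi> \<in> fns X" "\<psi> x \<noteq> 0" "openin (dtop X) A" "pts X \<subseteq> A \<union> U" "\<And>y. y \<in> A \<Longrightarrow> \<psi> y = 0"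
    using bump_function[OF X U x] by blast
  define V where "V p f = (if f \<in> fns X \<and> p \<in> U then \<psi> p / \<psi> x * (\<Sum>i<n. a i * partial i f p) else 0)" for p f
  have "vector_field X V"
    unfolding vector_field_def
  proof (intro conjI ballI)
    fix p assume p: "p \<in> pts X"
    show "V p \<in> tangent X p"
    proof (cases "p \<in> U")
      case False
      then show ?thesis by (simp add: V_def tangent_def)
    next
      case True
      have \<kappa>p: "\<kappa> ((\<phi> p)(i := \<phi> p i)) = p" for i using \<kappa>_\<phi>[OF True] by simp
      have "V p (\<lambda>y. b * f y + c * g y) = b * V p f + c * V p g"
        if f: "f \<in> fns X" and g: "g \<in> fns X" for f g b c
      proof -
        have "partial i (\<lambda>y. b * f y + c * g y) p = b * partial i f p + c * partial i g p" if "i < n" for i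
          unfolding partial_def[of i "\<lambda>y. b * f y + c * g y"]
          by (rule DERIV_imp_deriv)
            (auto intro!: derivative_eq_intros partial_has_derivative[OF f True that] partial_has_derivative[OF g True that])
        then have "(\<Sum>i<n. a i * partial i (\<lambda>y. b * f y + c * g y) p) =
            (\<Sum>i<n. b * (a i * partial i f p) + c * (a i * partial i g p))"
          by (intro sum.cong) (auto simp: algebra_simps)
        also have "\<dots> = b * (\<Sum>i<n. a i * partial i f p) + c * (\<Sum>i<n. a i * partial i g p)"
          by (simp add: sum.distrib sum_distrib_left)
        finally show ?thesis
          using f g True fns_add[OF X fns_mult[OF X fns_const[OF X] f] fns_mult[OF X fns_const[OF X] g], of b c]
          by (simp add: V_def algebra_simps)
      qed
      moreover have "V p (\<lambda>y. f y * g y) = f p * V p g + g p * V p f"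
        if f: "f \<in> fns X" and g: "g \<in> fns X" for f g
      proof -
        have "partial i (\<lambda>y. f y * g y) p = f p * partial i g p + g p * partial i f p" if "i < n" for i
          unfolding partial_def[of i "\<lambda>y. f y * g y"]
          using DERIV_mult[OF partial_has_derivative[OF f True that] partial_has_derivative[OF g True that]] \<kappa>_\<phi>[OF True]
          by (intro DERIV_imp_deriv) (simp add: algebra_simps)
        then have "(\<Sum>i<n. a i * partial i (\<lambda>y. f y * g y) p) =
            (\<Sum>i<n. f p * (a i * partial i g p) + g p * (a i * partial i f p))"
          by (intro sum.cong) (auto simp: algebra_simps)
        also have "\<dots> = f p * (\<Sum>i<n. a i * partial i g p) + g p * (\<Sum>i<n. a i * partial i f p)"
          by (simp add: sum.distrib sum_distrib_left)
        finally show ?thesis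
          using f g True fns_mult[OF X f g] by (simp add: V_def algebra_simps)
      qed
      ultimately show ?thesis by (simp add: tangent_def V_def)
    qed
  next
    fix f assume f: "f \<in> fns X"
    show "(\<lambda>p. V p f) \<in> fns X"
    proof (rule fns_local[OF X])
      fix p assume p: "p \<in> pts X"
      show "\<exists>h\<in>fns X. \<exists>W. openin (dtop X) W \<and> p \<in> W \<and> (\<forall>y\<in>W. V y f = h y)"
      proof (cases "p \<in> U")
        case False
        then have "p \<in> A" using \<psi>(4) p by blast
        then show ?thesis using \<psi>(3,5)
          by (intro bexI[OF _ fns_const[OF X, of 0]] exI[of _ A]) (auto simp: V_def)
      next
        case True
        obtain k W where k: "\<And>i. i < n \<Longrightarrow> k i \<in> fns (subspace_of X U)" and W: "openin (dtop X) W" "p \<in> W" "W \<subseteq> U"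
          and kW: "\<And>i y. i < n \<Longrightarrow> y \<in> W \<Longrightarrow> partial i f y = k i y"
          by (rule partial_smooth[OF f True]) blast
        have "(\<lambda>y. \<Sum>i<n. a i * k i y) \<in> fns (subspace_of X U)"
          using k by (intro fns_sum fns_mult fns_const) auto
        then obtain l W' where l: "l \<in> fns X" "openin (dtop X) W'" "p \<in> W'" "W' \<subseteq> U"
            "\<And>y. y \<in> W' \<Longrightarrow> (\<Sum>i<n. a i * k i y) = l y"
          by (rule fns_open_subspace_extend[OF X U _ True]) blast
        have "V y f = \<psi> y / \<psi> x * l y" if "y \<in> W \<inter> W'" for y
        proof -
          have "(\<Sum>i<n. a i * partial i f y) = (\<Sum>i<n. a i * k i y)"
            using that by (intro sum.cong) (auto simp: kW)
          then show ?thesis using f that W(3) l(5)[of y] by (auto simp: V_def)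
        qed
        moreover have "(\<lambda>y. \<psi> y / \<psi> x * l y) \<in> fns X"
          using fns_mult[OF X fns_mult[OF X \<psi>(1) fns_const[OF X, of "1 / \<psi> x"]] l(1)] by simp
        ultimately show ?thesis
          using W l by (intro bexI[rotated] exI[of _ "W \<inter> W'"]) auto
      qed
    qed
  qed
  moreover have "V x = v"
  proof
    fix f
    show "V x f = v f"
    proof (cases "f \<in> fns X")
      case True
      then show ?thesis using \<psi>(2) x a by (simp add: V_def)
    next
      case False
      then show ?thesis using v by (simp add: V_def tangent_def)
    qed
  qed
  ultimately show thesis by (rule that)
qed

end

lemma manifold_extend_tangent:
  assumes "manifold X" "x \<in> pts X" "v \<in> tangent X x"
  obtains V where "vector_field X V" "V x = v"
proof -
  obtain U n \<phi> \<kappa> where c: "smooth_chart X U n \<phi> \<kappa>" "x \<in> U"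
    by (rule manifold_chart[OF assms(1,2)])
  show thesis by (rule smooth_chart.extend_tangent[OF c assms(3)]) (rule that)
qed

text \<open>The fields in Koszul's formula are the result of a choice; only because fields through the given
  vectors exist are the chosen ones derivations, which kill the zero function.\<close>

lemma form_eq_ext_d_zero_form:
  assumes M: "manifold X"
  shows "form_eq X 2 (ext_d X 1 zero_form) zero_form"
  unfolding form_eq_def
proof (intro ballI allI impI)
  fix x vs assume x: "x \<in> pts X" and vs: "length vs = 2 \<and> set vs \<subseteq> tangent X x"
  have X: "saturated X" by (rule saturated_manifold[OF M])
  let ?P = "\<lambda>V. \<forall>i\<le>(1::nat). vector_field X (V i) \<and> V i x = vs ! i"
  have v: "vs ! i \<in> tangent X x" if "i \<le> 1" for i using vs that by (auto intro: nth_mem)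
  have "\<exists>W. vector_field X W \<and> W x = vs ! i" if "i \<le> 1" for i
    by (rule manifold_extend_tangent[OF M x v[OF that]]) blast
  then have "\<exists>V. ?P V" by metis
  then have V: "?P (SOME V. ?P V)" by (rule someI_ex)
  have "(SOME V. ?P V) i x (\<lambda>y. 0) = 0" if "i \<le> 1" for i
    using V v[OF that] tangent_const[OF X v[OF that]] that by simp
  then show "ext_d X 1 zero_form x vs = zero_form x vs"
    by (simp add: ext_d_def koszul_def zero_form_def)
qed

section \<open>Loops and their velocities\<close>

lemma fns_circle_differentiable:
  assumes "h \<in> fns circle"
  shows "(\<lambda>u. h (cis u)) differentiable (at t)"
proof -
  have "cis t \<in> sphere 0 1" by simp
  with assms obtain n g F W where *: "\<And>i. i < n \<Longrightarrow> g i \<in> {Re, Im}" "smooth_fun n F"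
    "openin (init_top (sphere 0 1) {Re, Im}) W" "cis t \<in> W"
    "\<And>y. y \<in> W \<Longrightarrow> h y = F (\<lambda>i. if i < n then g i y else 0)"
    unfolding circle_def by (rule fns_gen_spaceE) blast
  have "(\<lambda>s. g i (cis s)) differentiable (at t)" if "i < n" for i
    using *(1)[OF that] unfolding real_differentiable_def
    using exI[of "\<lambda>D. (cos has_real_derivative D) (at t)", OF DERIV_cos]
      exI[of "\<lambda>D. (sin has_real_derivative D) (at t)", OF DERIV_sin] by auto
  then have "(\<lambda>s. F (\<lambda>i. if i < n then g i (cis s) else 0)) differentiable (at t)"
    by (rule smooth_fun_along_curve[OF *(2)])
  then obtain d where d: "((\<lambda>s. F (\<lambda>i. if i < n then g i (cis s) else 0)) has_real_derivative d) (at t)"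
    unfolding real_differentiable_def by blast
  have "continuous_map euclideanreal (init_top (sphere 0 1) {Re, Im}) cis"
    by (rule continuous_map_into_init_top) (auto intro!: continuous_intros)
  from openin_continuous_map_preimage[OF this *(3)] have "open {s. cis s \<in> W}" by simp
  then have "((\<lambda>u. h (cis u)) has_real_derivative d) (at t)"
    by (rule has_field_derivative_transform_within_open[OF d]) (use *(4,5) in auto)
  then show ?thesis unfolding real_differentiable_def by blast
qed

lemma smooth_loop_differentiable:
  assumes f: "smooth_map circle X f" and g: "g \<in> fns X"
  shows "(\<lambda>u. g (f (cis (c * u)))) differentiable (at t)"
proof -
  obtain d where d: "((\<lambda>u. g (f (cis u))) has_real_derivative d) (at (c * t))"
    using fns_circle_differentiable[OF smooth_map_fns[OF f g]] unfolding real_differentiable_def by blast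
  have "((\<lambda>u. g (f (cis (c * u)))) has_real_derivative d * c) (at t)"
    by (rule DERIV_chain2[where f = "\<lambda>u. g (f (cis u))" and g = "\<lambda>u. c * u", OF d])
      (auto intro!: derivative_eq_intros)
  then show ?thesis unfolding real_differentiable_def by blast
qed

lemma velocity_tangent:
  assumes X: "saturated X" and c: "\<And>g. g \<in> fns X \<Longrightarrow> (\<lambda>u. g (c u)) differentiable (at t)"
  shows "velocity X c t \<in> tangent X (c t)"
proof -
  have D: "((\<lambda>u. g (c u)) has_real_derivative velocity X c t g) (at t)" if "g \<in> fns X" for g
    using c[OF that] that DERIV_deriv_iff_real_differentiable by (simp add: velocity_def)
  have "velocity X c t (\<lambda>y. a * f y + b * g y) = a * velocity X c t f + b * velocity X c t g"
    if "f \<in> fns X" "g \<in> fns X" for f g a b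
    using D[OF fns_add[OF X fns_mult[OF X fns_const[OF X] that(1)] fns_mult[OF X fns_const[OF X] that(2)]]]
    by (rule DERIV_unique) (auto intro!: derivative_eq_intros D that)
  moreover have "velocity X c t (\<lambda>y. f y * g y) = f (c t) * velocity X c t g + g (c t) * velocity X c t f"
    if "f \<in> fns X" "g \<in> fns X" for f g
    using D[OF fns_mult[OF X that]] by (rule DERIV_unique) (auto intro!: derivative_eq_intros D that)
  ultimately show ?thesis by (simp add: tangent_def) (simp add: velocity_def)
qed

lemma velocity_loop_tangent:
  assumes "saturated X" "smooth_map circle X f"
  shows "velocity X (\<lambda>u. f (cis (c * u))) t \<in> tangent X (f (cis (c * t)))"
  using velocity_tangent[of X "\<lambda>u. f (cis (c * u))" t] smooth_loop_differentiable[OF assms(2)] assms(1) by blast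

lemma dmap_velocity:
  assumes "smooth_map X Y f"
  shows "dmap Y f (velocity X c t) = velocity Y (\<lambda>u. f (c u)) t"
  using smooth_map_fns[OF assms] by (auto simp: dmap_def velocity_def fun_eq_iff o_def)

lemma velocity_const [simp]: "velocity X (\<lambda>u. x) t = (\<lambda>g. 0)"
  by (auto simp: velocity_def)

lemma velocity_shift: "velocity X (\<lambda>u. c (s + u)) 0 = velocity X c s"
proof -
  have "deriv (\<lambda>u. f (s + u)) 0 = deriv f s" for f :: "real \<Rightarrow> real"
    unfolding deriv_def using DERIV_at_within_shift[of f _ s 0 UNIV] by (simp add: add.commute)
  from this[of "\<lambda>u. g (c u)" for g] show ?thesis unfolding velocity_def by (intro ext) simp
qed

lemma zero_in_tangent: "(\<lambda>f. 0) \<in> tangent X x"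
  by (simp add: tangent_def)

lemma diff_form_1_add_scale:
  assumes "diff_form X 1 \<theta>" "x \<in> pts X" "u \<in> tangent X x" "w \<in> tangent X x"
  shows "\<theta> x [\<lambda>f. a * u f + b * w f] = a * \<theta> x [u] + b * \<theta> x [w]"
proof -
  have "length [u] = 1 \<and> set [u] \<subseteq> tangent X x" using assms(3) by simp
  then have "\<forall>i<1. \<forall>u'\<in>tangent X x. \<forall>w\<in>tangent X x. \<forall>a b.
      \<theta> x ([u][i := (\<lambda>f. a * u' f + b * w f)]) = a * \<theta> x ([u][i := u']) + b * \<theta> x ([u][i := w])"
    using assms(1,2) unfolding diff_form_def by blast
  then show ?thesis using assms(3,4) by fastforce
qed

lemma diff_form_1_scale:
  assumes "diff_form X 1 \<theta>" "x \<in> pts X" "u \<in> tangent X x"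
  shows "\<theta> x [\<lambda>f. a * u f] = a * \<theta> x [u]"
  using diff_form_1_add_scale[OF assms assms(3), of a 0] by simp

lemma diff_form_1_zero:
  assumes "diff_form X 1 \<theta>" "x \<in> pts X"
  shows "\<theta> x [\<lambda>f. 0] = 0"
  using diff_form_1_scale[OF assms zero_in_tangent, of 0] by simp

lemma diff_form_0_fns: "diff_form X 0 f \<Longrightarrow> (\<lambda>y. f y []) \<in> fns X"
  unfolding diff_form_def by (elim conjE allE[of _ "[]"]) simp

lemma diff_form_zero_form: "saturated X \<Longrightarrow> diff_form X k zero_form"
  using fns_const[of X 0] by (simp add: diff_form_def zero_form_def)

section \<open>Smooth characters of the circle\<close>

lemma cis_surj_circle: "z \<in> pts circle \<Longrightarrow> \<exists>t. z = cis t"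
  by (metis in_circle_iff cis_Arg cmod_eq_Re complex_mod_sqrt_Re_mult_cnj mult_1 norm_one of_real_1 rcis_cmod_Arg rcis_def)

lemma circle_mult: "z \<in> pts circle \<Longrightarrow> w \<in> pts circle \<Longrightarrow> z * w \<in> pts circle"
  by (simp add: in_circle_iff norm_mult)

lemma circle_powi: "z \<in> pts circle \<Longrightarrow> z powi k \<in> pts circle"
  by (simp add: in_circle_iff norm_power_int)

lemma one_in_circle [simp]: "1 \<in> pts circle" and cis_in_circle [simp]: "cis t \<in> pts circle"
  by (simp_all add: in_circle_iff)

lemma Re_Im_in_fns_circle: "Re \<in> fns circle" "Im \<in> fns circle"
  by (auto simp: circle_def intro: gen_space_generator)

text \<open>As a function of the angle, a smooth character satisfies \<open>h' = c h\<close>, hence \<open>h t = exp (c t)\<close>;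
  periodicity forces \<open>c\<close> to be an integral multiple of the imaginary unit.\<close>

lemma circle_character_powi:
  assumes \<rho>: "smooth_map circle circle \<rho>"
    and hom: "\<And>z w. z \<in> pts circle \<Longrightarrow> w \<in> pts circle \<Longrightarrow> \<rho> (z * w) = \<rho> z * \<rho> w"
  obtains k :: int where "\<And>z. z \<in> pts circle \<Longrightarrow> \<rho> z = z powi k"
proof -
  define h where "h t = \<rho> (cis t)" for t
  have h_add: "h (s + t) = h s * h t" for s t
    unfolding h_def cis_mult[symmetric] by (rule hom) simp_all
  have nz: "h t \<noteq> 0" for t
    using smooth_map_pts[OF \<rho>, of "cis t"] by (auto simp: h_def in_circle_iff)
  have h0: "h 0 = 1" using h_add[of 0 0] nz[of 0] by simp
  obtain a where a: "((\<lambda>u. Re (h u)) has_real_derivative a) (at 0)"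
    using fns_circle_differentiable[OF smooth_map_fns[OF \<rho> Re_Im_in_fns_circle(1)]]
    unfolding real_differentiable_def h_def by blast
  obtain b where b: "((\<lambda>u. Im (h u)) has_real_derivative b) (at 0)"
    using fns_circle_differentiable[OF smooth_map_fns[OF \<rho> Re_Im_in_fns_circle(2)]]
    unfolding real_differentiable_def h_def by blast
  define c where "c = Complex a b"
  have h': "(h has_vector_derivative c) (at 0)"
    unfolding has_vector_derivative_complex_iff c_def
    using a b by (simp add: has_real_derivative_iff_has_vector_derivative)
  have h't: "(h has_vector_derivative h t * c) (at t)" for t
  proof -
    have "((\<lambda>u. h (u - t)) has_vector_derivative 1 *\<^sub>R c) (at t)"
      by (rule vector_diff_chain_at[of "\<lambda>u. u - t" 1 t h c, unfolded o_def])
        (use h' in \<open>auto intro!: derivative_eq_intros\<close>)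
    then have "((\<lambda>u. h t * h (u - t)) has_vector_derivative h t * c) (at t)"
      by (simp add: has_vector_derivative_mult_right)
    then show ?thesis by (simp flip: h_add)
  qed
  have "((\<lambda>u. h u * exp (- (of_real u * c))) has_vector_derivative 0) (at t)" for t
  proof -
    have "((\<lambda>u. exp (- (of_real u * c))) has_vector_derivative exp (- (of_real t * c)) * (- c)) (at t)"
    proof -
      have "((\<lambda>u. - (of_real u * c)) has_vector_derivative - c) (at t)"
        unfolding has_vector_derivative_def scaleR_conv_of_real[symmetric]
        by (auto simp: scaleR_conv_of_real[symmetric] intro!: derivative_eq_intros)
      from field_vector_diff_chain_at[OF this, of exp "exp (- (of_real t * c))"]
      show ?thesis by (simp add: o_def mult.commute)
    qed
    from has_vector_derivative_mult[OF h't[of t] this] show ?thesis by (simp add: algebra_simps)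
  qed
  then obtain d where d: "\<And>t. h t * exp (- (of_real t * c)) = d"
    using has_vector_derivative_zero_constant[of UNIV "\<lambda>u. h u * exp (- (of_real u * c))"] by auto
  have "d = 1" using d[of 0] h0 by simp
  then have h_exp: "h t = exp (of_real t * c)" for t
    using d[of t] by (simp add: exp_minus field_simps)
  have "h (2 * pi) = h 0" by (simp add: h_def)
  then have "exp (of_real (2 * pi) * c) = 1" using h_exp[of "2 * pi"] h0 by simp
  then obtain k :: int where "Re (of_real (2 * pi) * c) = 0" "Im (of_real (2 * pi) * c) = of_int (2 * k) * pi"
    unfolding exp_eq_1 by blast
  then have "c = \<i> * of_int k" by (auto simp: complex_eq_iff)
  then have "h t = cis t powi k" for t
    unfolding h_exp cis_power_int by (simp add: cis_conv_exp mult.commute mult.left_commute)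
  then have "\<rho> z = z powi k" if "z \<in> pts circle" for z
    using cis_surj_circle[OF that] by (auto simp: h_def)
  then show thesis by (rule that)
qed

text \<open>A rotation by an irrational multiple of the full turn will do; irrational numbers exist because
  the rationals are countable.\<close>

lemma circle_element_of_infinite_order:
  obtains z where "z \<in> pts circle" "\<And>j k :: int. z powi j = z powi k \<Longrightarrow> j = k"
proof -
  have "\<exists>r::real. r \<notin> \<rat>"
    using countable_rat uncountable_UNIV_real by (metis UNIV_eq_I)
  then obtain r :: real where r: "r \<notin> \<rat>" by blast
  have "j = k" if "cis (2 * pi * r) powi j = cis (2 * pi * r) powi k" for j k :: int
  proof (rule ccontr)
    assume ne: "j \<noteq> k"
    have "cis (of_int j * (2 * pi * r)) = cis (of_int k * (2 * pi * r))"
      using that by (simp add: cis_power_int)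
    then have "cis (of_int j * (2 * pi * r) - of_int k * (2 * pi * r)) = 1"
      by (simp flip: cis_divide)
    then obtain n :: int where "of_int j * (2 * pi * r) - of_int k * (2 * pi * r) = of_int (2 * n) * pi"
      unfolding cis_conv_exp exp_eq_1 by auto
    then have "2 * pi * (of_int (j - k) * r) = 2 * pi * of_int n" by (simp add: algebra_simps)
    then have "of_int (j - k) * r = of_int n" by simp
    then have "r = of_int n / of_int (j - k)" using ne by (simp add: field_simps)
    then show False using r by (metis Rats_divide Rats_of_int)
  qed
  then show thesis using that[of "cis (2 * pi * r)"] by simp
qed

section \<open>Principal circle bundles\<close>

lemma smooth_map_circle_rotation:
  assumes w: "w \<in> pts circle"
  shows "smooth_map circle circle (\<lambda>z. z * w)"
proof -
  have c: "(\<lambda>z. a * Re z + b * Im z) \<in> fns circle" for a b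
    by (intro fns_add fns_mult fns_const Re_Im_in_fns_circle saturated_circle)
  have "smooth_map circle (gen_space (sphere 0 1) {Re, Im}) (\<lambda>z. z * w)"
  proof (rule smooth_map_into_gen_space[OF saturated_circle])
    show "z * w \<in> sphere 0 1" if "z \<in> pts circle" for z
      using circle_mult[OF that w] by (simp add: pts_circle)
    show "(\<lambda>z. g (z * w)) \<in> fns circle" if "g \<in> {Re, Im}" for g
      using that c[of "Re w" "- Im w"] c[of "Im w" "Re w"] by (auto simp: mult.commute algebra_simps)
  qed
  then show ?thesis by (simp add: circle_def[symmetric])
qed

lemma diffeoI:
  assumes Y: "saturated Y" and f: "smooth_map X Y f" and g: "smooth_map Y X g"
    and gf: "\<And>x. x \<in> pts X \<Longrightarrow> g (f x) = x" and fg: "\<And>y. y \<in> pts Y \<Longrightarrow> f (g y) = y"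
  shows "diffeo X Y f"
proof -
  have bij: "bij_betw f (pts X) (pts Y)"
    by (rule bij_betw_byWitness[of _ g]) (use gf fg smooth_map_pts[OF f] smooth_map_pts[OF g] in auto)
  have "inv_into (pts X) f y = g y" if "y \<in> pts Y" for y
    using that bij smooth_map_pts[OF g that] fg[OF that]
    by (metis bij_betw_def inv_into_f_f)
  then have "smooth_map Y X (inv_into (pts X) f)"
    by (intro smooth_map_cong[OF Y g]) auto
  then show ?thesis using f bij by (simp add: diffeo_def)
qed

lemma diffeoE:
  assumes "diffeo X Y f"
  obtains g where "smooth_map X Y f" "smooth_map Y X g" "\<And>x. x \<in> pts X \<Longrightarrow> g (f x) = x"
    "\<And>y. y \<in> pts Y \<Longrightarrow> f (g y) = y"
  by (rule that[of "inv_into (pts X) f"])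
    (use assms in \<open>auto simp: diffeo_def bij_betw_inv_into_left bij_betw_inv_into_right\<close>)

text \<open>The trivialisation together with its inverse \<open>\<Psi>\<close>; equivariance reduces \<open>\<Phi>\<close> to the local section
  \<open>u \<mapsto> \<Phi> (u, 1)\<close>.\<close>

lemma local_trivialization:
  assumes P: "principal_circle_bundle P B p act" and b: "b \<in> pts B"
  obtains U \<Phi> \<Psi> where "openin (dtop B) U" "b \<in> U" "U \<subseteq> pts B"
    "smooth_map (prod_space (subspace_of B U) circle) (subspace_of P {x. p x \<in> U}) \<Phi>"
    "smooth_map (subspace_of P {x. p x \<in> U}) (prod_space (subspace_of B U) circle) \<Psi>"
    "\<And>u z. u \<in> U \<Longrightarrow> z \<in> pts circle \<Longrightarrow> \<Psi> (\<Phi> (u, z)) = (u, z)"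
    "\<And>x. x \<in> pts P \<Longrightarrow> p x \<in> U \<Longrightarrow> \<Phi> (\<Psi> x) = x"
    "\<And>u z. u \<in> U \<Longrightarrow> z \<in> pts circle \<Longrightarrow> \<Phi> (u, z) \<in> pts P"
    "\<And>u z. u \<in> U \<Longrightarrow> z \<in> pts circle \<Longrightarrow> p (\<Phi> (u, z)) = u"
    "\<And>u z. u \<in> U \<Longrightarrow> z \<in> pts circle \<Longrightarrow> \<Phi> (u, z) = act z (\<Phi> (u, 1))"
    "\<And>x. x \<in> pts P \<Longrightarrow> p x \<in> U \<Longrightarrow> \<exists>z\<in>pts circle. \<Psi> x = (p x, z)"
proof -
  have "\<exists>U \<Phi>. openin (dtop B) U \<and> b \<in> U \<and>
      diffeo (prod_space (subspace_of B U) circle) (subspace_of P {x. p x \<in> U}) \<Phi> \<and>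
      (\<forall>u\<in>U. \<forall>z\<in>pts circle. p (\<Phi> (u, z)) = u \<and> (\<forall>w\<in>pts circle. \<Phi> (u, w * z) = act w (\<Phi> (u, z))))"
    using P b unfolding principal_circle_bundle_def by (elim conjE) (rule bspec)
  then obtain U \<Phi> where U: "openin (dtop B) U" "b \<in> U"
    and d: "diffeo (prod_space (subspace_of B U) circle) (subspace_of P {x. p x \<in> U}) \<Phi>"
    and \<Phi>: "\<forall>u\<in>U. \<forall>z\<in>pts circle. p (\<Phi> (u, z)) = u \<and>
        (\<forall>w\<in>pts circle. \<Phi> (u, w * z) = act w (\<Phi> (u, z)))"
    by (elim exE conjE) (rule that)
  have eq: "\<And>u z. u \<in> U \<Longrightarrow> z \<in> pts circle \<Longrightarrow> p (\<Phi> (u, z)) = u"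
      "\<And>u z w. u \<in> U \<Longrightarrow> z \<in> pts circle \<Longrightarrow> w \<in> pts circle \<Longrightarrow> \<Phi> (u, w * z) = act w (\<Phi> (u, z))"
    using \<Phi> by auto
  have UB: "U \<subseteq> pts B" using openin_subset[OF U(1)] by simp
  obtain \<Psi> where \<Psi>: "smooth_map (prod_space (subspace_of B U) circle) (subspace_of P {x. p x \<in> U}) \<Phi>"
    "smooth_map (subspace_of P {x. p x \<in> U}) (prod_space (subspace_of B U) circle) \<Psi>"
    "\<And>x. x \<in> pts (prod_space (subspace_of B U) circle) \<Longrightarrow> \<Psi> (\<Phi> x) = x"
    "\<And>y. y \<in> pts (subspace_of P {x. p x \<in> U}) \<Longrightarrow> \<Phi> (\<Psi> y) = y"
    using diffeoE[OF d] by blast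
  show thesis
  proof (rule that[OF U UB \<Psi>(1,2)])
    show "\<Psi> (\<Phi> (u, z)) = (u, z)" if "u \<in> U" "z \<in> pts circle" for u z
      using \<Psi>(3)[of "(u, z)"] that UB by auto
    show "\<Phi> (\<Psi> x) = x" if "x \<in> pts P" "p x \<in> U" for x
      using \<Psi>(4)[of x] that by auto
    show "\<Phi> (u, z) \<in> pts P" if "u \<in> U" "z \<in> pts circle" for u z
      using smooth_map_pts[OF \<Psi>(1), of "(u, z)"] that UB by auto
    show "\<Phi> (u, z) = act z (\<Phi> (u, 1))" if "u \<in> U" "z \<in> pts circle" for u z
      using eq(2)[OF that(1) one_in_circle that(2)] by simp
    show "\<exists>z\<in>pts circle. \<Psi> x = (p x, z)" if x: "x \<in> pts P" "p x \<in> U" for x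
    proof -
      obtain u z where uz: "\<Psi> x = (u, z)" by fastforce
      have "(u, z) \<in> pts (prod_space (subspace_of B U) circle)"
        using smooth_map_pts[OF \<Psi>(2), of x] x uz by simp
      then have "u \<in> U" "z \<in> pts circle" by auto
      moreover have "\<Phi> (u, z) = x" using \<Psi>(4)[of x] x uz by simp
      ultimately show ?thesis using eq(1)[of u z] uz by auto
    qed
  qed (rule eq(1))
qed

lemma
  assumes P: "principal_circle_bundle P B p act"
  shows principal_bundle_one: "x \<in> pts P \<Longrightarrow> act 1 x = x"
    and principal_bundle_mult: "z \<in> pts circle \<Longrightarrow> w \<in> pts circle \<Longrightarrow> x \<in> pts P \<Longrightarrow> act (z * w) x = act z (act w x)"
    and principal_bundle_proj: "z \<in> pts circle \<Longrightarrow> x \<in> pts P \<Longrightarrow> p (act z x) = p x"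
    and principal_bundle_smooth: "smooth_map (prod_space circle P) P (\<lambda>(z, x). act z x)"
    and principal_bundle_saturated: "saturated P" "saturated B"
    and principal_bundle_proj_smooth: "smooth_map P B p"
  using P saturated_manifold unfolding principal_circle_bundle_def by auto

lemma principal_bundle_act_pts:
  assumes "principal_circle_bundle P B p act" "z \<in> pts circle" "x \<in> pts P"
  shows "act z x \<in> pts P"
  using smooth_map_pts[OF principal_bundle_smooth[OF assms(1)], of "(z, x)"] assms(2,3) by simp

lemma principal_bundle_surj:
  assumes "principal_circle_bundle P B p act" "b \<in> pts B"
  shows "\<exists>x\<in>pts P. p x = b"
  by (rule local_trivialization[OF assms]) (metis one_in_circle)

lemma principal_bundle_smooth_orbit:
  assumes P: "principal_circle_bundle P B p act" and x: "x \<in> pts P"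
  shows "smooth_map circle P (\<lambda>z. act z x)"
  using smooth_map_compose[OF smooth_map_Pair[OF saturated_circle smooth_map_id smooth_map_const[OF saturated_circle x]]
      principal_bundle_smooth[OF P]] by simp

text \<open>In a trivialisation around the base point, the action of \<open>z\<close> on \<open>x0\<close> multiplies its circle
  coordinate \<open>z0\<close> by \<open>z\<close>; so the circle coordinate divided by \<open>z0\<close> is the inverse.\<close>

lemma principal_bundle_orbit_diffeo:
  assumes P: "principal_circle_bundle P B p act" and x0: "x0 \<in> pts P"
  shows "diffeo circle (subspace_of P {x \<in> pts P. p x = p x0}) (\<lambda>z. act z x0)"
proof -
  have b: "p x0 \<in> pts B" by (rule smooth_map_pts[OF principal_bundle_proj_smooth[OF P] x0])
  obtain U \<Phi> \<Psi> where tr: "openin (dtop B) U" "p x0 \<in> U" "U \<subseteq> pts B"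
    "smooth_map (prod_space (subspace_of B U) circle) (subspace_of P {x. p x \<in> U}) \<Phi>"
    "smooth_map (subspace_of P {x. p x \<in> U}) (prod_space (subspace_of B U) circle) \<Psi>"
    "\<And>u z. u \<in> U \<Longrightarrow> z \<in> pts circle \<Longrightarrow> \<Psi> (\<Phi> (u, z)) = (u, z)"
    "\<And>x. x \<in> pts P \<Longrightarrow> p x \<in> U \<Longrightarrow> \<Phi> (\<Psi> x) = x"
    "\<And>u z. u \<in> U \<Longrightarrow> z \<in> pts circle \<Longrightarrow> \<Phi> (u, z) \<in> pts P"
    "\<And>u z. u \<in> U \<Longrightarrow> z \<in> pts circle \<Longrightarrow> p (\<Phi> (u, z)) = u"
    "\<And>u z. u \<in> U \<Longrightarrow> z \<in> pts circle \<Longrightarrow> \<Phi> (u, z) = act z (\<Phi> (u, 1))"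
    "\<And>x. x \<in> pts P \<Longrightarrow> p x \<in> U \<Longrightarrow> \<exists>z\<in>pts circle. \<Psi> x = (p x, z)"
    by (rule local_trivialization[OF P b]) blast
  obtain z0 where z0: "z0 \<in> pts circle" "\<Psi> x0 = (p x0, z0)" using tr(11)[OF x0 tr(2)] by blast
  have inv_z0: "inverse z0 \<in> pts circle" and z0_nz: "z0 \<noteq> 0"
    using z0(1) by (auto simp: in_circle_iff norm_inverse)
  have one: "\<Phi> (p x0, 1) \<in> pts P" using tr(8)[OF tr(2) one_in_circle] .
  have x0_eq: "x0 = act z0 (\<Phi> (p x0, 1))"
    using tr(7)[OF x0 tr(2)] tr(10)[OF tr(2) z0(1)] z0(2) by simp
  have act_x0: "act z x0 = \<Phi> (p x0, z * z0)" if z: "z \<in> pts circle" for z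
    using principal_bundle_mult[OF P z z0(1) one] x0_eq tr(10)[OF tr(2) circle_mult[OF z z0(1)]] by simp
  let ?F = "subspace_of P {x \<in> pts P. p x = p x0}"
  show ?thesis
  proof (rule diffeoI)
    show "smooth_map circle ?F (\<lambda>z. act z x0)"
      by (rule smooth_map_into_subspace[OF saturated_circle principal_bundle_smooth_orbit[OF P x0]])
        (use principal_bundle_act_pts[OF P _ x0] principal_bundle_proj[OF P _ x0] in auto)
    have "smooth_map ?F (subspace_of P {x. p x \<in> U}) (\<lambda>x. x)"
      by (rule smooth_map_into_subspace[OF _ smooth_map_inclusion]) (use tr(2) in auto)
    from smooth_map_compose[OF smooth_map_compose[OF smooth_map_compose[OF this tr(5)] smooth_map_snd]
        smooth_map_circle_rotation[OF inv_z0]]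
    show "smooth_map ?F circle (\<lambda>x. snd (\<Psi> x) * inverse z0)" .
    show "snd (\<Psi> (act z x0)) * inverse z0 = z" if "z \<in> pts circle" for z
      using act_x0[OF that] tr(6)[OF tr(2) circle_mult[OF that z0(1)]] z0_nz by simp
    show "act (snd (\<Psi> x) * inverse z0) x0 = x" if "x \<in> pts ?F" for x
    proof -
      have x: "x \<in> pts P" "p x = p x0" using that by auto
      obtain z where z: "z \<in> pts circle" "\<Psi> x = (p x0, z)" using tr(11)[OF x(1)] x(2) tr(2) by auto
      have "act (z * inverse z0) x0 = \<Phi> (p x0, z)"
        using act_x0[OF circle_mult[OF z(1) inv_z0]] z0_nz by (simp add: mult.assoc)
      then show ?thesis using tr(7)[OF x(1)] x(2) tr(2) z(2) by simp
    qed
  qed simp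
qed

lemma principal_bundle_free:
  assumes "principal_circle_bundle P B p act" "x0 \<in> pts P" "z \<in> pts circle" "w \<in> pts circle" "act z x0 = act w x0"
  shows "z = w"
  using principal_bundle_orbit_diffeo[OF assms(1,2)] assms(3-5) by (auto simp: diffeo_def bij_betw_def inj_on_def)

section \<open>The weight of the isotropy action\<close>

locale bundle_over_extension =
  fixes \<Gamma> :: "('m, 'g) groupoid" and R :: "('m, 'r) groupoid"
    and \<pi> :: "'r \<Rightarrow> 'g" and act :: "complex \<Rightarrow> 'r \<Rightarrow> 'r"
    and L :: "('m, 'r, 'l) circle_bundle"
  assumes extension: "circle_central_extension \<Gamma> R \<pi> act"
    and circle_bundle: "groupoid_circle_bundle R L"
begin

abbreviation unit_circle :: "'m \<Rightarrow> complex \<Rightarrow> 'r" where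
  "unit_circle \<equiv> unit_circle_map R act"

lemma extension_bundle: "principal_circle_bundle (ar R) (ar \<Gamma>) \<pi> act"
  using extension by (simp add: circle_central_extension_def)

lemma fibre_bundle: "principal_circle_bundle (tot L) (ob R) (prj L) (\<lambda>z l. rac L l z)"
  using circle_bundle by (simp add: groupoid_circle_bundle_def)

lemma ob_eq: "ob R = ob \<Gamma>"
  using extension by (simp add: circle_central_extension_def)

lemma lie_groupoid_total: "lie_groupoid R" and lie_groupoid_base: "lie_groupoid \<Gamma>"
  using extension by (simp_all add: circle_central_extension_def)

lemma manifold_ob: "manifold (ob R)"
  using lie_groupoid_total by (simp add: lie_groupoid_def)

lemma saturated_spaces [simp]: "saturated (ar R)" "saturated (ob R)" "saturated (tot L)"
  using principal_bundle_saturated[OF extension_bundle] principal_bundle_saturated[OF fibre_bundle] by simp_all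

lemma smooth_src: "smooth_map (ar R) (ob R) (src R)" and smooth_tgt: "smooth_map (ar R) (ob R) (tgt R)"
  and smooth_idn: "smooth_map (ob R) (ar R) (idn R)"
  using lie_groupoid_total by (simp_all add: lie_groupoid_def submersion_def)

lemma src_idn: "x \<in> pts (ob R) \<Longrightarrow> src R (idn R x) = x" and tgt_idn: "x \<in> pts (ob R) \<Longrightarrow> tgt R (idn R x) = x"
  and idn_mul: "g \<in> pts (ar R) \<Longrightarrow> mul R (idn R (src R g)) g = g"
  and mul_idn: "g \<in> pts (ar R) \<Longrightarrow> mul R g (idn R (tgt R g)) = g"
  using lie_groupoid_total by (simp_all add: lie_groupoid_def)

lemma src_\<pi>: "g \<in> pts (ar R) \<Longrightarrow> src \<Gamma> (\<pi> g) = src R g"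
  and tgt_\<pi>: "g \<in> pts (ar R) \<Longrightarrow> tgt \<Gamma> (\<pi> g) = tgt R g"
  and \<pi>_idn: "x \<in> pts (ob R) \<Longrightarrow> \<pi> (idn R x) = idn \<Gamma> x"
  using extension by (simp_all add: circle_central_extension_def groupoid_morphism_def)

lemma pts_ar2: "pts (ar2 R) = {(g, h). g \<in> pts (ar R) \<and> h \<in> pts (ar R) \<and> tgt R g = src R h}"
  by (auto simp: ar2_def)

lemma pts_act_space: "pts (act_space R L) = {(g, l). g \<in> pts (ar R) \<and> l \<in> pts (tot L) \<and> tgt R g = prj L l}"
  by (auto simp: act_space_def)

lemma central:
  assumes "x \<in> pts (ar R)" "y \<in> pts (ar R)" "tgt R x = src R y" "z \<in> pts circle" "w \<in> pts circle"
  shows "mul R (act z x) (act w y) = act (z * w) (mul R x y)"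
proof -
  have "\<forall>(x, y)\<in>pts (ar2 R). \<forall>z\<in>pts circle. \<forall>w\<in>pts circle.
        mul R (act z x) (act w y) = act (z * w) (mul R x y)"
    using extension by (simp add: circle_central_extension_def)
  then show ?thesis using assms unfolding pts_ar2 by blast
qed

lemma idn_pts: "x \<in> pts (ob R) \<Longrightarrow> idn R x \<in> pts (ar R)"
  by (rule smooth_map_pts[OF smooth_idn])

lemma unit_circle_pts: "m \<in> pts (ob R) \<Longrightarrow> z \<in> pts circle \<Longrightarrow> unit_circle m z \<in> pts (ar R)"
  unfolding unit_circle_map_def by (rule principal_bundle_act_pts[OF extension_bundle _ idn_pts])

lemma \<pi>_unit_circle: "m \<in> pts (ob R) \<Longrightarrow> z \<in> pts circle \<Longrightarrow> \<pi> (unit_circle m z) = idn \<Gamma> m"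
  unfolding unit_circle_map_def using principal_bundle_proj[OF extension_bundle _ idn_pts] \<pi>_idn by simp

lemma src_unit_circle: "m \<in> pts (ob R) \<Longrightarrow> z \<in> pts circle \<Longrightarrow> src R (unit_circle m z) = m"
  and tgt_unit_circle: "m \<in> pts (ob R) \<Longrightarrow> z \<in> pts circle \<Longrightarrow> tgt R (unit_circle m z) = m"
  using src_\<pi>[OF unit_circle_pts] tgt_\<pi>[OF unit_circle_pts] src_\<pi>[OF idn_pts] tgt_\<pi>[OF idn_pts]
    \<pi>_unit_circle \<pi>_idn src_idn tgt_idn by metis+

lemma smooth_unit_circle: "m \<in> pts (ob R) \<Longrightarrow> smooth_map circle (ar R) (unit_circle m)"
  unfolding unit_circle_map_def by (rule principal_bundle_smooth_orbit[OF extension_bundle idn_pts])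

lemma unit_circle_mult:
  assumes "m \<in> pts (ob R)" "z \<in> pts circle" "w \<in> pts circle"
  shows "mul R (unit_circle m z) (unit_circle m w) = unit_circle m (z * w)"
  using central[OF idn_pts[OF assms(1)] idn_pts[OF assms(1)] _ assms(2,3)] idn_mul[OF idn_pts[OF assms(1)]]
    src_idn[OF assms(1)] tgt_idn[OF assms(1)] by (simp add: unit_circle_map_def)

lemma smooth_lac: "smooth_map (act_space R L) (tot L) (\<lambda>(g, l). lac L g l)"
  using circle_bundle by (simp add: groupoid_circle_bundle_def)

lemma
  assumes "g \<in> pts (ar R)" "l \<in> pts (tot L)" "tgt R g = prj L l"
  shows lac_pts: "lac L g l \<in> pts (tot L)" and prj_lac: "prj L (lac L g l) = src R g"
    and lac_rac: "z \<in> pts circle \<Longrightarrow> lac L g (rac L l z) = rac L (lac L g l) z"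
proof -
  have gl: "(g, l) \<in> pts (act_space R L)" using assms by (simp add: pts_act_space)
  show "lac L g l \<in> pts (tot L)" using smooth_map_pts[OF smooth_lac gl] by simp
  show "prj L (lac L g l) = src R g" "z \<in> pts circle \<Longrightarrow> lac L g (rac L l z) = rac L (lac L g l) z"
    using circle_bundle gl unfolding groupoid_circle_bundle_def by blast+
qed

lemma lac_mul:
  assumes "g \<in> pts (ar R)" "h \<in> pts (ar R)" "tgt R g = src R h" "l \<in> pts (tot L)" "tgt R h = prj L l"
  shows "lac L (mul R g h) l = lac L g (lac L h l)"
proof -
  have "\<forall>(g, h)\<in>pts (ar2 R). \<forall>l\<in>pts (tot L). tgt R h = prj L l \<longrightarrow>
        lac L (mul R g h) l = lac L g (lac L h l)"
    using circle_bundle by (simp add: groupoid_circle_bundle_def)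
  then show ?thesis using assms unfolding pts_ar2 by blast
qed

lemma rac_pts: "z \<in> pts circle \<Longrightarrow> l \<in> pts (tot L) \<Longrightarrow> rac L l z \<in> pts (tot L)"
  by (rule principal_bundle_act_pts[OF fibre_bundle])

lemma prj_rac: "z \<in> pts circle \<Longrightarrow> l \<in> pts (tot L) \<Longrightarrow> prj L (rac L l z) = prj L l"
  by (rule principal_bundle_proj[OF fibre_bundle])

lemma rac_rac: "z \<in> pts circle \<Longrightarrow> w \<in> pts circle \<Longrightarrow> l \<in> pts (tot L) \<Longrightarrow> rac L (rac L l w) z = rac L l (w * z)"
  using principal_bundle_mult[OF fibre_bundle, of z w l] by (simp add: mult.commute)

lemma rac_inject:
  "l \<in> pts (tot L) \<Longrightarrow> z \<in> pts circle \<Longrightarrow> w \<in> pts circle \<Longrightarrow> rac L l z = rac L l w \<Longrightarrow> z = w"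
  using principal_bundle_free[OF fibre_bundle, of l z w] by simp

lemma fibre_point:
  assumes "m \<in> pts (ob R)" obtains l where "l \<in> pts (tot L)" "prj L l = m"
  using principal_bundle_surj[OF fibre_bundle assms] by blast

definition has_weight :: "'m \<Rightarrow> int \<Rightarrow> bool" where
  "has_weight m k \<longleftrightarrow> (\<forall>z\<in>pts circle. \<forall>l\<in>pts (tot L). prj L l = m \<longrightarrow>
     lac L (unit_circle m z) l = rac L l (z powi k))"

lemma fibre_coordinate:
  assumes l: "l \<in> pts (tot L)"
  obtains \<kappa> where "smooth_map (subspace_of (tot L) {x \<in> pts (tot L). prj L x = prj L l}) circle \<kappa>"
    "\<And>z. z \<in> pts circle \<Longrightarrow> \<kappa> (rac L l z) = z"
    "\<And>x. x \<in> pts (tot L) \<Longrightarrow> prj L x = prj L l \<Longrightarrow> rac L l (\<kappa> x) = x"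
    "\<And>x. x \<in> pts (tot L) \<Longrightarrow> prj L x = prj L l \<Longrightarrow> \<kappa> x \<in> pts circle"
proof -
  let ?F = "subspace_of (tot L) {x \<in> pts (tot L). prj L x = prj L l}"
  obtain \<kappa> where \<kappa>: "smooth_map ?F circle \<kappa>" "\<And>z. z \<in> pts circle \<Longrightarrow> \<kappa> (rac L l z) = z"
    "\<And>x. x \<in> pts ?F \<Longrightarrow> rac L l (\<kappa> x) = x"
    by (rule diffeoE[OF principal_bundle_orbit_diffeo[OF fibre_bundle l]]) blast
  have "\<kappa> x \<in> pts circle" if "x \<in> pts (tot L)" "prj L x = prj L l" for x
    using smooth_map_pts[OF \<kappa>(1), of x] that by simp
  then show thesis using \<kappa> that by simp
qed

lemma smooth_unit_circle_point:
  assumes l: "l \<in> pts (tot L)" and "prj L l = m" "m \<in> pts (ob R)"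
  shows "smooth_map circle (act_space R L) (\<lambda>z. (unit_circle m z, l))"
  unfolding act_space_def
  by (rule smooth_map_into_subspace[OF saturated_circle smooth_map_Pair[OF saturated_circle
        smooth_unit_circle[OF assms(3)] smooth_map_const[OF saturated_circle l]]])
    (use assms tgt_unit_circle in auto)

text \<open>Comparing the action of the unit circle on one point \<open>l\<close> with the structure action gives a smooth map
  \<open>\<rho> : S\<^sup>1 \<rightarrow> S\<^sup>1\<close>. As the two actions commute, \<open>\<rho>\<close> is the same for all points of the fibre, and therefore
  a homomorphism.\<close>

lemma has_weight_exists:
  assumes m: "m \<in> pts (ob R)"
  obtains k where "has_weight m k"
proof -
  obtain l where l: "l \<in> pts (tot L)" "prj L l = m" by (rule fibre_point[OF m])
  obtain \<kappa> where \<kappa>: "smooth_map (subspace_of (tot L) {x \<in> pts (tot L). prj L x = prj L l}) circle \<kappa>"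
    "\<And>z. z \<in> pts circle \<Longrightarrow> \<kappa> (rac L l z) = z"
    "\<And>x. x \<in> pts (tot L) \<Longrightarrow> prj L x = prj L l \<Longrightarrow> rac L l (\<kappa> x) = x"
    "\<And>x. x \<in> pts (tot L) \<Longrightarrow> prj L x = prj L l \<Longrightarrow> \<kappa> x \<in> pts circle"
    by (rule fibre_coordinate[OF l(1)]) blast
  define \<rho> where "\<rho> z = \<kappa> (lac L (unit_circle m z) l)" for z
  note u = unit_circle_pts[OF m] tgt_unit_circle[OF m] src_unit_circle[OF m]
  have img: "lac L (unit_circle m z) x \<in> pts (tot L)" "prj L (lac L (unit_circle m z) x) = m"
    if "z \<in> pts circle" "x \<in> pts (tot L)" "prj L x = m" for z x
    using lac_pts[OF u(1)[OF that(1)] that(2)] prj_lac[OF u(1)[OF that(1)] that(2)] u(2,3)[OF that(1)] that(3)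
    by simp_all
  have \<rho>_circle: "\<rho> z \<in> pts circle" if "z \<in> pts circle" for z
    unfolding \<rho>_def using img[OF that l] l(2) by (intro \<kappa>(4)) auto
  have \<rho>_l: "lac L (unit_circle m z) l = rac L l (\<rho> z)" if "z \<in> pts circle" for z
    unfolding \<rho>_def using img[OF that l] l(2) by (intro \<kappa>(3)[symmetric]) auto
  have \<rho>_any: "lac L (unit_circle m z) x = rac L x (\<rho> z)" if z: "z \<in> pts circle" and x: "x \<in> pts (tot L)" "prj L x = m" for z x
  proof -
    have px: "prj L x = prj L l" using x l by simp
    define w where "w = \<kappa> x"
    have w: "w \<in> pts circle" "x = rac L l w" using \<kappa>(3,4)[OF x(1) px] by (simp_all add: w_def)
    have "lac L (unit_circle m z) x = rac L (lac L (unit_circle m z) l) w"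
      unfolding w(2) using lac_rac[OF u(1)[OF z] l(1) _ w(1)] u(2)[OF z] l(2) by simp
    also have "\<dots> = rac L l (\<rho> z * w)" unfolding \<rho>_l[OF z] by (rule rac_rac[OF w(1) \<rho>_circle[OF z] l(1)])
    also have "\<dots> = rac L x (\<rho> z)"
      unfolding w(2) rac_rac[OF \<rho>_circle[OF z] w(1) l(1)] by (simp add: mult.commute)
    finally show ?thesis .
  qed
  have "smooth_map circle (tot L) (\<lambda>z. lac L (unit_circle m z) l)"
    using smooth_map_compose[OF smooth_unit_circle_point[OF l m] smooth_lac] by simp
  then have "smooth_map circle (subspace_of (tot L) {x \<in> pts (tot L). prj L x = prj L l}) (\<lambda>z. lac L (unit_circle m z) l)"
    by (rule smooth_map_into_subspace[OF saturated_circle]) (use img[OF _ l] l(2) in auto)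
  then have smooth: "smooth_map circle circle \<rho>"
    unfolding \<rho>_def by (rule smooth_map_compose[OF _ \<kappa>(1)])
  have "\<rho> (z * w) = \<rho> z * \<rho> w" if z: "z \<in> pts circle" and w: "w \<in> pts circle" for z w
  proof -
    have "rac L l (\<rho> (z * w)) = lac L (mul R (unit_circle m z) (unit_circle m w)) l"
      by (simp add: \<rho>_l circle_mult z w unit_circle_mult m)
    also have "\<dots> = lac L (unit_circle m z) (lac L (unit_circle m w) l)"
      using u z w l by (intro lac_mul) auto
    also have "\<dots> = rac L (rac L l (\<rho> w)) (\<rho> z)"
      using \<rho>_any[OF z img[OF w l]] \<rho>_l[OF w] by simp
    also have "\<dots> = rac L l (\<rho> w * \<rho> z)"
      by (rule rac_rac[OF \<rho>_circle[OF z] \<rho>_circle[OF w] l(1)])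
    finally show ?thesis
      using rac_inject[OF l(1) \<rho>_circle[OF circle_mult[OF z w]] circle_mult[OF \<rho>_circle[OF w] \<rho>_circle[OF z]]]
      by (simp add: mult.commute)
  qed
  from circle_character_powi[OF smooth this] obtain k :: int where "\<And>z. z \<in> pts circle \<Longrightarrow> \<rho> z = z powi k"
    by blast
  then have "has_weight m k" unfolding has_weight_def using \<rho>_any by simp
  then show thesis by (rule that)
qed

text \<open>A coordinate on the fibre that is equivariant for the structure action turns the action of the unit
  circle into multiplication by \<open>z powi k\<close>; conversely, any isomorphism with a standard bundle
  recovers the exponent by evaluation at a rotation of infinite order.\<close>

lemma Ind_at_eq_weight:
  assumes m: "m \<in> pts (ob R)" and k: "has_weight m k"
  shows "Ind_at R act L m = k"
proof -
  obtain l where l: "l \<in> pts (tot L)" "prj L l = m" by (rule fibre_point[OF m])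
  obtain \<kappa> where \<kappa>: "smooth_map (subspace_of (tot L) {x \<in> pts (tot L). prj L x = prj L l}) circle \<kappa>"
    "\<And>z. z \<in> pts circle \<Longrightarrow> \<kappa> (rac L l z) = z"
    "\<And>x. x \<in> pts (tot L) \<Longrightarrow> prj L x = prj L l \<Longrightarrow> rac L l (\<kappa> x) = x"
    "\<And>x. x \<in> pts (tot L) \<Longrightarrow> prj L x = prj L l \<Longrightarrow> \<kappa> x \<in> pts circle"
    by (rule fibre_coordinate[OF l(1)]) blast
  let ?P = "bundle_pullback circle_groupoid (\<lambda>_. m) (unit_circle_map R act m) L"
  have tot: "tot ?P = subspace_of (prod_space point (tot L)) {(x, y). m = prj L y}"
    and prj: "prj ?P = fst" and rac: "rac ?P = (\<lambda>(x, y) z. (x, rac L y z))"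
    and lac: "lac ?P = (\<lambda>z (x, y). ((), lac L (unit_circle m z) y))"
    by (simp_all add: bundle_pullback_def circle_groupoid_def)
  have pts_tot: "p \<in> pts (tot ?P) \<longleftrightarrow> snd p \<in> pts (tot L) \<and> prj L (snd p) = m" for p
    unfolding tot by (cases p) auto
  have pts_act: "(z, p) \<in> pts (act_space circle_groupoid ?P) \<longleftrightarrow> z \<in> pts circle \<and> p \<in> pts (tot ?P)" for z p
    unfolding act_space_def by (auto simp: circle_groupoid_def)
  have lac_eq: "lac ?P z p = rac ?P p (z powi k)" if "z \<in> pts circle" "p \<in> pts (tot ?P)" for z p
    using k that unfolding has_weight_def lac rac pts_tot by (cases p) auto
  have "bundle_iso circle_groupoid ?P (B_bundle k)"
    unfolding bundle_iso_def
  proof (intro exI conjI ballI)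
    show "diffeo (tot ?P) (tot (B_bundle k)) (\<lambda>p. \<kappa> (snd p))"
    proof (rule diffeoI)
      show "saturated (tot (B_bundle k))" by (simp add: B_bundle_def)
      have "smooth_map (tot ?P) (subspace_of (tot L) {x \<in> pts (tot L). prj L x = prj L l}) snd"
        unfolding tot
        by (rule smooth_map_into_subspace[OF saturated_subspace_of smooth_map_from_subspace[OF smooth_map_snd]])
          (use l(2) in auto)
      from smooth_map_compose[OF this \<kappa>(1)]
      show "smooth_map (tot ?P) (tot (B_bundle k)) (\<lambda>p. \<kappa> (snd p))" by (simp add: B_bundle_def)
      have "smooth_map circle (prod_space point (tot L)) (\<lambda>z. ((), rac L l z))"
        by (intro smooth_map_Pair saturated_circle smooth_map_const principal_bundle_smooth_orbit[OF fibre_bundle l(1)]) simp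
      then have "smooth_map circle (tot ?P) (\<lambda>z. ((), rac L l z))"
        unfolding tot by (rule smooth_map_into_subspace[OF saturated_circle])
          (use prj_rac[OF _ l(1)] l(2) in auto)
      then show "smooth_map (tot (B_bundle k)) (tot ?P) (\<lambda>z. ((), rac L l z))" by (simp add: B_bundle_def)
      show "((), rac L l (\<kappa> (snd p))) = p" if "p \<in> pts (tot ?P)" for p
        using that \<kappa>(3)[of "snd p"] l(2) unfolding pts_tot by (cases p) auto
      show "\<kappa> (snd ((), rac L l z)) = z" if "z \<in> pts (tot (B_bundle k))" for z
        using that \<kappa>(2) by (simp add: B_bundle_def)
    qed
    show eqv: "\<kappa> (snd (rac ?P p z)) = rac (B_bundle k) (\<kappa> (snd p)) z"
      if p: "p \<in> pts (tot ?P)" and z: "z \<in> pts circle" for p z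
    proof -
      have y: "snd p \<in> pts (tot L)" "prj L (snd p) = prj L l" using p l(2) unfolding pts_tot by auto
      have "rac L (snd p) z = rac L (rac L l (\<kappa> (snd p))) z" using \<kappa>(3)[OF y] by simp
      also have "\<dots> = rac L l (\<kappa> (snd p) * z)" by (rule rac_rac[OF z \<kappa>(4)[OF y] l(1)])
      finally have "\<kappa> (rac L (snd p) z) = \<kappa> (snd p) * z"
        using \<kappa>(2)[OF circle_mult[OF \<kappa>(4)[OF y] z]] by simp
      then show ?thesis unfolding rac by (cases p) (simp add: B_bundle_def)
    qed
    show "case q of (z, p) \<Rightarrow> \<kappa> (snd (lac ?P z p)) = lac (B_bundle k) z (\<kappa> (snd p))"
      if q: "q \<in> pts (act_space circle_groupoid ?P)" for q
    proof -
      obtain z p where zp: "q = (z, p)" by (cases q) auto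
      then have z: "z \<in> pts circle" and p: "p \<in> pts (tot ?P)" using q pts_act by auto
      show ?thesis
        using eqv[OF p circle_powi[OF z, of k]] lac_eq[OF z p] zp by (simp add: B_bundle_def mult.commute)
    qed
  qed simp
  moreover have "j = k" if j: "bundle_iso circle_groupoid ?P (B_bundle j)" for j
  proof -
    obtain \<Phi> where \<Phi>: "diffeo (tot ?P) (tot (B_bundle j)) \<Phi>"
      "\<forall>p\<in>pts (tot ?P). \<forall>z\<in>pts circle. \<Phi> (rac ?P p z) = rac (B_bundle j) (\<Phi> p) z"
      "\<forall>(z, p)\<in>pts (act_space circle_groupoid ?P). \<Phi> (lac ?P z p) = lac (B_bundle j) z (\<Phi> p)"
      using j unfolding bundle_iso_def by blast
    obtain z where z: "z \<in> pts circle" "\<And>j k :: int. z powi j = z powi k \<Longrightarrow> j = k"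
      by (rule circle_element_of_infinite_order) blast
    have p: "((), l) \<in> pts (tot ?P)" using l unfolding pts_tot by simp
    have "\<Phi> ((), l) \<in> pts circle"
      using \<Phi>(1) p by (auto simp: diffeo_def smooth_map_def B_bundle_def)
    then have nz: "\<Phi> ((), l) \<noteq> 0" by (auto simp: in_circle_iff)
    have "\<Phi> ((), l) * z powi k = \<Phi> (rac ?P ((), l) (z powi k))"
      using \<Phi>(2) p circle_powi[OF z(1)] by (simp add: B_bundle_def)
    also have "\<dots> = z powi j * \<Phi> ((), l)"
      using \<Phi>(3) p z(1) pts_act[of z "((), l)"] lac_eq[OF z(1) p] by (force simp: B_bundle_def)
    finally have "z powi j = z powi k" using nz by simp
    then show ?thesis by (rule z(2))
  qed
  ultimately show ?thesis unfolding Ind_at_def by (rule the_equality)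
qed

subsection \<open>Independence of the base point\<close>

text \<open>Centrality lets the unit circles at the two ends of \<open>g\<close> pass through \<open>g\<close>, so \<open>l \<mapsto> g \<cdot> l\<close> intertwines
  their actions on the fibres.\<close>

lemma has_weight_invariant:
  assumes g: "g \<in> pts (ar R)" and j: "has_weight (src R g) j" and k: "has_weight (tgt R g) k"
  shows "j = k"
proof -
  have a: "src R g \<in> pts (ob R)" and b: "tgt R g \<in> pts (ob R)"
    using smooth_map_pts[OF smooth_src g] smooth_map_pts[OF smooth_tgt g] .
  obtain l where l: "l \<in> pts (tot L)" "prj L l = tgt R g" by (rule fibre_point[OF b])
  obtain z where z: "z \<in> pts circle" "\<And>j k :: int. z powi j = z powi k \<Longrightarrow> j = k"
    by (rule circle_element_of_infinite_order) blast
  have gl: "lac L g l \<in> pts (tot L)" "prj L (lac L g l) = src R g"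
    using lac_pts[OF g] prj_lac[OF g] l by simp_all
  have "mul R (unit_circle (src R g) z) g = act z (mul R (idn R (src R g)) g)"
    using central[OF idn_pts[OF a] g _ z(1) one_in_circle] tgt_idn[OF a] principal_bundle_one[OF extension_bundle g]
    by (simp add: unit_circle_map_def)
  moreover have "mul R g (unit_circle (tgt R g) z) = act z (mul R g (idn R (tgt R g)))"
    using central[OF g idn_pts[OF b] _ one_in_circle z(1)] src_idn[OF b] principal_bundle_one[OF extension_bundle g]
    by (simp add: unit_circle_map_def)
  ultimately have comm: "mul R (unit_circle (src R g) z) g = mul R g (unit_circle (tgt R g) z)"
    using idn_mul[OF g] mul_idn[OF g] by simp
  have "rac L (lac L g l) (z powi j) = lac L (unit_circle (src R g) z) (lac L g l)"
    using j gl z(1) unfolding has_weight_def by simp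
  also have "\<dots> = lac L (mul R (unit_circle (src R g) z) g) l"
    using l tgt_unit_circle[OF a z(1)] by (intro lac_mul[symmetric] unit_circle_pts a z g) auto
  also have "\<dots> = lac L g (lac L (unit_circle (tgt R g) z) l)"
    unfolding comm using l src_unit_circle[OF b z(1)] tgt_unit_circle[OF b z(1)]
    by (intro lac_mul unit_circle_pts b z g) auto
  also have "\<dots> = lac L g (rac L l (z powi k))"
    using k l z(1) unfolding has_weight_def by simp
  also have "\<dots> = rac L (lac L g l) (z powi k)"
    using l by (intro lac_rac g circle_powi z) auto
  finally show ?thesis
    using rac_inject[OF gl(1) circle_powi[OF z(1)] circle_powi[OF z(1)]] z(2) by blast
qed

definition weight :: "'m \<Rightarrow> int" where
  "weight m = (SOME k. has_weight m k)"

lemma has_weight_weight: "m \<in> pts (ob R) \<Longrightarrow> has_weight m (weight m)"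
  unfolding weight_def by (metis has_weight_exists someI_ex)

text \<open>Over a trivialising open set with local section \<open>\<sigma>\<close>, the point \<open>\<sigma> u\<close> is moved by the unit circle
  at \<open>u\<close> to the point with circle coordinate \<open>z powi weight u\<close>. That coordinate depends smoothly on \<open>u\<close>.\<close>

lemma fns_weight:
  assumes z: "z \<in> pts circle" and h: "h \<in> fns circle"
  shows "(\<lambda>m. h (z powi weight m)) \<in> fns (ob R)"
proof (rule fns_local)
  fix m assume m: "m \<in> pts (ob R)"
  obtain U \<Phi> \<Psi> where tr: "openin (dtop (ob R)) U" "m \<in> U" "U \<subseteq> pts (ob R)"
    "smooth_map (prod_space (subspace_of (ob R) U) circle) (subspace_of (tot L) {x. prj L x \<in> U}) \<Phi>"
    "smooth_map (subspace_of (tot L) {x. prj L x \<in> U}) (prod_space (subspace_of (ob R) U) circle) \<Psi>"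
    "\<And>u z. u \<in> U \<Longrightarrow> z \<in> pts circle \<Longrightarrow> \<Psi> (\<Phi> (u, z)) = (u, z)"
    "\<And>u z. u \<in> U \<Longrightarrow> z \<in> pts circle \<Longrightarrow> \<Phi> (u, z) \<in> pts (tot L)"
    "\<And>u z. u \<in> U \<Longrightarrow> z \<in> pts circle \<Longrightarrow> prj L (\<Phi> (u, z)) = u"
    "\<And>u z. u \<in> U \<Longrightarrow> z \<in> pts circle \<Longrightarrow> \<Phi> (u, z) = rac L (\<Phi> (u, 1)) z"
    by (rule local_trivialization[OF fibre_bundle m]) blast
  let ?B = "subspace_of (ob R) U"
  let ?\<sigma> = "\<lambda>u. \<Phi> (u, 1)"
  have ptsB: "pts ?B = U" using tr(3) by auto
  have s\<sigma>: "smooth_map ?B (tot L) ?\<sigma>"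
    by (rule smooth_map_compose[OF smooth_map_compose[OF smooth_map_Pair[OF saturated_subspace_of smooth_map_id
        smooth_map_const[OF saturated_subspace_of one_in_circle]] tr(4)] smooth_map_inclusion])
  have se: "smooth_map ?B (ar R) (\<lambda>u. unit_circle u z)"
    unfolding unit_circle_map_def
    using smooth_map_compose[OF smooth_map_Pair[OF saturated_subspace_of smooth_map_const[OF saturated_subspace_of z]
        smooth_map_from_subspace[OF smooth_idn]] principal_bundle_smooth[OF extension_bundle]] by simp
  have "smooth_map ?B (act_space R L) (\<lambda>u. (unit_circle u z, ?\<sigma> u))"
    unfolding act_space_def
    by (rule smooth_map_into_subspace[OF saturated_subspace_of smooth_map_Pair[OF saturated_subspace_of se s\<sigma>]])
      (use tr(3,8) tgt_unit_circle[OF _ z] one_in_circle in auto)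
  from smooth_map_compose[OF this smooth_lac]
  have sl: "smooth_map ?B (tot L) (\<lambda>u. lac L (unit_circle u z) (?\<sigma> u))" by simp
  have lac: "lac L (unit_circle u z) (?\<sigma> u) = \<Phi> (u, z powi weight u)" if u: "u \<in> U" for u
  proof -
    have "has_weight u (weight u)" using has_weight_weight tr(3) u by blast
    then show ?thesis
      using tr(7,8)[OF u one_in_circle] tr(9)[OF u circle_powi[OF z]] z unfolding has_weight_def by simp
  qed
  have "smooth_map ?B (subspace_of (tot L) {x. prj L x \<in> U}) (\<lambda>u. lac L (unit_circle u z) (?\<sigma> u))"
    by (rule smooth_map_into_subspace[OF saturated_subspace_of sl])
      (use lac tr(8) circle_powi[OF z] ptsB in auto)
  from smooth_map_compose[OF smooth_map_compose[OF this tr(5)] smooth_map_snd]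
  have "(\<lambda>u. h (snd (\<Psi> (lac L (unit_circle u z) (?\<sigma> u))))) \<in> fns ?B"
    by (rule smooth_map_fns[OF _ h])
  then obtain f W where f: "f \<in> fns (ob R)" "openin (dtop (ob R)) W" "m \<in> W" "W \<subseteq> U"
    "\<And>u. u \<in> W \<Longrightarrow> h (snd (\<Psi> (lac L (unit_circle u z) (?\<sigma> u)))) = f u"
    by (rule fns_open_subspace_extend[OF saturated_spaces(2) tr(1) _ tr(2)]) blast
  have "h (z powi weight u) = f u" if "u \<in> W" for u
  proof -
    have u: "u \<in> U" using that f(4) by blast
    show ?thesis using f(5)[OF that] lac[OF u] tr(6)[OF u circle_powi[OF z]] by simp
  qed
  then show "\<exists>f\<in>fns (ob R). \<exists>W. openin (dtop (ob R)) W \<and> m \<in> W \<and> (\<forall>u\<in>W. h (z powi weight u) = f u)"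
    using f by blast
qed simp

lemma weight_orbit:
  assumes x: "x \<in> pts (ob R)" and y: "y \<in> pts (ob R)" and o: "orbit \<Gamma> x = orbit \<Gamma> y"
  shows "weight x = weight y"
proof -
  have "idn \<Gamma> y \<in> pts (ar \<Gamma>)" "src \<Gamma> (idn \<Gamma> y) = y" "tgt \<Gamma> (idn \<Gamma> y) = y"
    using lie_groupoid_base y ob_eq smooth_map_pts[of "ob \<Gamma>" "ar \<Gamma>" "idn \<Gamma>" y]
    by (simp_all add: lie_groupoid_def)
  then have "y \<in> orbit \<Gamma> y" unfolding orbit_def by (intro CollectI exI[of _ "idn \<Gamma> y"]) simp
  then have "y \<in> orbit \<Gamma> x" by (simp only: o)
  then obtain g where g: "g \<in> pts (ar \<Gamma>)" "src \<Gamma> g = x" "tgt \<Gamma> g = y"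
    unfolding orbit_def by auto
  obtain r where r: "r \<in> pts (ar R)" "\<pi> r = g"
    using principal_bundle_surj[OF extension_bundle g(1)] by blast
  have "src R r = x" "tgt R r = y" using src_\<pi>[OF r(1)] tgt_\<pi>[OF r(1)] r(2) g by simp_all
  then show ?thesis using has_weight_invariant[OF r(1)] has_weight_weight x y by blast
qed

text \<open>A connected set of reals is a singleton or uncountable, whereas powers of \<open>z\<close> are countably many.
  The real and imaginary parts are treated separately.\<close>

lemma weight_constant:
  assumes conn: "connected_space (orbit_space \<Gamma>)" and x: "x \<in> pts (ob R)" and y: "y \<in> pts (ob R)"
  shows "weight x = weight y"
proof -
  obtain z where z: "z \<in> pts circle" "\<And>j k :: int. z powi j = z powi k \<Longrightarrow> j = k"
    by (rule circle_element_of_infinite_order) blast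
  have const: "h (z powi weight x) = h (z powi weight y)" if h: "h \<in> fns circle" for h
  proof -
    let ?f = "\<lambda>m. h (z powi weight m)"
    have f: "continuous_map (dtop (ob \<Gamma>)) euclideanreal ?f"
      using continuous_map_fns[OF fns_weight[OF z(1) h]] ob_eq by simp
    have "?f x = ?f y" if "x \<in> topspace (dtop (ob \<Gamma>))" "y \<in> topspace (dtop (ob \<Gamma>))" "orbit \<Gamma> x = orbit \<Gamma> y" for x y
      using weight_orbit[of x y] that ob_eq by simp
    then obtain F where F: "continuous_map (orbit_space \<Gamma>) euclideanreal F"
      "F ` topspace (orbit_space \<Gamma>) = ?f ` topspace (dtop (ob \<Gamma>))"
      by (rule quotient_map_lift_exists[OF quotient_map_orbit_space f]) blast
    have "connected (?f ` pts (ob R))"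
      using connectedin_continuous_map_image[OF F(1), of "topspace (orbit_space \<Gamma>)"] conn F(2) ob_eq
      by (simp add: connectedin_topspace)
    moreover have "countable (?f ` pts (ob R))"
      by (rule countable_subset[of _ "range (\<lambda>k::int. h (z powi k))"]) auto
    ultimately show ?thesis using connected_uncountable x y by blast
  qed
  have "z powi weight x = z powi weight y"
    using const[OF Re_Im_in_fns_circle(1)] const[OF Re_Im_in_fns_circle(2)] by (simp add: complex_eq_iff)
  then show ?thesis by (rule z(2))
qed

lemma Ind_eq_weight:
  assumes "connected_space (orbit_space \<Gamma>)" "m \<in> pts (ob R)"
  shows "Ind R act L = weight m"
  unfolding Ind_def
proof (rule the_equality)
  have *: "Ind_at R act L x = weight x" if "x \<in> pts (ob R)" for x
    by (rule Ind_at_eq_weight[OF that has_weight_weight[OF that]])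
  then show "\<forall>x\<in>pts (ob R). Ind_at R act L x = weight m"
    using weight_constant[OF assms(1) _ assms(2)] by simp
  show "k = weight m" if "\<forall>x\<in>pts (ob R). Ind_at R act L x = k" for k
    using that * assms(2) by simp
qed

section \<open>Integrating the pseudo-curvature\<close>

text \<open>Invariance makes the integrand of the loop integral over an orbit constant, so it equals the integral.\<close>

lemma pseudo_connection_fundamental_vector:
  assumes \<theta>L: "pseudo_connection L \<theta>L" and l: "l \<in> pts (tot L)"
  shows "\<theta>L (rac L l (cis (2 * pi * s))) [velocity (tot L) (\<lambda>u. rac L l (cis (2 * pi * u))) s] = 1"
proof -
  let ?V = "\<lambda>s. velocity (tot L) (\<lambda>u. rac L l (cis (2 * pi * u))) s"
  have sm: "smooth_map circle (tot L) (rac L l)"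
    using principal_bundle_smooth_orbit[OF fibre_bundle l] by simp
  have rl1: "rac L l 1 = l" using principal_bundle_one[OF fibre_bundle l] by simp
  have V0: "?V 0 \<in> tangent (tot L) l"
    using velocity_loop_tangent[OF saturated_spaces(3) sm, of "2 * pi" 0] rl1 by simp
  have inv: "\<theta>L (rac L l (cis (2 * pi * s))) [?V s] = \<theta>L l [?V 0]" for s
  proof -
    let ?z = "cis (2 * pi * s)"
    have "smooth_map (tot L) (tot L) (\<lambda>y. rac L y ?z)"
      using smooth_map_compose[OF smooth_map_Pair[OF saturated_spaces(3) smooth_map_const[OF saturated_spaces(3) cis_in_circle] smooth_map_id]
          principal_bundle_smooth[OF fibre_bundle]] by simp
    then have "dmap (tot L) (\<lambda>y. rac L y ?z) (?V 0) = velocity (tot L) (\<lambda>u. rac L (rac L l (cis (2 * pi * u))) ?z) 0"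
      by (rule dmap_velocity)
    also have "(\<lambda>u. rac L (rac L l (cis (2 * pi * u))) ?z) = (\<lambda>u. rac L l (cis (2 * pi * (s + u))))"
      by (intro ext, subst rac_rac) (simp_all add: l cis_mult ring_distribs add.commute)
    also have "velocity (tot L) (\<lambda>u. rac L l (cis (2 * pi * (s + u)))) 0 = ?V s"
      by (rule velocity_shift)
    finally have "dmap (tot L) (\<lambda>y. rac L y ?z) (?V 0) = ?V s" .
    moreover have "form_eq (tot L) 1 (pullback (tot L) (\<lambda>y. rac L y ?z) \<theta>L) \<theta>L"
      using \<theta>L unfolding pseudo_connection_def by simp
    then have "pullback (tot L) (\<lambda>y. rac L y ?z) \<theta>L l [?V 0] = \<theta>L l [?V 0]"
      using l V0 unfolding form_eq_def by simp
    ultimately show ?thesis by (simp add: pullback_def)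
  qed
  have "loop_integral (tot L) (rac L l) \<theta>L = 1"
    using \<theta>L l unfolding pseudo_connection_def by simp
  then have "\<theta>L l [?V 0] = 1" unfolding loop_integral_def inv by simp
  then show ?thesis using inv by simp
qed

text \<open>Both sides of the identity that defines the pseudo-curvature are evaluated on the velocity of the loop
  \<open>z \<mapsto> (unit_circle m z, l)\<close>: it is mapped by the target to zero and by the source to the velocity of
  \<open>z \<mapsto> rac L l (z powi k)\<close>, which is \<open>k\<close> times the fundamental vector.\<close>

lemma pseudo_curvature_on_unit_circle:
  assumes m: "m \<in> pts (ob R)" and k: "has_weight m k"
    and \<theta>L: "pseudo_connection L \<theta>L" and \<theta>: "pseudo_curvature R L \<theta>L \<theta> \<omega>"
  shows "\<theta> (unit_circle m (cis (2 * pi * t))) [velocity (ar R) (\<lambda>u. unit_circle m (cis (2 * pi * u))) t] = of_int k"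
proof -
  obtain l where l: "l \<in> pts (tot L)" "prj L l = m" by (rule fibre_point[OF m])
  let ?T = "transformation_groupoid R L" and ?A = "act_space R L"
  let ?f = "\<lambda>z. (unit_circle m z, l)"
  let ?w = "velocity ?A (\<lambda>u. ?f (cis (2 * pi * u))) t" and ?x = "?f (cis (2 * pi * t))"
  have A: "saturated ?A" by (simp add: act_space_def)
  have sm_fst: "smooth_map ?A (ar R) fst" and sm_snd: "smooth_map ?A (tot L) snd"
    unfolding act_space_def by (rule smooth_map_from_subspace[OF smooth_map_fst] smooth_map_from_subspace[OF smooth_map_snd])+
  have sf: "smooth_map circle ?A ?f" by (rule smooth_unit_circle_point[OF l m])
  have w: "?w \<in> tangent ?A ?x" by (rule velocity_loop_tangent[OF A sf])
  have x: "?x \<in> pts ?A" by (rule smooth_map_pts[OF sf cis_in_circle])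
  have "form_eq ?A 1 (sub_form (bd0 ?T \<theta>L) (ext_d ?A 0 zero_form)) (pullback (ar R) fst \<theta>)"
    using \<theta> unfolding pseudo_curvature_def cochain2_eq_def delta1_def cochain2_pullback_def
    by (simp add: transformation_groupoid_def)
  then have "sub_form (bd0 ?T \<theta>L) (ext_d ?A 0 zero_form) ?x [?w] = pullback (ar R) fst \<theta> ?x [?w]"
    using w x unfolding form_eq_def by (simp del: One_nat_def)
  moreover have "ext_d ?A 0 zero_form ?x [?w] = 0"
    using tangent_const[OF A w, of 0] by (simp add: ext_d_def zero_form_def)
  moreover have "pullback (ar R) fst \<theta> ?x [?w] =
      \<theta> (unit_circle m (cis (2 * pi * t))) [velocity (ar R) (\<lambda>u. unit_circle m (cis (2 * pi * u))) t]"
    using dmap_velocity[OF sm_fst] by (simp add: pullback_def)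
  moreover have "pullback (tot L) snd \<theta>L ?x [?w] = 0"
    using dmap_velocity[OF sm_snd] diff_form_1_zero[OF _ l(1), of \<theta>L] \<theta>L
    by (simp add: pullback_def pseudo_connection_def)
  moreover have "pullback (tot L) (\<lambda>(g, l). lac L g l) \<theta>L ?x [?w] = of_int k"
  proof -
    let ?V = "\<lambda>s. velocity (tot L) (\<lambda>u. rac L l (cis (2 * pi * u))) s"
    have lac: "lac L (unit_circle m (cis (2 * pi * u))) l = rac L l (cis (2 * pi * (of_int k * u)))" for u
      using k l unfolding has_weight_def by (simp add: cis_power_int mult.left_commute)
    have sm: "smooth_map circle (tot L) (rac L l)"
      using principal_bundle_smooth_orbit[OF fibre_bundle l(1)] by simp
    have V: "?V s \<in> tangent (tot L) (rac L l (cis (2 * pi * s)))" for s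
      by (rule velocity_loop_tangent[OF saturated_spaces(3) sm])
    have "velocity (tot L) (\<lambda>u. rac L l (cis (2 * pi * (of_int k * u)))) t = (\<lambda>g. of_int k * ?V (of_int k * t) g)"
    proof
      fix g
      show "velocity (tot L) (\<lambda>u. rac L l (cis (2 * pi * (of_int k * u)))) t g = of_int k * ?V (of_int k * t) g"
      proof (cases "g \<in> fns (tot L)")
        case True
        let ?q = "\<lambda>u. g (rac L l (cis (2 * pi * u)))"
        have "(?q has_real_derivative deriv ?q (of_int k * t)) (at (of_int k * t))"
          using smooth_loop_differentiable[OF sm True] DERIV_deriv_iff_real_differentiable by blast
        then have "((\<lambda>u. ?q (of_int k * u)) has_real_derivative deriv ?q (of_int k * t) * of_int k) (at t)"
          by (rule DERIV_chain2[where f = ?q and g = "\<lambda>u. of_int k * u"]) (auto intro!: derivative_eq_intros)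
        then show ?thesis using True by (simp add: velocity_def DERIV_imp_deriv mult.commute)
      qed (simp add: velocity_def)
    qed
    moreover have "\<theta>L (rac L l (cis (2 * pi * (of_int k * t)))) [\<lambda>g. of_int k * ?V (of_int k * t) g] = of_int k"
      using diff_form_1_scale[OF _ rac_pts[OF cis_in_circle l(1)] V, of \<theta>L]
        pseudo_connection_fundamental_vector[OF \<theta>L l(1)] \<theta>L
      by (simp add: pseudo_connection_def)
    ultimately show ?thesis
      using dmap_velocity[OF smooth_lac] by (simp add: pullback_def lac)
  qed
  ultimately show ?thesis
    by (simp add: sub_form_def bd0_def transformation_groupoid_def)
qed

text \<open>The first representative lies in its own class, by means of the zero cochain, hence in the
  class of the second.\<close>

lemma dR_class_eq_imp_cohomologous:
  assumes \<theta>: "diff_form (ar R) 1 \<theta>" and \<omega>: "diff_form (ob R) 2 \<omega>"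
    and eq: "dR_class R (\<omega>, \<theta>, zero_form) = dR_class R (\<omega>', \<theta>', zero_form)"
  obtains \<alpha> f where "diff_form (ob R) 1 \<alpha>" "diff_form (ar R) 0 f"
    "form_eq (ar R) 1 \<theta> (add_form \<theta>' (sub_form (bd0 R \<alpha>) (ext_d (ar R) 0 f)))"
proof -
  have ar2: "saturated (ar2 R)" by (simp add: ar2_def)
  have d: "form_eq (ob R) 2 (ext_d (ob R) 1 zero_form) zero_form"
    by (rule form_eq_ext_d_zero_form[OF manifold_ob])
  have "cochain2_eq R (\<omega>, \<theta>, zero_form) (cochain2_add (\<omega>, \<theta>, zero_form) (delta1 R (zero_form, zero_form)))"
  proof -
    have "hd vs (\<lambda>y. 0) = 0" if "length vs = 1" "set vs \<subseteq> tangent (ar R) x" for x and vs :: "'r tvec list"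
    proof -
      have "vs \<noteq> []" using that(1) by auto
      then have "hd vs \<in> tangent (ar R) x" using that(2) hd_in_set by blast
      then show ?thesis by (rule tangent_const[OF saturated_spaces(1)])
    qed
    then show ?thesis
      using d by (auto simp: cochain2_eq_def cochain2_add_def delta1_def form_eq_def add_form_def sub_form_def
          bd0_def bd1_def pullback_def zero_form_def ext_d_def[of "ar R" 0])
  qed
  then have "(\<omega>, \<theta>, zero_form) \<in> dR_class R (\<omega>, \<theta>, zero_form)"
    unfolding dR_class_def using \<theta> \<omega> ar2
    by (intro CollectI conjI exI[of _ "(zero_form, zero_form)"]) (simp_all add: is_cochain2_def is_cochain1_def diff_form_zero_form)
  then have "\<exists>b. is_cochain1 R b \<and> cochain2_eq R (\<omega>, \<theta>, zero_form) (cochain2_add (\<omega>', \<theta>', zero_form) (delta1 R b))"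
    unfolding eq by (simp add: dR_class_def)
  then obtain \<alpha> f where "is_cochain1 R (\<alpha>, f)"
    "cochain2_eq R (\<omega>, \<theta>, zero_form) (cochain2_add (\<omega>', \<theta>', zero_form) (delta1 R (\<alpha>, f)))"
    by (metis prod.exhaust)
  then show thesis
    by (intro that[of \<alpha> f]) (auto simp: is_cochain1_def cochain2_eq_def cochain2_add_def delta1_def)
qed

text \<open>Along the unit circle \<open>\<theta>\<close> is the constant \<open>k\<close> up to the derivative of a periodic function.\<close>

lemma loop_integral_unit_circle:
  assumes m: "m \<in> pts (ob R)" and k: "has_weight m k"
    and \<theta>: "diff_form (ar R) 1 \<theta>" and \<omega>: "diff_form (ob R) 2 \<omega>"
    and chern: "has_chern_class R L (dR_class R (\<omega>, \<theta>, zero_form))"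
  shows "loop_integral (ar R) (unit_circle m) \<theta> = of_int k"
proof -
  obtain \<theta>L \<theta>' \<omega>' where \<theta>L: "pseudo_connection L \<theta>L" and \<theta>': "pseudo_curvature R L \<theta>L \<theta>' \<omega>'"
    and eq: "dR_class R (\<omega>, \<theta>, zero_form) = dR_class R (\<omega>', \<theta>', zero_form)"
    using chern unfolding has_chern_class_def by blast
  obtain \<alpha> f where \<alpha>: "diff_form (ob R) 1 \<alpha>" and f: "diff_form (ar R) 0 f"
    and coh: "form_eq (ar R) 1 \<theta> (add_form \<theta>' (sub_form (bd0 R \<alpha>) (ext_d (ar R) 0 f)))"
    by (rule dR_class_eq_imp_cohomologous[OF \<theta> \<omega> eq])
  have sm: "smooth_map circle (ar R) (unit_circle m)" by (rule smooth_unit_circle[OF m])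
  let ?c = "\<lambda>u. unit_circle m (cis (2 * pi * u))"
  let ?q = "\<lambda>u. f (?c u) []"
  have q: "(?q has_real_derivative deriv ?q t) (at t)" for t
    using smooth_loop_differentiable[OF sm diff_form_0_fns[OF f]] DERIV_deriv_iff_real_differentiable by blast
  have val: "\<theta> (?c t) [velocity (ar R) ?c t] = of_int k - deriv ?q t" for t
  proof -
    let ?v = "velocity (ar R) ?c t"
    have v: "?v \<in> tangent (ar R) (?c t)" by (rule velocity_loop_tangent[OF saturated_spaces(1) sm])
    have c: "?c t \<in> pts (ar R)" by (rule smooth_map_pts[OF sm cis_in_circle])
    have "\<theta> (?c t) [?v] = add_form \<theta>' (sub_form (bd0 R \<alpha>) (ext_d (ar R) 0 f)) (?c t) [?v]"
      using coh v c unfolding form_eq_def by (simp del: One_nat_def)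
    moreover have "\<theta>' (?c t) [?v] = of_int k"
      by (rule pseudo_curvature_on_unit_circle[OF m k \<theta>L \<theta>'])
    moreover have "dmap (ob R) (src R) ?v = (\<lambda>g. 0)" "dmap (ob R) (tgt R) ?v = (\<lambda>g. 0)"
      using dmap_velocity[OF smooth_src] dmap_velocity[OF smooth_tgt]
      by (simp_all add: src_unit_circle[OF m] tgt_unit_circle[OF m])
    then have "bd0 R \<alpha> (?c t) [?v] = 0"
      using diff_form_1_zero[OF \<alpha> m]
      by (simp add: bd0_def sub_form_def pullback_def src_unit_circle[OF m] tgt_unit_circle[OF m])
    moreover have "ext_d (ar R) 0 f (?c t) [?v] = deriv ?q t"
      using diff_form_0_fns[OF f] by (simp add: ext_d_def velocity_def)
    ultimately show ?thesis by (simp add: add_form_def sub_form_def)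
  qed
  have "((\<lambda>t. deriv ?q t) has_integral ?q 1 - ?q 0) {0..1}"
    by (rule fundamental_theorem_of_calculus)
      (use q in \<open>auto simp: has_real_derivative_iff_has_vector_derivative[symmetric] intro: has_field_derivative_at_within\<close>)
  then have "((\<lambda>t. deriv ?q t) has_integral 0) {0..1}" by simp
  moreover have "((\<lambda>t::real. of_int k) has_integral (of_int k :: real)) {0..1}"
    using has_integral_const_real[of "of_int k :: real" 0 1] by simp
  ultimately have "((\<lambda>t. of_int k - deriv ?q t) has_integral of_int k - 0) {0..1}"
    by (intro has_integral_diff)
  then show ?thesis unfolding loop_integral_def val by (simp add: integral_unique)
qed

end

theorem proposition3p8:
  fixes \<Gamma> :: "('m, 'g) groupoid" and R :: "('m, 'r) groupoid"
    and \<pi> :: "'r \<Rightarrow> 'g" and act :: "complex \<Rightarrow> 'r \<Rightarrow> 'r"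
    and L :: "('m, 'r, 'l) circle_bundle"
    and \<theta> :: "'r form" and \<omega> :: "'m form" and m :: 'm
  assumes "circle_central_extension \<Gamma> R \<pi> act"
    and "path_connected_space (orbit_space \<Gamma>)"
    and "groupoid_circle_bundle R L"
    and "diff_form (ar R) 1 \<theta>" and "diff_form (ob R) 2 \<omega>"
    and "dR_class R (\<omega>, \<theta>, zero_form) \<in> H2_dR_int R"
    and "has_chern_class R L (dR_class R (\<omega>, \<theta>, zero_form))"
    and "m \<in> pts (ob R)"
  shows "real_of_int (Ind R act L) =
    circle_integral (ar R) {x \<in> pts (ar R). \<pi> x = idn \<Gamma> m} (unit_circle_map R act m) \<theta>"
proof -
  interpret bundle_over_extension \<Gamma> R \<pi> act L
    using assms(1,3) by unfold_locales
  have "diffeo circle (subspace_of (ar R) {x \<in> pts (ar R). \<pi> x = idn \<Gamma> m}) (unit_circle_map R act m)"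
    using principal_bundle_orbit_diffeo[OF extension_bundle idn_pts[OF assms(8)]] \<pi>_idn[OF assms(8)]
    by (simp add: unit_circle_map_def)
  moreover have "Ind R act L = weight m"
    by (rule Ind_eq_weight[OF path_connected_imp_connected_space[OF assms(2)] assms(8)])
  moreover have "loop_integral (ar R) (unit_circle_map R act m) \<theta> = of_int (weight m)"
    by (rule loop_integral_unit_circle[OF assms(8) has_weight_weight[OF assms(8)] assms(4,5,7)])
  ultimately show ?thesis by (simp add: circle_integral_def)
qed

end
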